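(* Let $M$ be a three-dimensional manifold with sub-Riemannian contact structure $(H,g)$ and a contact form $\theta$ normalised by $\|\Omega\|^2=2$, where $\Omega=d\theta|_H$. Let $\nabla$ be the full connection on $\Lambda^1=T^*M$ obtained by promoting the canonical partial connection $\nabla_H$ of $(H,g)$, let $\nabla^{TW}$ be the Tanaka-Webster connection on $\Lambda^1$, and let $R$ be the Tanaka-Webster curvature function. With respect to the splitting $\Lambda^1=\Lambda^1_H\oplus\Lambda^0$ given by the Reeb field of $\theta$, the difference $\nabla-\nabla^{TW}:\Lambda^1\to\Lambda^1\otimes\Lambda^1$ is the bundle homomorphism $$\begin{bmatrix}\sigma\\ \rho\end{bmatrix}\longmapsto\begin{bmatrix}R\,\theta\otimes J\sigma+\Omega\rho\\ 0\end{bmatrix},$$ that is, $(\nabla-\nabla^{TW})(\sigma+\rho\,\theta)=R\,\theta\otimes J\sigma+\rho\,\Omega$ for $\sigma\in\Gamma(\Lambda^1_H)$ and $\rho\in\Gamma(\Lambda^0)$.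
   Context: A contact distribution on a 3-manifold $M$ is a smooth rank-2 subbundle $H\subset TM$ with annihilator line bundle $L\subset\Lambda^1=T^*M$, such that every nowhere vanishing local section $\theta$ of $L$ (a contact form) satisfies $\theta\wedge d\theta\ne0$. A sub-Riemannian contact structure is such an $H$ with a smooth positive-definite symmetric bilinear form $g$ on $H$. Notation: $\Lambda^0$ is the trivial line bundle, whose sections are the smooth functions. $\Lambda^1_H=H^*=\Lambda^1/L$ and $\Lambda^2_H=\Lambda^2(\Lambda^1_H)$. For a 1-form $\alpha$, $\alpha_H$ denotes its image in $\Lambda^1_H$. $d_H$ denotes $d$ followed by restriction to $H$, as $\Lambda^0\to\Lambda^1_H$ and $\Lambda^1\to\Lambda^2_H$. The Reeb field $T$ of $\theta$ is the vector field with $\theta(T)=1$ and $d\theta(T,\cdot)=0$. It identifies $\Lambda^1_H$ with $\{\alpha\in\Lambda^1:\alpha(T)=0\}$, so that $\Lambda^1=\Lambda^1_H\oplus\Lambda^0$ via $\alpha\mapsto(\alpha_H,\alpha(T))$. Put $\Omega=d\theta|_H\in\Gamma(\Lambda^2_H)$. In a $g$-orthonormal frame $X_1,X_2$ of $H$, $\|\Omega\|^2=\sum_{i,j}\Omega(X_i,X_j)^2$, so $\|\Omega\|^2=2$ means $\Omega(X_1,X_2)=\pm1$. The endomorphism $J:H\to H$ given by $g(JX,Y)=\Omega(X,Y)$ satisfies $J^2=-\mathrm{Id}$, and it acts on $\Lambda^1_H$ by $(J\sigma)(X)=\sigma(JX)$. When a 2-form is regarded as a section of a tensor square (as with $\Omega\in\Lambda^1_H\otimes\Lambda^1_H$),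 the inclusion is the right inverse of $\phi\otimes\psi\mapsto\phi\wedge\psi$, namely $\phi\wedge\psi\mapsto\frac12(\phi\otimes\psi-\psi\otimes\phi)$. Canonical partial connection: a partial connection on a vector bundle $V$ is a linear differential operator $\nabla_H:V\to\Lambda^1_H\otimes V$ with $\nabla_H(f\sigma)=f\nabla_H\sigma+d_Hf\otimes\sigma$. Its extension to dual and tensor bundles is by the Leibniz rule. For $V=\Lambda^1$, its partial torsion is the difference between $d_H:\Lambda^1\to\Lambda^2_H$ and the composition $\Lambda^1\xrightarrow{\nabla_H}\Lambda^1_H\otimes\Lambda^1\to\Lambda^1_H\otimes\Lambda^1_H\xrightarrow{\wedge}\Lambda^2_H$. The canonical partial connection of $(H,g)$ is the unique partial connection on $\Lambda^1$ with $\nabla_HT=0$, $\nabla_H\theta=(d\theta)_H$, zero partial torsion, and $\nabla_Hg=0$. Here $(d\theta)_H$ is the image of $d\theta$ under $\Lambda^2\hookrightarrow\Lambda^1\otimes\Lambda^1\to\Lambda^1_H\otimes\Lambda^1$. Promotion: a partial connection $\nabla_H$ on $V$ determines an operator $\nabla_H:\Lambda^1\otimes V\to\Lambda^2_H\otimes V$ by $\nabla_H(\alpha\otimes\sigma)=d_H\alpha\otimes\sigma-\alpha_H\wedge\nabla_H\sigma$. In dimension three, the promoted connection is the unique full connection $\nabla$ on $V$ such that $V\xrightarrow{\nabla}\Lambda^1\otimes V\to\Lambda^1_H\otimes V$ equals $\nabla_H$ and the composition $V\xrightarrow{\nabla}\Lambda^1\otimes V\xrightarrow{\nabla_H}\Lambda^2_H\otimes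 V$ vanishes. Tanaka-Webster connection: choose local co-frames $\theta,e_1,e_2$ with $d\theta=e_1\wedge e_2$ and $Je_2=e_1$ (then $e_1(T)=e_2(T)=0$ and $g=e_1\otimes e_1+e_2\otimes e_2$). There are a unique 1-form $\omega$ and unique functions $A,B$ with $de_1=\omega\wedge e_2+A\,\theta\wedge e_1+B\,\theta\wedge e_2$ and $de_2=-\omega\wedge e_1+B\,\theta\wedge e_1-A\,\theta\wedge e_2$. The Tanaka-Webster connection is given by $\nabla^{TW}\theta=0$, $\nabla^{TW}e_1=\omega\otimes e_2$, $\nabla^{TW}e_2=-\omega\otimes e_1$, independently of the choice of co-frame. The Tanaka-Webster curvature $R$ is the function defined by $d\omega\wedge\theta=R\,\theta\wedge e_1\wedge e_2$. *)

theory Defs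
  imports "HOL-Analysis.Analysis" "HOL-Library.Function_Algebras"
begin

section \<open>Functions as real vectors\<close>

text \<open>Tangent vectors and differential forms are functions below; addition is the pointwise one
  of \<^theory>\<open>HOL-Library.Function_Algebras\<close>, to which we add scalar multiplication.\<close>

instantiation "fun" :: (type, scaleR) scaleR
begin
definition scaleR_fun_def: "scaleR c f = (\<lambda>x. c *\<^sub>R f x)"
instance ..
end

instance "fun" :: (type, real_vector) real_vector
  by standard (auto simp: scaleR_fun_def fun_eq_iff algebra_simps)


section \<open>Smooth three-dimensional manifolds\<close>

primrec Ck_on :: "nat \<Rightarrow> 'b::real_normed_vector set \<Rightarrow> ('b \<Rightarrow> 'c::real_normed_vector) \<Rightarrow> bool" where
  "Ck_on 0 = (\<lambda>S f. continuous_on S f)"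
| "Ck_on (Suc k) = (\<lambda>S f. (\<forall>x\<in>S. f differentiable (at x)) \<and>
      (\<forall>h. Ck_on k S (\<lambda>x. frechet_derivative f (at x) h)))"

text \<open>Only used for open subsets of finite-dimensional spaces, where it is the usual
  C-infinity condition.\<close>

definition smooth_on :: "'b::real_normed_vector set \<Rightarrow> ('b \<Rightarrow> 'c::real_normed_vector) \<Rightarrow> bool" where
  "smooth_on S f \<longleftrightarrow> (\<forall>k. Ck_on k S f)"

text \<open>A manifold is a type; its charts are pairs of an open domain and a coordinate map.  The
  values of a coordinate map outside its domain are irrelevant.\<close>

class smooth_3_manifold = t2_space + second_countable_topology +
  fixes atlas :: "('a set \<times> ('a \<Rightarrow> real^3)) set"
  assumes atlas_cover: "\<exists>V \<phi>. (V, \<phi>) \<in> atlas \<and> p \<in> V"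
    and chart_domain_open: "(V, \<phi>) \<in> atlas \<Longrightarrow> open V"
    and chart_inj: "(V, \<phi>) \<in> atlas \<Longrightarrow> inj_on \<phi> V"
    and chart_open_iff: "(V, \<phi>) \<in> atlas \<Longrightarrow> S \<subseteq> V \<Longrightarrow> open S \<longleftrightarrow> open (\<phi> ` S)"
    and chart_transition: "(V, \<phi>) \<in> atlas \<Longrightarrow> (V', \<phi>') \<in> atlas \<Longrightarrow>
      smooth_on (\<phi> ` (V \<inter> V')) (\<phi>' \<circ> inv_into V \<phi>)"

text \<open>The axioms other than the first and the last say that charts are homeomorphisms onto open subsets; they avoid the
  constant \<^const>\<open>homeomorphism\<close>, which cannot be used at the type of a class being declared.\<close>

lemma chart_homeomorphism:
  fixes \<phi> :: "'a::smooth_3_manifold \<Rightarrow> real^3"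
  assumes "(V, \<phi>) \<in> atlas"
  shows "open (\<phi> ` V)" and "homeomorphism V (\<phi> ` V) \<phi> (inv_into V \<phi>)"
proof -
  note V = chart_domain_open[OF assms] and inj = chart_inj[OF assms] and op = chart_open_iff[OF assms]
  show op': "open (\<phi> ` V)"
    using V op by blast
  have "continuous_on V \<phi>"
  proof (subst continuous_on_open_vimage[OF V], intro allI impI)
    fix B :: "(real^3) set" assume B: "open B"
    have "\<phi> ` (\<phi> -` B \<inter> V) = B \<inter> \<phi> ` V" by auto
    then show "open (\<phi> -` B \<inter> V)"
      using op[of "\<phi> -` B \<inter> V"] B op' by (auto simp: open_Int)
  qed
  moreover have "continuous_on (\<phi> ` V) (inv_into V \<phi>)"
  proof (subst continuous_on_open_vimage[OF op'], intro allI impI)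
    fix B :: "'a set" assume B: "open B"
    have "inv_into V \<phi> -` B \<inter> \<phi> ` V = \<phi> ` (B \<inter> V)"
      using inj by (auto simp: inv_into_f_f)
    then show "open (inv_into V \<phi> -` B \<inter> \<phi> ` V)"
      using op[of "B \<inter> V"] B V by (auto simp: open_Int)
  qed
  ultimately show "homeomorphism V (\<phi> ` V) \<phi> (inv_into V \<phi>)"
    using inj by (auto simp: homeomorphism_def inv_into_f_f image_iff f_inv_into_f intro!: bexI)
qed

definition smooth_fun :: "'a::smooth_3_manifold set \<Rightarrow> ('a \<Rightarrow> real) \<Rightarrow> bool" where
  "smooth_fun U f \<longleftrightarrow> (\<forall>(V, \<phi>)\<in>atlas. smooth_on (\<phi> ` (U \<inter> V)) (f \<circ> inv_into V \<phi>))"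

definition smooth_near :: "'a::smooth_3_manifold \<Rightarrow> ('a \<Rightarrow> real) \<Rightarrow> bool" where
  "smooth_near p f \<longleftrightarrow> (\<exists>U. open U \<and> p \<in> U \<and> smooth_fun U f)"


section \<open>Tangent vectors, vector fields and forms\<close>

text \<open>A tangent vector at \<open>p\<close> is a directional derivative in a chart, acting on functions that are
  smooth near \<open>p\<close>.  On all other functions it is set to 0, so that a tangent vector is
  determined by its action on germs and does not depend on the chart used to express it.\<close>

type_synonym 'a tvec = "('a \<Rightarrow> real) \<Rightarrow> real"

definition chart_vec :: "'a::smooth_3_manifold set \<times> ('a \<Rightarrow> real^3) \<Rightarrow> 'a \<Rightarrow> real^3 \<Rightarrow> 'a tvec" where
  "chart_vec c p h = (\<lambda>f. if smooth_near p f
     then frechet_derivative (f \<circ> inv_into (fst c) (snd c)) (at (snd c p)) h else 0)"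

definition tangent_space :: "'a::smooth_3_manifold \<Rightarrow> 'a tvec set" where
  "tangent_space p = {v. \<exists>c\<in>atlas. p \<in> fst c \<and> (\<exists>h. v = chart_vec c p h)}"

definition vector_field :: "'a::smooth_3_manifold set \<Rightarrow> ('a \<Rightarrow> 'a tvec) \<Rightarrow> bool" where
  "vector_field U X \<longleftrightarrow> (\<forall>p\<in>U. X p \<in> tangent_space p) \<and>
     (\<forall>V f. open V \<and> V \<subseteq> U \<and> smooth_fun V f \<longrightarrow> smooth_fun V (\<lambda>p. X p f))"

text \<open>The guard keeps the bracket at \<open>p\<close> inside the tangent space at \<open>p\<close>.\<close>

definition lie_bracket :: "('a::smooth_3_manifold \<Rightarrow> 'a tvec) \<Rightarrow> ('a \<Rightarrow> 'a tvec) \<Rightarrow> 'a \<Rightarrow> 'a tvec" where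
  "lie_bracket X Y p = (\<lambda>f. if smooth_near p f
     then X p (\<lambda>q. Y q f) - Y p (\<lambda>q. X q f) else 0)"

definition linear_on_set :: "'v::real_vector set \<Rightarrow> ('v \<Rightarrow> real) \<Rightarrow> bool" where
  "linear_on_set S F \<longleftrightarrow> (\<forall>x\<in>S. \<forall>y\<in>S. F (x + y) = F x + F y) \<and>
     (\<forall>c. \<forall>x\<in>S. F (c *\<^sub>R x) = c * F x)"

text \<open>Forms and tensors are total functions of which only the values on tangent vectors at points
  of the given open set matter.\<close>

type_synonym 'a form1 = "'a \<Rightarrow> 'a tvec \<Rightarrow> real"
type_synonym 'a form2 = "'a \<Rightarrow> 'a tvec \<Rightarrow> 'a tvec \<Rightarrow> real"
type_synonym 'a form3 = "'a \<Rightarrow> 'a tvec \<Rightarrow> 'a tvec \<Rightarrow> 'a tvec \<Rightarrow> real"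

definition one_form :: "'a::smooth_3_manifold set \<Rightarrow> 'a form1 \<Rightarrow> bool" where
  "one_form U \<alpha> \<longleftrightarrow> (\<forall>p\<in>U. linear_on_set (tangent_space p) (\<alpha> p)) \<and>
     (\<forall>V X. open V \<and> V \<subseteq> U \<and> vector_field V X \<longrightarrow> smooth_fun V (\<lambda>p. \<alpha> p (X p)))"

text \<open>Smooth sections over \<open>U\<close> of the tensor product of the duals of two subbundles \<open>E\<close>, \<open>F\<close> of the
  tangent bundle; the first argument belongs to the first tensor factor.\<close>

definition bilinear_section ::
  "('a::smooth_3_manifold \<Rightarrow> 'a tvec set) \<Rightarrow> ('a \<Rightarrow> 'a tvec set) \<Rightarrow> 'a set \<Rightarrow> 'a form2 \<Rightarrow> bool" where
  "bilinear_section E F U \<Phi> \<longleftrightarrow>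
     (\<forall>p\<in>U. (\<forall>w\<in>F p. linear_on_set (E p) (\<lambda>v. \<Phi> p v w)) \<and> (\<forall>v\<in>E p. linear_on_set (F p) (\<Phi> p v))) \<and>
     (\<forall>V X Y. open V \<and> V \<subseteq> U \<and> vector_field V X \<and> vector_field V Y \<and>
        (\<forall>p\<in>V. X p \<in> E p \<and> Y p \<in> F p) \<longrightarrow> smooth_fun V (\<lambda>p. \<Phi> p (X p) (Y p)))"

definition fun_form :: "('a \<Rightarrow> real) \<Rightarrow> 'a form1 \<Rightarrow> 'a form1" where
  "fun_form f \<alpha> = (\<lambda>p v. f p * \<alpha> p v)"

definition tensor :: "'a form1 \<Rightarrow> 'a form1 \<Rightarrow> 'a form2" where
  "tensor \<alpha> \<beta> = (\<lambda>p v w. \<alpha> p v * \<beta> p w)"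

definition wedge :: "'a form1 \<Rightarrow> 'a form1 \<Rightarrow> 'a form2" where
  "wedge \<alpha> \<beta> = (\<lambda>p v w. \<alpha> p v * \<beta> p w - \<alpha> p w * \<beta> p v)"

definition wedge12 :: "'a form1 \<Rightarrow> 'a form2 \<Rightarrow> 'a form3" where
  "wedge12 \<alpha> \<beta> = (\<lambda>p u v w. \<alpha> p u * \<beta> p v w + \<alpha> p v * \<beta> p w u + \<alpha> p w * \<beta> p u v)"

definition wedge21 :: "'a form2 \<Rightarrow> 'a form1 \<Rightarrow> 'a form3" where
  "wedge21 \<beta> \<alpha> = (\<lambda>p u v w. \<beta> p u v * \<alpha> p w + \<beta> p v w * \<alpha> p u + \<beta> p w u * \<alpha> p v)"

text \<open>A 2-form as a section of the tensor square: with the above normalisation of the wedge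
  product, \<open>\<phi> \<and> \<psi> \<mapsto> (\<phi> \<otimes> \<psi> - \<psi> \<otimes> \<phi>) / 2\<close> halves the underlying bilinear map.\<close>

definition form2_tensor :: "'a form2 \<Rightarrow> 'a form2" where
  "form2_tensor \<beta> = (1/2) *\<^sub>R \<beta>"

text \<open>The exterior derivative of a 1-form, by the invariant formula
  \<open>d\<alpha>(X,Y) = X(\<alpha>(Y)) - Y(\<alpha>(X)) - \<alpha>([X,Y])\<close> for arbitrary local extensions
  \<open>X\<close>, \<open>Y\<close> of the two tangent vectors.\<close>

definition ext_d :: "'a::smooth_3_manifold form1 \<Rightarrow> 'a form2" where
  "ext_d \<alpha> = (\<lambda>p v w. THE c. \<forall>U X Y. open U \<and> p \<in> U \<and> vector_field U X \<and> vector_field U Y \<and>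
     X p = v \<and> Y p = w \<longrightarrow>
     c = v (\<lambda>q. \<alpha> q (Y q)) - w (\<lambda>q. \<alpha> q (X q)) - \<alpha> p (lie_bracket X Y p))"


section \<open>Sub-Riemannian contact structures\<close>

definition rank2_subbundle :: "('a::smooth_3_manifold \<Rightarrow> 'a tvec set) \<Rightarrow> bool" where
  "rank2_subbundle H \<longleftrightarrow> (\<forall>p. \<exists>U X Y. open U \<and> p \<in> U \<and> vector_field U X \<and> vector_field U Y \<and>
     (\<forall>q\<in>U. X q \<noteq> Y q \<and> independent {X q, Y q} \<and> H q = span {X q, Y q}))"

definition nonvanishing_annihilator ::
  "('a::smooth_3_manifold \<Rightarrow> 'a tvec set) \<Rightarrow> 'a set \<Rightarrow> 'a form1 \<Rightarrow> bool" where
  "nonvanishing_annihilator H U \<theta> \<longleftrightarrow> one_form U \<theta> \<and> (\<forall>p\<in>U. \<forall>v\<in>H p. \<theta> p v = 0) \<and>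
     (\<forall>p\<in>U. \<exists>v\<in>tangent_space p. \<theta> p v \<noteq> 0)"

definition contact_distribution :: "('a::smooth_3_manifold \<Rightarrow> 'a tvec set) \<Rightarrow> bool" where
  "contact_distribution H \<longleftrightarrow> rank2_subbundle H \<and>
     (\<forall>U \<theta>. open U \<and> nonvanishing_annihilator H U \<theta> \<longrightarrow>
       (\<forall>p\<in>U. \<exists>u\<in>tangent_space p. \<exists>v\<in>tangent_space p. \<exists>w\<in>tangent_space p.
          wedge12 \<theta> (ext_d \<theta>) p u v w \<noteq> 0))"

definition sub_riemannian_contact ::
  "('a::smooth_3_manifold \<Rightarrow> 'a tvec set) \<Rightarrow> 'a form2 \<Rightarrow> bool" where
  "sub_riemannian_contact H g \<longleftrightarrow> contact_distribution H \<and> bilinear_section H H UNIV g \<and>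
     (\<forall>p. \<forall>v\<in>H p. \<forall>w\<in>H p. g p v w = g p w v) \<and>
     (\<forall>p. \<forall>v\<in>H p. v \<noteq> 0 \<longrightarrow> g p v v > 0)"

text \<open>A contact form is a local object; \<open>W\<close> is its domain.  The squared norm of a 2-form is taken
  over both orderings of the indices.\<close>

definition normalised_contact_form ::
  "('a::smooth_3_manifold \<Rightarrow> 'a tvec set) \<Rightarrow> 'a form2 \<Rightarrow> 'a set \<Rightarrow> 'a form1 \<Rightarrow> bool" where
  "normalised_contact_form H g W \<theta> \<longleftrightarrow> nonvanishing_annihilator H W \<theta> \<and>
     (\<forall>p\<in>W. \<forall>X :: nat \<Rightarrow> 'a tvec.
        (\<forall>i<2. X i \<in> H p) \<and> (\<forall>i<2. \<forall>j<2. g p (X i) (X j) = (if i = j then 1 else 0)) \<longrightarrow>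
        (\<Sum>i<2. \<Sum>j<2. (ext_d \<theta> p (X i) (X j))\<^sup>2) = 2)"

definition reeb_field :: "'a::smooth_3_manifold set \<Rightarrow> 'a form1 \<Rightarrow> ('a \<Rightarrow> 'a tvec) \<Rightarrow> bool" where
  "reeb_field W \<theta> T \<longleftrightarrow> vector_field W T \<and>
     (\<forall>p\<in>W. \<theta> p (T p) = 1 \<and> (\<forall>v\<in>tangent_space p. ext_d \<theta> p (T p) v = 0))"

text \<open>The Reeb field identifies the dual of \<open>H\<close> with the forms that vanish on \<open>T\<close>, that is, a
  functional on \<open>H\<close> is extended by precomposition with the projection along \<open>T\<close>.\<close>

definition H_proj :: "'a form1 \<Rightarrow> ('a \<Rightarrow> 'a tvec) \<Rightarrow> 'a \<Rightarrow> 'a tvec \<Rightarrow> 'a tvec" where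
  "H_proj \<theta> T p v = v - \<theta> p v *\<^sub>R T p"

definition extend1 :: "'a form1 \<Rightarrow> ('a \<Rightarrow> 'a tvec) \<Rightarrow> 'a form1 \<Rightarrow> 'a form1" where
  "extend1 \<theta> T \<sigma> = (\<lambda>p v. \<sigma> p (H_proj \<theta> T p v))"

definition extend2 :: "'a form1 \<Rightarrow> ('a \<Rightarrow> 'a tvec) \<Rightarrow> 'a form2 \<Rightarrow> 'a form2" where
  "extend2 \<theta> T \<beta> = (\<lambda>p v w. \<beta> p (H_proj \<theta> T p v) (H_proj \<theta> T p w))"

definition horizontal_form :: "'a::smooth_3_manifold set \<Rightarrow> ('a \<Rightarrow> 'a tvec) \<Rightarrow> 'a form1 \<Rightarrow> bool" where
  "horizontal_form U T \<sigma> \<longleftrightarrow> one_form U \<sigma> \<and> (\<forall>p\<in>U. \<sigma> p (T p) = 0)"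

definition J_map ::
  "('a::smooth_3_manifold \<Rightarrow> 'a tvec set) \<Rightarrow> 'a form2 \<Rightarrow> 'a form1 \<Rightarrow> 'a \<Rightarrow> 'a tvec \<Rightarrow> 'a tvec" where
  "J_map H g \<theta> p v = (THE u. u \<in> H p \<and> (\<forall>w\<in>H p. g p u w = ext_d \<theta> p v w))"

definition J_form ::
  "('a::smooth_3_manifold \<Rightarrow> 'a tvec set) \<Rightarrow> 'a form2 \<Rightarrow> 'a form1 \<Rightarrow> 'a form1 \<Rightarrow> 'a form1" where
  "J_form H g \<theta> \<sigma> = (\<lambda>p v. \<sigma> p (J_map H g \<theta> p v))"


section \<open>Partial connections on the cotangent bundle\<close>

text \<open>The covariant derivative \<open>D \<alpha> p v w\<close> of the 1-form \<open>\<alpha>\<close> at \<open>p\<close> in direction \<open>v \<in> E p\<close>, evaluated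
  on \<open>w\<close>.  Differential operators act on local sections and commute with restriction to smaller
  open sets, which is the second clause; homogeneity over the reals follows from the last one.\<close>

definition partial_connection ::
  "('a::smooth_3_manifold \<Rightarrow> 'a tvec set) \<Rightarrow> 'a set \<Rightarrow> ('a form1 \<Rightarrow> 'a form2) \<Rightarrow> bool" where
  "partial_connection E W D \<longleftrightarrow>
     (\<forall>U \<alpha>. open U \<and> U \<subseteq> W \<and> one_form U \<alpha> \<longrightarrow> bilinear_section E tangent_space U (D \<alpha>)) \<and>
     (\<forall>U \<alpha> \<beta>. open U \<and> U \<subseteq> W \<and> one_form U \<alpha> \<and> one_form U \<beta> \<and>
        (\<forall>p\<in>U. \<forall>v\<in>tangent_space p. \<alpha> p v = \<beta> p v) \<longrightarrow>
        (\<forall>p\<in>U. \<forall>v\<in>E p. \<forall>w\<in>tangent_space p. D \<alpha> p v w = D \<beta> p v w)) \<and>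
     (\<forall>U \<alpha> \<beta>. open U \<and> U \<subseteq> W \<and> one_form U \<alpha> \<and> one_form U \<beta> \<longrightarrow>
        (\<forall>p\<in>U. \<forall>v\<in>E p. \<forall>w\<in>tangent_space p. D (\<alpha> + \<beta>) p v w = D \<alpha> p v w + D \<beta> p v w)) \<and>
     (\<forall>U f \<alpha>. open U \<and> U \<subseteq> W \<and> smooth_fun U f \<and> one_form U \<alpha> \<longrightarrow>
        (\<forall>p\<in>U. \<forall>v\<in>E p. \<forall>w\<in>tangent_space p.
           D (fun_form f \<alpha>) p v w = f p * D \<alpha> p v w + v f * \<alpha> p w))"

abbreviation connection :: "'a::smooth_3_manifold set \<Rightarrow> ('a form1 \<Rightarrow> 'a form2) \<Rightarrow> bool" where
  "connection \<equiv> partial_connection tangent_space"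

text \<open>The dual partial connection on the tangent bundle:
  \<open>\<alpha>(D\<^sub>v Y) = v(\<alpha>(Y)) - (D\<^sub>v \<alpha>)(Y)\<close> for all local 1-forms \<open>\<alpha>\<close>.\<close>

definition dual_deriv ::
  "'a::smooth_3_manifold set \<Rightarrow> ('a form1 \<Rightarrow> 'a form2) \<Rightarrow> ('a \<Rightarrow> 'a tvec) \<Rightarrow> 'a \<Rightarrow> 'a tvec \<Rightarrow> 'a tvec" where
  "dual_deriv W D Y p v = (THE u. u \<in> tangent_space p \<and>
     (\<forall>U \<alpha>. open U \<and> p \<in> U \<and> U \<subseteq> W \<and> one_form U \<alpha> \<longrightarrow>
        \<alpha> p u = v (\<lambda>q. \<alpha> q (Y q)) - D \<alpha> p v (Y p)))"

definition torsion_free_partial ::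
  "('a::smooth_3_manifold \<Rightarrow> 'a tvec set) \<Rightarrow> 'a set \<Rightarrow> ('a form1 \<Rightarrow> 'a form2) \<Rightarrow> bool" where
  "torsion_free_partial H W D \<longleftrightarrow> (\<forall>U \<alpha>. open U \<and> U \<subseteq> W \<and> one_form U \<alpha> \<longrightarrow>
     (\<forall>p\<in>U. \<forall>v\<in>H p. \<forall>w\<in>H p. ext_d \<alpha> p v w - (D \<alpha> p v w - D \<alpha> p w v) = 0))"

text \<open>Vanishing of the covariant derivative of a section \<open>G\<close> of the tensor square of the cotangent
  bundle, by the Leibniz rule.\<close>

definition parallel2 ::
  "('a::smooth_3_manifold \<Rightarrow> 'a tvec set) \<Rightarrow> 'a set \<Rightarrow> ('a form1 \<Rightarrow> 'a form2) \<Rightarrow> 'a form2 \<Rightarrow> bool" where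
  "parallel2 H W D G \<longleftrightarrow> (\<forall>U Y Z. open U \<and> U \<subseteq> W \<and> vector_field U Y \<and> vector_field U Z \<longrightarrow>
     (\<forall>p\<in>U. \<forall>v\<in>H p. v (\<lambda>q. G q (Y q) (Z q)) - G p (dual_deriv W D Y p v) (Z p)
        - G p (Y p) (dual_deriv W D Z p v) = 0))"

definition canonical_partial_connection ::
  "('a::smooth_3_manifold \<Rightarrow> 'a tvec set) \<Rightarrow> 'a form2 \<Rightarrow> 'a set \<Rightarrow> 'a form1 \<Rightarrow> ('a \<Rightarrow> 'a tvec) \<Rightarrow>
   ('a form1 \<Rightarrow> 'a form2) \<Rightarrow> bool" where
  "canonical_partial_connection H g W \<theta> T D \<longleftrightarrow> partial_connection H W D \<and>
     (\<forall>p\<in>W. \<forall>v\<in>H p. dual_deriv W D T p v = 0) \<and>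
     (\<forall>p\<in>W. \<forall>v\<in>H p. \<forall>w\<in>tangent_space p. D \<theta> p v w = form2_tensor (ext_d \<theta>) p v w) \<and>
     torsion_free_partial H W D \<and>
     parallel2 H W D (extend2 \<theta> T g)"


section \<open>Promotion\<close>

text \<open>The operator \<open>\<Lambda>\<^sup>1 \<otimes> \<Lambda>\<^sup>1 \<rightarrow> \<Lambda>\<^sup>2\<^sub>H \<otimes> \<Lambda>\<^sup>1\<close> induced by a partial connection \<open>D\<close>; in \<open>P \<Phi> p u v w\<close> the
  vectors \<open>u\<close>, \<open>v\<close> in \<open>H\<close> are the arguments of the 2-form factor.  Its values on decomposable
  tensors determine it, every section being locally a finite sum of these.\<close>

definition promotion_operator ::
  "('a::smooth_3_manifold \<Rightarrow> 'a tvec set) \<Rightarrow> 'a set \<Rightarrow> ('a form1 \<Rightarrow> 'a form2) \<Rightarrow>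
   ('a form2 \<Rightarrow> 'a form3) \<Rightarrow> bool" where
  "promotion_operator H W D P \<longleftrightarrow>
     (\<forall>U \<Phi> \<Psi>. open U \<and> U \<subseteq> W \<and> bilinear_section tangent_space tangent_space U \<Phi> \<and>
        bilinear_section tangent_space tangent_space U \<Psi> \<and>
        (\<forall>p\<in>U. \<forall>v\<in>tangent_space p. \<forall>w\<in>tangent_space p. \<Phi> p v w = \<Psi> p v w) \<longrightarrow>
        (\<forall>p\<in>U. \<forall>u\<in>H p. \<forall>v\<in>H p. \<forall>w\<in>tangent_space p. P \<Phi> p u v w = P \<Psi> p u v w)) \<and>
     (\<forall>U \<Phi> \<Psi>. open U \<and> U \<subseteq> W \<and> bilinear_section tangent_space tangent_space U \<Phi> \<and>
        bilinear_section tangent_space tangent_space U \<Psi> \<longrightarrow>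
        (\<forall>p\<in>U. \<forall>u\<in>H p. \<forall>v\<in>H p. \<forall>w\<in>tangent_space p.
           P (\<Phi> + \<Psi>) p u v w = P \<Phi> p u v w + P \<Psi> p u v w)) \<and>
     (\<forall>U \<alpha> \<sigma>. open U \<and> U \<subseteq> W \<and> one_form U \<alpha> \<and> one_form U \<sigma> \<longrightarrow>
        (\<forall>p\<in>U. \<forall>u\<in>H p. \<forall>v\<in>H p. \<forall>w\<in>tangent_space p.
           P (tensor \<alpha> \<sigma>) p u v w =
             ext_d \<alpha> p u v * \<sigma> p w - (\<alpha> p u * D \<sigma> p v w - \<alpha> p v * D \<sigma> p u w)))"

definition promoted_connection ::
  "('a::smooth_3_manifold \<Rightarrow> 'a tvec set) \<Rightarrow> 'a set \<Rightarrow> ('a form1 \<Rightarrow> 'a form2) \<Rightarrow>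
   ('a form1 \<Rightarrow> 'a form2) \<Rightarrow> bool" where
  "promoted_connection H W D N \<longleftrightarrow> connection W N \<and>
     (\<forall>U \<alpha>. open U \<and> U \<subseteq> W \<and> one_form U \<alpha> \<longrightarrow>
        (\<forall>p\<in>U. \<forall>v\<in>H p. \<forall>w\<in>tangent_space p. N \<alpha> p v w = D \<alpha> p v w)) \<and>
     (\<exists>P. promotion_operator H W D P \<and>
        (\<forall>U \<alpha>. open U \<and> U \<subseteq> W \<and> one_form U \<alpha> \<longrightarrow>
           (\<forall>p\<in>U. \<forall>u\<in>H p. \<forall>v\<in>H p. \<forall>w\<in>tangent_space p. P (N \<alpha>) p u v w = 0)))"


section \<open>The Tanaka--Webster connection\<close>

definition adapted_coframe ::
  "('a::smooth_3_manifold \<Rightarrow> 'a tvec set) \<Rightarrow> 'a form2 \<Rightarrow> 'a form1 \<Rightarrow> 'a set \<Rightarrow> 'a form1 \<Rightarrow> 'a form1 \<Rightarrow> bool" where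
  "adapted_coframe H g \<theta> U e\<^sub>1 e\<^sub>2 \<longleftrightarrow> one_form U e\<^sub>1 \<and> one_form U e\<^sub>2 \<and>
     (\<forall>p\<in>U. \<forall>a b c. (\<forall>v\<in>tangent_space p. a * \<theta> p v + b * e\<^sub>1 p v + c * e\<^sub>2 p v = 0) \<longrightarrow>
        a = 0 \<and> b = 0 \<and> c = 0) \<and>
     (\<forall>p\<in>U. \<forall>v\<in>tangent_space p. \<forall>w\<in>tangent_space p. ext_d \<theta> p v w = wedge e\<^sub>1 e\<^sub>2 p v w) \<and>
     (\<forall>p\<in>U. \<forall>v\<in>H p. J_form H g \<theta> e\<^sub>2 p v = e\<^sub>1 p v)"

definition structure_equations ::
  "'a::smooth_3_manifold form1 \<Rightarrow> 'a set \<Rightarrow> 'a form1 \<Rightarrow> 'a form1 \<Rightarrow> 'a form1 \<Rightarrow>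
   ('a \<Rightarrow> real) \<Rightarrow> ('a \<Rightarrow> real) \<Rightarrow> bool" where
  "structure_equations \<theta> U e\<^sub>1 e\<^sub>2 \<omega> A B \<longleftrightarrow> one_form U \<omega> \<and> smooth_fun U A \<and> smooth_fun U B \<and>
     (\<forall>p\<in>U. \<forall>v\<in>tangent_space p. \<forall>w\<in>tangent_space p.
        ext_d e\<^sub>1 p v w = wedge \<omega> e\<^sub>2 p v w + A p * wedge \<theta> e\<^sub>1 p v w + B p * wedge \<theta> e\<^sub>2 p v w \<and>
        ext_d e\<^sub>2 p v w = - wedge \<omega> e\<^sub>1 p v w + B p * wedge \<theta> e\<^sub>1 p v w - A p * wedge \<theta> e\<^sub>2 p v w)"

definition tanaka_webster_connection ::
  "('a::smooth_3_manifold \<Rightarrow> 'a tvec set) \<Rightarrow> 'a form2 \<Rightarrow> 'a set \<Rightarrow> 'a form1 \<Rightarrow>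
   ('a form1 \<Rightarrow> 'a form2) \<Rightarrow> bool" where
  "tanaka_webster_connection H g W \<theta> N \<longleftrightarrow> connection W N \<and>
     (\<forall>p\<in>W. \<forall>v\<in>tangent_space p. \<forall>w\<in>tangent_space p. N \<theta> p v w = 0) \<and>
     (\<forall>U e\<^sub>1 e\<^sub>2 \<omega> A B. open U \<and> U \<subseteq> W \<and> adapted_coframe H g \<theta> U e\<^sub>1 e\<^sub>2 \<and>
        structure_equations \<theta> U e\<^sub>1 e\<^sub>2 \<omega> A B \<longrightarrow>
        (\<forall>p\<in>U. \<forall>v\<in>tangent_space p. \<forall>w\<in>tangent_space p.
           N e\<^sub>1 p v w = tensor \<omega> e\<^sub>2 p v w \<and> N e\<^sub>2 p v w = - tensor \<omega> e\<^sub>1 p v w))"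

definition tanaka_webster_curvature ::
  "('a::smooth_3_manifold \<Rightarrow> 'a tvec set) \<Rightarrow> 'a form2 \<Rightarrow> 'a set \<Rightarrow> 'a form1 \<Rightarrow> ('a \<Rightarrow> real) \<Rightarrow> bool" where
  "tanaka_webster_curvature H g W \<theta> R \<longleftrightarrow>
     (\<forall>U e\<^sub>1 e\<^sub>2 \<omega> A B. open U \<and> U \<subseteq> W \<and> adapted_coframe H g \<theta> U e\<^sub>1 e\<^sub>2 \<and>
        structure_equations \<theta> U e\<^sub>1 e\<^sub>2 \<omega> A B \<longrightarrow>
        (\<forall>p\<in>U. \<forall>u\<in>tangent_space p. \<forall>v\<in>tangent_space p. \<forall>w\<in>tangent_space p.
           wedge21 (ext_d \<omega>) \<theta> p u v w = R p * wedge21 (wedge \<theta> e\<^sub>1) e\<^sub>2 p u v w))"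

end

theory Submission
  imports Defs
begin

text \<open>Near each point choose an orthonormal frame \<open>X\<^sub>1, X\<^sub>2\<close> of \<open>H\<close> with \<open>d\<theta>(X\<^sub>1, X\<^sub>2) = 1\<close>; together with
  the Reeb field \<open>T\<close> and the dual coframe \<open>\<theta>, e\<^sub>1, e\<^sub>2\<close> it satisfies the structure equations, the one
  integrability condition being \<open>d(d\<theta>) = 0\<close>.  Metric compatibility and the vanishing torsion force the
  canonical partial connection to be \<open>e\<^sub>1 \<mapsto> \<omega> \<otimes> e\<^sub>2\<close>, \<open>e\<^sub>2 \<mapsto> - \<omega> \<otimes> e\<^sub>1\<close> along \<open>H\<close>, where it agrees with
  the Tanaka--Webster connection on these two forms.  Writing \<open>\<nabla>\<sigma>\<close> as the sum of \<open>\<eta>\<^sub>k \<otimes> \<epsilon>\<^sub>k\<close> over the coframe, the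
  promotion condition prescribes \<open>d\<eta>\<^sub>k(X\<^sub>1, X\<^sub>2)\<close>, and since \<open>[X\<^sub>1, X\<^sub>2]\<close> is \<open>- T\<close> modulo \<open>H\<close> this
  determines \<open>\<eta>\<^sub>k(T)\<close>.  For \<open>\<sigma> = e\<^sub>1, e\<^sub>2\<close> the component along the other of the two differs from the Tanaka--Webster
  value by \<open>d\<omega>(X\<^sub>1, X\<^sub>2) = R\<close> up to sign, and all others vanish.\<close>

section \<open>Calculus on open sets\<close>

text \<open>The coefficient \<open>R\<close> has a short origin. Let \<eta> be the coefficient form
  of \<nabla>\<open>e\<^sub>1\<close> along \<open>e\<^sub>2\<close>. On \<open>H\<close> it agrees
  with \<omega>, and promotion reduces to d\<eta>(\<open>X\<^sub>1\<close>,
  \<open>X\<^sub>2\<close>) = 0. Forms that agree on \<open>H\<close> differ by some f\<theta>, and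
  d(f\<theta>) takes the value f on this pair because \<theta> vanishes on \<open>H\<close>; since
  d\<omega> takes the value \<open>R\<close> there, \<eta> = \<omega> - R\<theta>. The \<Omega> term
  is \<nabla>\<theta> itself, since the Tanaka-Webster connection annihilates \<theta>. Most of the
  labour lies elsewhere. \<open>ext_d\<close>, \<open>J_map\<close> and \<open>dual_deriv\<close>
  are definite descriptions, which say nothing until existence and uniqueness are known. For
  \<open>ext_d\<close> this is tensoriality of the invariant formula, which needs local frames and
  brackets that are again tangent vectors; the latter rests on the symmetry of second derivatives.
  Dimension three enters through a bound on independent sets of tangent vectors, which makes
  \<open>H\<close> the whole kernel of \<theta>.\<close>

lemma Ck_on_mono: "Ck_on k S f \<Longrightarrow> S' \<subseteq> S \<Longrightarrow> Ck_on k S' f"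
  by (induction k arbitrary: f) (auto intro: continuous_on_subset)

text \<open>Openness of \<open>S\<close> matters: the derivative at a point of \<open>S\<close> then
  depends only on the values in \<open>S\<close>.\<close>

lemma Ck_on_cong:
  assumes "open S" "Ck_on k S f" "\<And>x. x \<in> S \<Longrightarrow> f x = g x"
  shows "Ck_on k S g"
  using assms(2,3)
proof (induction k arbitrary: f g)
  case 0
  then show ?case using continuous_on_cong[of S S f g] by simp
next
  case (Suc k)
  have d: "f differentiable (at x)" if "x \<in> S" for x using Suc.prems that by simp
  have eq: "frechet_derivative f (at x) = frechet_derivative g (at x)" if "x \<in> S" for x
    using frechet_derivative_transform_within_open[OF d[OF that] assms(1) that] Suc.prems by blast
  have "g differentiable (at x)" if "x \<in> S" for x
    using d[OF that] Suc.prems(2) assms(1) that has_derivative_transform_within_open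
    unfolding differentiable_def by blast
  moreover have "Ck_on k S (\<lambda>x. frechet_derivative g (at x) h)" for h
    by (rule Suc.IH[of "\<lambda>x. frechet_derivative f (at x) h"]) (use Suc.prems eq in auto)
  ultimately show ?case by simp
qed

lemma Ck_on_Suc_imp: "Ck_on (Suc k) S f \<Longrightarrow> Ck_on k S f"
proof (induction k arbitrary: f)
  case 0
  then have "continuous (at x) f" if "x \<in> S" for x
    using that differentiable_imp_continuous_within by auto
  then show ?case by (simp add: continuous_at_imp_continuous_on)
next
  case (Suc k)
  have "Ck_on k S (\<lambda>x. frechet_derivative f (at x) h)" for h
    using Suc.prems by (intro Suc.IH) (simp del: Ck_on.simps add: Ck_on.simps(2)[of "Suc k"])
  moreover have "\<forall>x\<in>S. f differentiable (at x)" using Suc.prems by simp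
  ultimately show ?case by simp
qed

text \<open>Closure properties are proved with the derivative in whatever form the calculus rules
  deliver; uniqueness of the derivative identifies it with the \<open>frechet_derivative\<close> in
  the definition of \<open>Ck_on\<close>.\<close>

lemma Ck_on_SucI:
  assumes "open S" "\<And>x. x \<in> S \<Longrightarrow> (f has_derivative f' x) (at x)"
    and "\<And>h. Ck_on k S (\<lambda>x. f' x h)"
  shows "Ck_on (Suc k) S f"
proof -
  have "f' x = frechet_derivative f (at x)" if "x \<in> S" for x
    using assms(2)[OF that] frechet_derivative_at by blast
  then have "Ck_on k S (\<lambda>x. frechet_derivative f (at x) h)" for h
    by (intro Ck_on_cong[OF assms(1) assms(3)[of h]]) simp
  then show ?thesis using assms(2) by (auto simp: differentiable_def)
qed

lemma Ck_on_SucD: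
  assumes "Ck_on (Suc k) S f"
  shows "x \<in> S \<Longrightarrow> (f has_derivative frechet_derivative f (at x)) (at x)"
    and "Ck_on k S (\<lambda>x. frechet_derivative f (at x) h)"
  using assms by (auto simp: frechet_derivative_works[symmetric])

lemma Ck_on_const: "Ck_on k S (\<lambda>x. c)"
  by (induction k arbitrary: c) auto

lemma Ck_on_bounded_linear:
  assumes "open S" "bounded_linear L" "Ck_on k S f"
  shows "Ck_on k S (\<lambda>x. L (f x))"
  using assms(3)
proof (induction k arbitrary: f)
  case 0
  then show ?case by (simp add: bounded_linear.continuous_on[OF assms(2)])
next
  case (Suc k)
  show ?case
    by (rule Ck_on_SucI[OF assms(1) bounded_linear.has_derivative[OF assms(2) Ck_on_SucD(1)[OF Suc.prems]]])
      (use Suc in auto)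
qed

lemma Ck_on_add:
  assumes "open S" "Ck_on k S f" "Ck_on k S g"
  shows "Ck_on k S (\<lambda>x. f x + g x)"
  using assms(2,3)
proof (induction k arbitrary: f g)
  case 0
  then show ?case by (auto intro: continuous_on_add)
next
  case (Suc k)
  show ?case
    by (rule Ck_on_SucI[OF assms(1) has_derivative_add[OF Ck_on_SucD(1)[OF Suc.prems(1)] Ck_on_SucD(1)[OF Suc.prems(2)]]])
      (use Suc in auto)
qed

lemma Ck_on_mult:
  fixes f g :: "'b::real_normed_vector \<Rightarrow> real"
  assumes "open S" "Ck_on k S f" "Ck_on k S g"
  shows "Ck_on k S (\<lambda>x. f x * g x)"
  using assms(2,3)
proof (induction k arbitrary: f g)
  case 0
  then show ?case by (auto intro: continuous_on_mult)
next
  case (Suc k)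
  \<comment> \<open>The product rule pairs each undifferentiated factor with a derivative that is
    only of class k, so the factors are first lowered to that class.\<close>
  note f = Ck_on_Suc_imp[OF Suc.prems(1)] and g = Ck_on_Suc_imp[OF Suc.prems(2)]
  show ?case
    by (rule Ck_on_SucI[OF assms(1) has_derivative_mult[OF Ck_on_SucD(1)[OF Suc.prems(1)] Ck_on_SucD(1)[OF Suc.prems(2)]]])
      (assumption, assumption, intro Ck_on_add[OF assms(1)] Suc.IH f g Ck_on_SucD(2)[OF Suc.prems(1)] Ck_on_SucD(2)[OF Suc.prems(2)])
qed

text \<open>The exponent is generalised in the induction because differentiating lowers it by one.
  The power -1/2 will normalise vector fields.\<close>

lemma Ck_on_powr:
  fixes f :: "'b::real_normed_vector \<Rightarrow> real"
  assumes "open S" "Ck_on k S f" "\<And>x. x \<in> S \<Longrightarrow> f x > 0"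
  shows "Ck_on k S (\<lambda>x. f x powr a)"
  using assms(2)
proof (induction k arbitrary: a)
  case 0
  then show ?case using assms(3) by (auto intro!: continuous_on_powr simp: less_imp_neq[symmetric])
next
  case (Suc k)
  have D: "((\<lambda>x. f x powr a) has_derivative
      (\<lambda>h. a * (f x powr (a - 1) * frechet_derivative f (at x) h))) (at x)" if "x \<in> S" for x
    using assms(3)[OF that]
    by (auto intro!: derivative_eq_intros Ck_on_SucD(1)[OF Suc.prems that]
        simp: fun_eq_iff powr_diff field_simps)
  show ?case
    by (rule Ck_on_SucI[OF assms(1) D])
      (assumption, intro Ck_on_mult[OF assms(1)] Ck_on_const Suc.IH Ck_on_Suc_imp[OF Suc.prems] Ck_on_SucD(2)[OF Suc.prems])
qed

text \<open>The mean value theorem, applied once in each direction.\<close>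

lemma second_difference:
  fixes F :: "'b::real_normed_vector \<Rightarrow> real"
  assumes F: "Ck_on 2 (ball x r) F" and t: "t > 0" "t * (norm h + norm k) < r"
  obtains a b where "0 \<le> a" "a \<le> t" "0 \<le> b" "b \<le> t"
    "F (x + t *\<^sub>R h + t *\<^sub>R k) - F (x + t *\<^sub>R h) - F (x + t *\<^sub>R k) + F x =
      t * t * frechet_derivative (\<lambda>y. frechet_derivative F (at y) h) (at (x + a *\<^sub>R h + b *\<^sub>R k)) k"
proof -
  have F2: "Ck_on (Suc (Suc 0)) (ball x r) F" using F by (simp add: numeral_2_eq_2)
  note D1 = Ck_on_SucD(1)[OF F2] and D2 = Ck_on_SucD(1)[OF Ck_on_SucD(2)[OF F2]]
  \<comment> \<open>The hypothesis on \<open>t\<close> keeps the whole parallelogram spanned by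
    \<open>t *\<^sub>R h\<close> and \<open>t *\<^sub>R k\<close> inside the ball, so both
    derivatives exist at every intermediate point.\<close>
  have in_ball: "x + a *\<^sub>R h + b *\<^sub>R k \<in> ball x r" if "0 \<le> a" "a \<le> t" "0 \<le> b" "b \<le> t" for a b
  proof -
    have "norm (a *\<^sub>R h + b *\<^sub>R k) \<le> a * norm h + b * norm k"
      using norm_triangle_ineq[of "a *\<^sub>R h" "b *\<^sub>R k"] that by simp
    also have "\<dots> \<le> t * norm h + t * norm k"
      using that by (intro add_mono mult_right_mono) auto
    finally have "norm (a *\<^sub>R h + b *\<^sub>R k) < r" using t by (simp add: algebra_simps)
    moreover have "dist x (x + a *\<^sub>R h + b *\<^sub>R k) = norm (a *\<^sub>R h + b *\<^sub>R k)"
      by (metis add.assoc add_diff_cancel_left' dist_norm dist_commute)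
    ultimately show ?thesis by simp
  qed
  have line1: "((\<lambda>a. F (x + a *\<^sub>R h + b *\<^sub>R k)) has_real_derivative
      frechet_derivative F (at (x + a *\<^sub>R h + b *\<^sub>R k)) h) (at a)"
    if "0 \<le> a" "a \<le> t" "0 \<le> b" "b \<le> t" for a b
  proof -
    have "((\<lambda>a. F (x + a *\<^sub>R h + b *\<^sub>R k)) has_derivative
      (\<lambda>s. frechet_derivative F (at (x + a *\<^sub>R h + b *\<^sub>R k)) (s *\<^sub>R h))) (at a)"
      by (rule has_derivative_compose[where f="\<lambda>a. x + a *\<^sub>R h + b *\<^sub>R k" and s=UNIV, OF _ D1[OF in_ball[OF that]]]) (auto intro!: derivative_eq_intros)
    then show ?thesis
      unfolding has_field_derivative_def
      using linear_cmul[OF has_derivative_linear[OF D1[OF in_ball[OF that]]]]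
      by (simp add: mult_commute_abs)
  qed
  have line2: "((\<lambda>b. frechet_derivative F (at (x + a *\<^sub>R h + b *\<^sub>R k)) h) has_real_derivative
      frechet_derivative (\<lambda>y. frechet_derivative F (at y) h) (at (x + a *\<^sub>R h + b *\<^sub>R k)) k) (at b)"
    if "0 \<le> a" "a \<le> t" "0 \<le> b" "b \<le> t" for a b
  proof -
    have "((\<lambda>b. frechet_derivative F (at (x + a *\<^sub>R h + b *\<^sub>R k)) h) has_derivative
      (\<lambda>s. frechet_derivative (\<lambda>y. frechet_derivative F (at y) h) (at (x + a *\<^sub>R h + b *\<^sub>R k)) (s *\<^sub>R k))) (at b)"
      by (rule has_derivative_compose[where f="\<lambda>b. x + a *\<^sub>R h + b *\<^sub>R k" and s=UNIV, OF _ D2[OF in_ball[OF that]]])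
        (auto intro!: derivative_eq_intros)
    then show ?thesis
      unfolding has_field_derivative_def
      using linear_cmul[OF has_derivative_linear[OF D2[OF in_ball[OF that]]]]
      by (simp add: mult_commute_abs)
  qed
  \<comment> \<open>The second difference is the increment, in the direction \<open>h\<close>, of
    the difference across the \<open>k\<close> side. The coefficient 0 is written out so that both
    ends match \<open>line1\<close>.\<close>
  obtain a where a: "0 < a" "a < t"
    "(F (x + t *\<^sub>R h + t *\<^sub>R k) - F (x + t *\<^sub>R h + 0 *\<^sub>R k)) - (F (x + 0 *\<^sub>R h + t *\<^sub>R k) - F (x + 0 *\<^sub>R h + 0 *\<^sub>R k)) =
      (t - 0) * (frechet_derivative F (at (x + a *\<^sub>R h + t *\<^sub>R k)) h - frechet_derivative F (at (x + a *\<^sub>R h + 0 *\<^sub>R k)) h)"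
    using MVT2[OF t(1), of "\<lambda>a. F (x + a *\<^sub>R h + t *\<^sub>R k) - F (x + a *\<^sub>R h + 0 *\<^sub>R k)",
        OF DERIV_diff[OF line1 line1]] t(1) by auto
  obtain b where b: "0 < b" "b < t"
    "frechet_derivative F (at (x + a *\<^sub>R h + t *\<^sub>R k)) h - frechet_derivative F (at (x + a *\<^sub>R h + 0 *\<^sub>R k)) h =
      (t - 0) * frechet_derivative (\<lambda>y. frechet_derivative F (at y) h) (at (x + a *\<^sub>R h + b *\<^sub>R k)) k"
    using MVT2[OF t(1), of "\<lambda>b. frechet_derivative F (at (x + a *\<^sub>R h + b *\<^sub>R k)) h", OF line2] a by auto
  show ?thesis
    by (rule that[of a b]) (use a b in auto)
qed

text \<open>The second difference is symmetric in \<open>h\<close> and \<open>k\<close>. By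
  \<open>second_difference\<close> it is \<open>t * t\<close> times a mixed derivative of either
  order, at points that tend to \<open>x\<close> with \<open>t\<close>, so continuity of these
  derivatives gives equality in the limit.\<close>

lemma symmetric_second_derivative:
  fixes F :: "'b::real_normed_vector \<Rightarrow> real"
  assumes "open S" "Ck_on 2 S F" "x \<in> S"
  shows "frechet_derivative (\<lambda>y. frechet_derivative F (at y) h) (at x) k =
    frechet_derivative (\<lambda>y. frechet_derivative F (at y) k) (at x) h"
proof -
  obtain r where r: "r > 0" "ball x r \<subseteq> S" using assms by (meson openE)
  have F: "Ck_on 2 (ball x r) F" using Ck_on_mono[OF assms(2) r(2)] .
  define G where "G = (\<lambda>h k y. frechet_derivative (\<lambda>y. frechet_derivative F (at y) h) (at y) k)"
  have cont: "isCont (G h k) x" for h k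
  proof -
    have "Ck_on 0 (ball x r) (G h k)"
      unfolding G_def using F by (intro Ck_on_SucD(2)) (simp add: numeral_2_eq_2)
    then show ?thesis using r by (simp add: continuous_on_eq_continuous_at)
  qed
  \<comment> \<open>The summand 1 keeps the denominator positive when \<open>h\<close> and
    \<open>k\<close> vanish; the factor 2 leaves the bound at \<open>r / 2\<close>, strictly below
    \<open>r\<close>.\<close>
  define t where "t = (\<lambda>n. r / (2 * (norm h + norm k + 1)) / real (Suc n))"
  have "norm h + norm k + 1 > 0" by (simp add: add_nonneg_pos)
  then have pos: "t n > 0" for n using r by (simp add: t_def del: of_nat_Suc)
  have small: "t n * (norm h + norm k) < r" for n
  proof -
    have "t n \<le> r / (2 * (norm h + norm k + 1))"
      using r \<open>norm h + norm k + 1 > 0\<close> divide_left_mono[of 1 "real (Suc n)" "r / (2 * (norm h + norm k + 1))"]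
      by (simp add: t_def add_nonneg_nonneg)
    then have "t n * (norm h + norm k) \<le> r / (2 * (norm h + norm k + 1)) * (norm h + norm k)"
      by (intro mult_right_mono) auto
    also have "\<dots> = r / 2 * ((norm h + norm k) / (norm h + norm k + 1))" by simp
    also have "\<dots> \<le> r / 2 * 1" using r \<open>norm h + norm k + 1 > 0\<close> by (intro mult_left_mono) auto
    finally show ?thesis using r by simp
  qed
  have lim0: "t \<longlonglongrightarrow> 0"
    unfolding t_def using lim_const_over_n[THEN LIMSEQ_Suc] by blast
  have "\<exists>a b. 0 \<le> a \<and> a \<le> t n \<and> 0 \<le> b \<and> b \<le> t n \<and>
    F (x + t n *\<^sub>R h + t n *\<^sub>R k) - F (x + t n *\<^sub>R h) - F (x + t n *\<^sub>R k) + F x =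
      t n * t n * G h k (x + a *\<^sub>R h + b *\<^sub>R k)" for n
    by (rule second_difference[OF F pos small, of n]) (auto simp: G_def)
  then obtain a b where ab: "\<And>n. 0 \<le> a n \<and> a n \<le> t n \<and> 0 \<le> b n \<and> b n \<le> t n \<and>
    F (x + t n *\<^sub>R h + t n *\<^sub>R k) - F (x + t n *\<^sub>R h) - F (x + t n *\<^sub>R k) + F x =
      t n * t n * G h k (x + a n *\<^sub>R h + b n *\<^sub>R k)" by metis
  have small': "t n * (norm k + norm h) < r" for n using small[of n] by (simp add: add.commute)
  have "\<exists>a b. 0 \<le> a \<and> a \<le> t n \<and> 0 \<le> b \<and> b \<le> t n \<and>
    F (x + t n *\<^sub>R k + t n *\<^sub>R h) - F (x + t n *\<^sub>R k) - F (x + t n *\<^sub>R h) + F x =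
      t n * t n * G k h (x + a *\<^sub>R k + b *\<^sub>R h)" for n
    by (rule second_difference[OF F pos small', of n]) (auto simp: G_def)
  then obtain c d where cd: "\<And>n. 0 \<le> c n \<and> c n \<le> t n \<and> 0 \<le> d n \<and> d n \<le> t n \<and>
    F (x + t n *\<^sub>R k + t n *\<^sub>R h) - F (x + t n *\<^sub>R k) - F (x + t n *\<^sub>R h) + F x =
      t n * t n * G k h (x + c n *\<^sub>R k + d n *\<^sub>R h)" by metis
  have eq: "G h k (x + a n *\<^sub>R h + b n *\<^sub>R k) = G k h (x + c n *\<^sub>R k + d n *\<^sub>R h)" for n
  proof -
    have "t n * t n * G h k (x + a n *\<^sub>R h + b n *\<^sub>R k) = t n * t n * G k h (x + c n *\<^sub>R k + d n *\<^sub>R h)"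
      using ab[of n] cd[of n] by (simp add: algebra_simps)
    then show ?thesis using pos[of n] by simp
  qed
  have z: "f \<longlonglongrightarrow> 0" if "\<And>n. 0 \<le> f n \<and> f n \<le> t n" for f
    by (rule tendsto_sandwich[OF _ _ tendsto_const lim0]) (use that in auto)
  have "(\<lambda>n. x + a n *\<^sub>R h + b n *\<^sub>R k) \<longlonglongrightarrow> x + 0 *\<^sub>R h + 0 *\<^sub>R k"
    by (intro tendsto_intros z) (use ab in auto)
  then have l1: "(\<lambda>n. G h k (x + a n *\<^sub>R h + b n *\<^sub>R k)) \<longlonglongrightarrow> G h k x"
    using isCont_tendsto_compose[OF cont] by fastforce
  have "(\<lambda>n. x + c n *\<^sub>R k + d n *\<^sub>R h) \<longlonglongrightarrow> x + 0 *\<^sub>R k + 0 *\<^sub>R h"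
    by (intro tendsto_intros z) (use cd in auto)
  then have l2: "(\<lambda>n. G k h (x + c n *\<^sub>R k + d n *\<^sub>R h)) \<longlonglongrightarrow> G k h x"
    using isCont_tendsto_compose[OF cont] by fastforce
  show ?thesis using LIMSEQ_unique[OF l1[unfolded eq] l2] by (simp add: G_def)
qed

section \<open>Smoothness of all orders on open sets\<close>

lemma smooth_onD: "smooth_on S f \<Longrightarrow> Ck_on k S f"
  by (simp add: smooth_on_def)

lemma smooth_on_has_derivative:
  "smooth_on S f \<Longrightarrow> x \<in> S \<Longrightarrow> (f has_derivative frechet_derivative f (at x)) (at x)"
  using Ck_on_SucD(1)[of 0] smooth_onD by blast

lemma smooth_on_frechet_derivative:
  "smooth_on S f \<Longrightarrow> smooth_on S (\<lambda>x. frechet_derivative f (at x) h)"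
  using Ck_on_SucD(2) smooth_onD unfolding smooth_on_def by blast

lemma smooth_on_mono: "smooth_on S f \<Longrightarrow> S' \<subseteq> S \<Longrightarrow> smooth_on S' f"
  using Ck_on_mono unfolding smooth_on_def by blast

lemma smooth_on_cong: "open S \<Longrightarrow> smooth_on S f \<Longrightarrow> (\<And>x. x \<in> S \<Longrightarrow> f x = g x) \<Longrightarrow> smooth_on S g"
  using Ck_on_cong unfolding smooth_on_def by blast

section \<open>Smooth functions\<close>

lemma chart_image_open:
  assumes "(V, \<phi>) \<in> atlas" "open U"
  shows "open (\<phi> ` (U \<inter> V))"
  using chart_open_iff[OF assms(1), of "U \<inter> V"] chart_domain_open[OF assms(1)] assms(2) by (simp add: open_Int)

lemma chart_inverse:
  assumes "(V, \<phi>) \<in> atlas" "p \<in> V"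
  shows "inv_into V \<phi> (\<phi> p) = p"
  using chart_inj[OF assms(1)] assms(2) by (rule inv_into_f_f)

lemma smooth_funI:
  assumes "\<And>V \<phi>. (V, \<phi>) \<in> atlas \<Longrightarrow> smooth_on (\<phi> ` (U \<inter> V)) (\<lambda>x. f (inv_into V \<phi> x))"
  shows "smooth_fun U f"
  using assms by (auto simp: smooth_fun_def comp_def)

lemma smooth_funD:
  "smooth_fun U f \<Longrightarrow> (V, \<phi>) \<in> atlas \<Longrightarrow> smooth_on (\<phi> ` (U \<inter> V)) (\<lambda>x. f (inv_into V \<phi> x))"
  by (auto simp: smooth_fun_def comp_def)

lemma smooth_fun_mono: "smooth_fun U f \<Longrightarrow> U' \<subseteq> U \<Longrightarrow> smooth_fun U' f"
  by (rule smooth_funI, rule smooth_on_mono, erule (1) smooth_funD) auto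

lemma smooth_fun_cong:
  assumes "open U" "smooth_fun U f" "\<And>q. q \<in> U \<Longrightarrow> f q = g q"
  shows "smooth_fun U g"
proof (rule smooth_funI)
  fix V and \<phi> :: "'a \<Rightarrow> real^3" assume c: "(V, \<phi>) \<in> atlas"
  show "smooth_on (\<phi> ` (U \<inter> V)) (\<lambda>x. g (inv_into V \<phi> x))"
    by (rule smooth_on_cong[OF chart_image_open[OF c assms(1)] smooth_funD[OF assms(2) c]])
      (use assms(3) chart_inverse[OF c] in auto)
qed

lemma smooth_fun_const: "smooth_fun U (\<lambda>q. c)"
  by (rule smooth_funI) (simp add: smooth_on_def Ck_on_const)

lemma smooth_fun_add:
  assumes "open U" "smooth_fun U f" "smooth_fun U g"
  shows "smooth_fun U (\<lambda>q. f q + g q)"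
  by (rule smooth_funI) (auto simp: smooth_on_def intro!: Ck_on_add chart_image_open assms(1)
      smooth_onD[OF smooth_funD[OF assms(2)]] smooth_onD[OF smooth_funD[OF assms(3)]])

lemma smooth_fun_mult:
  assumes "open U" "smooth_fun U f" "smooth_fun U g"
  shows "smooth_fun U (\<lambda>q. f q * g q)"
  by (rule smooth_funI) (auto simp: smooth_on_def intro!: Ck_on_mult chart_image_open assms(1)
      smooth_onD[OF smooth_funD[OF assms(2)]] smooth_onD[OF smooth_funD[OF assms(3)]])

lemma smooth_fun_minus:
  assumes "open U" "smooth_fun U f"
  shows "smooth_fun U (\<lambda>q. - f q)"
  using smooth_fun_mult[OF assms(1) smooth_fun_const[of U "-1"] assms(2)] by simp

lemma smooth_fun_diff:
  assumes "open U" "smooth_fun U f" "smooth_fun U g"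
  shows "smooth_fun U (\<lambda>q. f q - g q)"
  using smooth_fun_add[OF assms(1,2) smooth_fun_minus[OF assms(1,3)]] by simp

lemma smooth_fun_powr:
  assumes "open U" "smooth_fun U f" "\<And>q. q \<in> U \<Longrightarrow> f q > 0"
  shows "smooth_fun U (\<lambda>q. f q powr a)"
proof (rule smooth_funI)
  fix V and \<phi> :: "'a \<Rightarrow> real^3" assume c: "(V, \<phi>) \<in> atlas"
  show "smooth_on (\<phi> ` (U \<inter> V)) (\<lambda>x. f (inv_into V \<phi> x) powr a)"
    unfolding smooth_on_def
    by (intro allI Ck_on_powr chart_image_open[OF c assms(1)] smooth_onD[OF smooth_funD[OF assms(2) c]])
      (use assms(3) chart_inverse[OF c] in auto)
qed

section \<open>Functions smooth near a point\<close>

lemma smooth_nearI: "open U \<Longrightarrow> p \<in> U \<Longrightarrow> smooth_fun U f \<Longrightarrow> smooth_near p f"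
  by (auto simp: smooth_near_def)

lemma smooth_near_cong:
  assumes "smooth_near p f" "open U" "p \<in> U" "\<And>q. q \<in> U \<Longrightarrow> f q = g q"
  shows "smooth_near p g"
proof -
  obtain U' where "open U'" "p \<in> U'" "smooth_fun U' f" using assms(1) by (auto simp: smooth_near_def)
  then show ?thesis
    using assms(2-4) smooth_fun_cong[of "U \<inter> U'" f g] smooth_fun_mono[of U' f "U \<inter> U'"]
    by (intro smooth_nearI[of "U \<inter> U'"]) auto
qed

lemma smooth_near_both:
  assumes "smooth_near p f" "smooth_near p g"
  obtains U where "open U" "p \<in> U" "smooth_fun U f" "smooth_fun U g"
proof -
  obtain U U' where "open U" "p \<in> U" "smooth_fun U f" "open U'" "p \<in> U'" "smooth_fun U' g"
    using assms by (auto simp: smooth_near_def)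
  then show ?thesis by (intro that[of "U \<inter> U'"]) (auto intro: smooth_fun_mono)
qed

lemma smooth_near_const: "smooth_near p (\<lambda>q. c)"
  by (rule smooth_nearI[of UNIV]) (auto intro: smooth_fun_const)

lemma smooth_near_add: "smooth_near p f \<Longrightarrow> smooth_near p g \<Longrightarrow> smooth_near p (\<lambda>q. f q + g q)"
  by (erule (1) smooth_near_both) (metis smooth_nearI smooth_fun_add)

lemma smooth_near_mult: "smooth_near p f \<Longrightarrow> smooth_near p g \<Longrightarrow> smooth_near p (\<lambda>q. f q * g q)"
  by (erule (1) smooth_near_both) (metis smooth_nearI smooth_fun_mult)

lemma smooth_near_has_derivative:
  assumes "smooth_near p f" "(V, \<phi>) \<in> atlas" "p \<in> V"
  shows "((\<lambda>x. f (inv_into V \<phi> x)) has_derivative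
    frechet_derivative (\<lambda>x. f (inv_into V \<phi> x)) (at (\<phi> p))) (at (\<phi> p))"
  using assms(1) unfolding smooth_near_def
  by (metis IntI assms(2,3) image_eqI smooth_funD smooth_on_has_derivative)


section \<open>Tangent vectors\<close>

lemma chart_vec_apply:
  "smooth_near p f \<Longrightarrow> chart_vec (V, \<phi>) p h f = frechet_derivative (\<lambda>x. f (inv_into V \<phi> x)) (at (\<phi> p)) h"
  by (simp add: chart_vec_def comp_def)

lemma chart_vec_eqI:
  assumes "smooth_near p f" "(V, \<phi>) \<in> atlas" "p \<in> V"
    "((\<lambda>x. f (inv_into V \<phi> x)) has_derivative f') (at (\<phi> p))"
  shows "chart_vec (V, \<phi>) p h f = f' h"
  using assms frechet_derivative_at chart_vec_apply by metis

lemma tangent_not_smooth: "v \<in> tangent_space p \<Longrightarrow> \<not> smooth_near p f \<Longrightarrow> v f = 0"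
  by (auto simp: tangent_space_def chart_vec_def)

lemma tangent_spaceE:
  assumes "v \<in> tangent_space p"
  obtains V \<phi> h where "(V, \<phi>) \<in> atlas" "p \<in> V" "v = chart_vec (V, \<phi>) p h"
  using assms by (auto simp: tangent_space_def)

lemma tangent_const:
  assumes "v \<in> tangent_space p"
  shows "v (\<lambda>q. c) = 0"
  using assms by (rule tangent_spaceE) (simp add: chart_vec_apply smooth_near_const)

lemma tangent_add:
  assumes "v \<in> tangent_space p" "smooth_near p f" "smooth_near p g"
  shows "v (\<lambda>q. f q + g q) = v f + v g"
  using assms(1)
proof (rule tangent_spaceE)
  fix V \<phi> h assume c: "(V, \<phi>) \<in> atlas" "p \<in> V" and v: "v = chart_vec (V, \<phi>) p h"
  show ?thesis unfolding v
    using assms(2,3)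
    by (simp add: chart_vec_eqI[OF smooth_near_add[OF assms(2,3)] c has_derivative_add[OF
          smooth_near_has_derivative[OF assms(2) c] smooth_near_has_derivative[OF assms(3) c]]]
        chart_vec_apply)
qed

lemma tangent_mult:
  assumes "v \<in> tangent_space p" "smooth_near p f" "smooth_near p g"
  shows "v (\<lambda>q. f q * g q) = f p * v g + v f * g p"
  using assms(1)
proof (rule tangent_spaceE)
  fix V \<phi> h assume c: "(V, \<phi>) \<in> atlas" "p \<in> V" and v: "v = chart_vec (V, \<phi>) p h"
  show ?thesis unfolding v
    using assms(2,3)
    by (simp add: chart_vec_eqI[OF smooth_near_mult[OF assms(2,3)] c has_derivative_mult[OF
          smooth_near_has_derivative[OF assms(2) c] smooth_near_has_derivative[OF assms(3) c]]]
        chart_vec_apply chart_inverse[OF c])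
qed

text \<open>Tangent vectors see only germs. Formulas that hold merely on a neighbourhood can
  therefore be differentiated.\<close>

lemma tangent_local:
  assumes "v \<in> tangent_space p" "open U" "p \<in> U" "\<And>q. q \<in> U \<Longrightarrow> f q = g q"
  shows "v f = v g"
proof (cases "smooth_near p f")
  case True
  have g: "smooth_near p g" using smooth_near_cong[OF True assms(2-4)] .
  show ?thesis
    using assms(1)
  proof (rule tangent_spaceE)
    fix V \<phi> h assume c: "(V, \<phi>) \<in> atlas" "p \<in> V" and v: "v = chart_vec (V, \<phi>) p h"
    have "((\<lambda>x. g (inv_into V \<phi> x)) has_derivative
      frechet_derivative (\<lambda>x. f (inv_into V \<phi> x)) (at (\<phi> p))) (at (\<phi> p))"
      by (rule has_derivative_transform_within_open[OF smooth_near_has_derivative[OF True c]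
          chart_image_open[OF c(1) assms(2)]]) (use assms(3,4) c chart_inverse[OF c(1)] in auto)
    then show ?thesis unfolding v by (simp add: chart_vec_eqI[OF g c] chart_vec_apply[OF True])
  qed
next
  case False
  \<comment> \<open>Neither function is smooth near \<open>p\<close>, so both values are the default
    0 of \<open>chart_vec\<close>.\<close>
  then have "\<not> smooth_near p g" using smooth_near_cong[of p g U f] assms by auto
  then show ?thesis using False tangent_not_smooth[OF assms(1)] by simp
qed

lemma tangent_cmult:
  assumes "v \<in> tangent_space p" "smooth_near p f"
  shows "v (\<lambda>q. c * f q) = c * v f"
  using tangent_mult[OF assms(1) smooth_near_const assms(2)] tangent_const[OF assms(1)] by simp

lemma tangent_minus:
  assumes "v \<in> tangent_space p" "smooth_near p f"
  shows "v (\<lambda>q. - f q) = - v f"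
  using tangent_cmult[OF assms, of "-1"] by simp

lemma tangent_diff:
  assumes "v \<in> tangent_space p" "smooth_near p f" "smooth_near p g"
  shows "v (\<lambda>q. f q - g q) = v f - v g"
  using tangent_add[OF assms(1,2), of "\<lambda>q. - g q"] tangent_minus[OF assms(1,3)]
    smooth_near_mult[OF smooth_near_const[of p "-1"] assms(3)] by simp

lemma tangent_constant_near:
  assumes "v \<in> tangent_space p" "open U" "p \<in> U" "\<And>q. q \<in> U \<Longrightarrow> f q = c"
  shows "v f = 0"
  using tangent_local[OF assms(1-3), of f "\<lambda>_. c"] tangent_const[OF assms(1)] assms(4) by simp

lemma linear_chart_vec:
  assumes "(V, \<phi>) \<in> atlas" "p \<in> V"
  shows "linear (chart_vec (V, \<phi>) p)"
proof (rule linearI)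
  have lin: "linear (frechet_derivative (\<lambda>x. f (inv_into V \<phi> x)) (at (\<phi> p)))" if "smooth_near p f" for f
    using has_derivative_linear[OF smooth_near_has_derivative[OF that assms]] .
  fix h k r
  show "chart_vec (V, \<phi>) p (h + k) = chart_vec (V, \<phi>) p h + chart_vec (V, \<phi>) p k"
    by (auto simp: chart_vec_def comp_def fun_eq_iff linear_add[OF lin])
  show "chart_vec (V, \<phi>) p (r *\<^sub>R h) = r *\<^sub>R chart_vec (V, \<phi>) p h"
    by (auto simp: chart_vec_def comp_def fun_eq_iff scaleR_fun_def linear_cmul[OF lin])
qed

lemma smooth_fun_coordinate:
  assumes "(V, \<phi>) \<in> atlas"
  shows "smooth_fun V (\<lambda>q. \<phi> q $ i)"
proof (rule smooth_funI)
  fix V' \<phi>' assume c': "(V', \<phi>') \<in> (atlas :: ('a set \<times> ('a \<Rightarrow> real^3)) set)"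
  have "smooth_on (\<phi>' ` (V' \<inter> V)) (\<phi> \<circ> inv_into V' \<phi>')"
    using chart_transition[OF c' assms] .
  moreover have "open (\<phi>' ` (V \<inter> V'))"
    using chart_image_open[OF c' chart_domain_open[OF assms]] .
  ultimately show "smooth_on (\<phi>' ` (V \<inter> V')) (\<lambda>x. \<phi> (inv_into V' \<phi>' x) $ i)"
    unfolding smooth_on_def comp_def Int_commute[of V']
    by (intro allI Ck_on_bounded_linear[OF _ bounded_linear_vec_nth]) auto
qed

text \<open>Recovers the components of a vector field by applying it to coordinate functions, which
  are smooth; \<open>lie_bracket_tangent\<close> expands fields this way.\<close>

lemma chart_vec_coordinate:
  assumes "(V, \<phi>) \<in> atlas" "p \<in> V"
  shows "chart_vec (V, \<phi>) p h (\<lambda>q. \<phi> q $ i) = h $ i"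
proof (rule chart_vec_eqI[OF _ assms])
  show "smooth_near p (\<lambda>q. \<phi> q $ i)"
    using smooth_nearI[OF chart_domain_open[OF assms(1)] assms(2) smooth_fun_coordinate[OF assms(1)]] .
  show "((\<lambda>x. \<phi> (inv_into V \<phi> x) $ i) has_derivative (\<lambda>h. h $ i)) (at (\<phi> p))"
    by (rule has_derivative_transform_within_open[OF bounded_linear_imp_has_derivative[OF bounded_linear_vec_nth]
          chart_homeomorphism(1)[OF assms(1)]])
      (use assms chart_inverse[OF assms(1)] in auto)
qed

text \<open>By the chain rule, a vector given in another chart is transported by the derivative of
  the transition map. One chart thus carries the whole tangent space with its linear
  structure.\<close>

lemma tangent_space_chart:
  assumes "(V, \<phi>) \<in> atlas" "p \<in> V"
  shows "tangent_space p = range (chart_vec (V, \<phi>) p)"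
proof
  show "range (chart_vec (V, \<phi>) p) \<subseteq> tangent_space p"
    using assms by (force simp: tangent_space_def)
  show "tangent_space p \<subseteq> range (chart_vec (V, \<phi>) p)"
  proof
    fix v assume "v \<in> tangent_space p"
    then obtain V' \<phi>' h where c': "(V', \<phi>') \<in> atlas" "p \<in> V'" and v: "v = chart_vec (V', \<phi>') p h"
      by (rule tangent_spaceE)
    define \<tau> where "\<tau> = \<phi> \<circ> inv_into V' \<phi>'"
    define O' where "O' = \<phi>' ` (V \<inter> V')"
    have O': "open O'" "\<phi>' p \<in> O'"
      unfolding O'_def using chart_image_open[OF c'(1) chart_domain_open[OF assms(1)]] assms c' by auto
    have "smooth_on O' \<tau>"
      using chart_transition[OF c'(1) assms(1)] unfolding O'_def \<tau>_def by (simp add: Int_commute)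
    then have D\<tau>: "(\<tau> has_derivative frechet_derivative \<tau> (at (\<phi>' p))) (at (\<phi>' p))"
      using smooth_on_has_derivative O'(2) by blast
    have \<tau>p: "\<tau> (\<phi>' p) = \<phi> p" unfolding \<tau>_def using chart_inverse[OF c'] by simp
    have "v f = chart_vec (V, \<phi>) p (frechet_derivative \<tau> (at (\<phi>' p)) h) f" for f
    proof (cases "smooth_near p f")
      case True
      define F where "F = (\<lambda>x. f (inv_into V \<phi> x))"
      have DF: "(F has_derivative frechet_derivative F (at (\<tau> (\<phi>' p)))) (at (\<tau> (\<phi>' p)))"
        unfolding \<tau>p F_def by (rule smooth_near_has_derivative[OF True assms])
      have "((\<lambda>x. F (\<tau> x)) has_derivative
          (\<lambda>h. frechet_derivative F (at (\<tau> (\<phi>' p))) (frechet_derivative \<tau> (at (\<phi>' p)) h))) (at (\<phi>' p))"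
        by (rule has_derivative_compose[OF D\<tau> DF])
      then have "((\<lambda>x. f (inv_into V' \<phi>' x)) has_derivative
          (\<lambda>h. frechet_derivative F (at (\<phi> p)) (frechet_derivative \<tau> (at (\<phi>' p)) h))) (at (\<phi>' p))"
        unfolding \<tau>p
        by (rule has_derivative_transform_within_open[OF _ O'])
          (auto simp: F_def \<tau>_def O'_def chart_inverse[OF c'(1)] chart_inverse[OF assms(1)])
      then show ?thesis
        unfolding v chart_vec_apply[OF True] F_def[symmetric] by (rule chart_vec_eqI[OF True c', unfolded chart_vec_apply[OF True]])
    next
      case False
      then show ?thesis unfolding v by (simp add: chart_vec_def)
    qed
    then show "v \<in> range (chart_vec (V, \<phi>) p)" by blast
  qed
qed

lemma tangent_space_chartE:
  fixes p :: "'a::smooth_3_manifold"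
  obtains V \<phi> where "(V, \<phi>) \<in> atlas" "p \<in> V" "open V" "linear (chart_vec (V, \<phi>) p)"
    "tangent_space p = range (chart_vec (V, \<phi>) p)"
  using atlas_cover[of p] linear_chart_vec tangent_space_chart chart_domain_open by metis

lemma subspace_tangent_space: "subspace (tangent_space p)"
  by (rule tangent_space_chartE[of p]) (simp add: linear_subspace_image)

lemmas tangent_space_add = subspace_add[OF subspace_tangent_space]
  and tangent_space_diff = subspace_diff[OF subspace_tangent_space]
  and tangent_space_scale = subspace_scale[OF subspace_tangent_space]
  and tangent_space_0 = subspace_0[OF subspace_tangent_space]

text \<open>Three coordinate directions span. This is the dimension count behind
  \<open>kernel_\<theta>\<close>.\<close>

lemma independent_tangent_bound:
  assumes "independent B" "B \<subseteq> tangent_space p"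
  shows "finite B \<and> card B \<le> 3"
proof (rule tangent_space_chartE[of p])
  fix V \<phi> assume lin: "linear (chart_vec (V, \<phi>) p)" and t: "tangent_space p = range (chart_vec (V, \<phi>) p)"
  have "tangent_space p = span (chart_vec (V, \<phi>) p ` Basis)"
    using t linear_span_image[OF lin, of Basis] by simp
  then have "finite B \<and> card B \<le> card (chart_vec (V, \<phi>) p ` (Basis :: (real^3) set))"
    using assms by (intro independent_span_bound) auto
  moreover have "card (chart_vec (V, \<phi>) p ` (Basis :: (real^3) set)) \<le> 3"
    using card_image_le[of "Basis :: (real^3) set" "chart_vec (V, \<phi>) p"] by simp
  ultimately show ?thesis by linarith
qed


section \<open>Vector fields and the Lie bracket\<close>

lemma vector_fieldD: "vector_field U X \<Longrightarrow> p \<in> U \<Longrightarrow> X p \<in> tangent_space p"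
  by (simp add: vector_field_def)

lemma vector_field_smooth:
  "vector_field U X \<Longrightarrow> open V \<Longrightarrow> V \<subseteq> U \<Longrightarrow> smooth_fun V f \<Longrightarrow> smooth_fun V (\<lambda>p. X p f)"
  by (simp add: vector_field_def)

lemma vector_field_mono: "vector_field U X \<Longrightarrow> U' \<subseteq> U \<Longrightarrow> vector_field U' X"
  unfolding vector_field_def by (meson subset_eq)

lemma vector_field_smooth_near:
  assumes "vector_field U X" "open U" "p \<in> U" "smooth_near p f"
  shows "smooth_near p (\<lambda>q. X q f)"
proof -
  obtain V where V: "open V" "p \<in> V" "smooth_fun V f" using assms(4) by (auto simp: smooth_near_def)
  have "smooth_fun (U \<inter> V) (\<lambda>q. X q f)"
    using vector_field_smooth[OF assms(1), of "U \<inter> V"] V assms(2) by (auto intro: smooth_fun_mono)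
  then show ?thesis using V assms(2,3) by (intro smooth_nearI[of "U \<inter> V"]) auto
qed

lemma vector_field_add:
  assumes "open U" "vector_field U X" "vector_field U Y"
  shows "vector_field U (\<lambda>q. X q + Y q)"
  using assms unfolding vector_field_def
  by (auto intro!: tangent_space_add smooth_fun_add)

lemma vector_field_scale:
  assumes "open U" "smooth_fun U f" "vector_field U X"
  shows "vector_field U (\<lambda>q. f q *\<^sub>R X q)"
  using assms tangent_space_scale[of "X _" _ "f _"] unfolding vector_field_def
  by (auto intro!: smooth_fun_mult intro: smooth_fun_mono simp: scaleR_fun_def)

lemma lie_bracket_apply:
  "smooth_near p f \<Longrightarrow> lie_bracket X Y p f = X p (\<lambda>q. Y q f) - Y p (\<lambda>q. X q f)"
  by (simp add: lie_bracket_def)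

text \<open>In a chart both iterated derivatives of \<open>f\<close> contain the same second-order
  term, by symmetry of second derivatives. It cancels, and what remains is first order in
  \<open>f\<close>, hence a directional derivative.\<close>

lemma lie_bracket_tangent:
  assumes U: "open U" "p \<in> U" and X: "vector_field U X" and Y: "vector_field U Y"
  shows "lie_bracket X Y p \<in> tangent_space p"
proof (rule tangent_space_chartE[of p])
  fix V \<phi> assume c: "(V, \<phi>) \<in> atlas" "p \<in> V" and V: "open V"
    and t: "tangent_space p = range (chart_vec (V, \<phi>) p)"
  let ?\<phi> = "\<lambda>i q. \<phi> q $ i" and ?inv = "inv_into V \<phi>" and ?e = "\<lambda>i::3. axis i (1::real)"
  have coord: "smooth_near p (?\<phi> i)" for i
    using smooth_nearI[OF V c(2) smooth_fun_coordinate[OF c(1)]] .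
  have rep: "Z q f = (\<Sum>j\<in>UNIV. Z q (?\<phi> j) * frechet_derivative (\<lambda>x. f (?inv x)) (at (\<phi> q)) (?e j))"
    if Z: "vector_field U Z" and q: "q \<in> U" "q \<in> V" and f: "smooth_near q f" for Z q f
  proof -
    obtain h where h: "Z q = chart_vec (V, \<phi>) q h"
      using vector_fieldD[OF Z q(1)] tangent_space_chart[OF c(1) q(2)] by auto
    have "h = (\<Sum>j\<in>UNIV. (h $ j) *\<^sub>R ?e j)" using basis_expansion[of h] by (simp add: scalar_mult_eq_scaleR)
    then have "Z q f = frechet_derivative (\<lambda>x. f (?inv x)) (at (\<phi> q)) (\<Sum>j\<in>UNIV. (h $ j) *\<^sub>R ?e j)"
      using h chart_vec_apply[OF f] by metis
    also have "\<dots> = (\<Sum>j\<in>UNIV. (h $ j) * frechet_derivative (\<lambda>x. f (?inv x)) (at (\<phi> q)) (?e j))"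
      using has_derivative_linear[OF smooth_near_has_derivative[OF f c(1) q(2)]]
      by (simp add: linear_sum linear_cmul)
    finally show ?thesis using chart_vec_coordinate[OF c(1) q(2)] h by simp
  qed
  \<comment> \<open>If the bracket is a chart vector at all, its components must be its values on
    the coordinate functions.\<close>
  define k :: "real^3" where "k = (\<chi> i. lie_bracket X Y p (?\<phi> i))"
  have "lie_bracket X Y p f = chart_vec (V, \<phi>) p k f" for f
  proof (cases "smooth_near p f")
    case True
    then obtain U0 where U0: "open U0" "p \<in> U0" "smooth_fun U0 f" by (auto simp: smooth_near_def)
    define O' where "O' = U0 \<inter> U \<inter> V"
    have O': "open O'" "p \<in> O'" "O' \<subseteq> U" "O' \<subseteq> V" "smooth_fun O' f"
      using U0 U V c(2) by (auto simp: O'_def intro: smooth_fun_mono)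
    define F where "F = (\<lambda>x. f (?inv x))"
    define S where "S = \<phi> ` O'"
    have S: "open S" "\<phi> p \<in> S" using chart_image_open[OF c(1) O'(1)] O' by (auto simp: S_def Int_absorb2)
    have F: "smooth_on S F" using smooth_funD[OF O'(5) c(1)] O'(4) by (simp add: S_def F_def Int_absorb2)
    define dF where "dF = (\<lambda>j x. frechet_derivative F (at x) (?e j))"
    have dF: "smooth_on S (dF j)" for j
      unfolding dF_def by (rule smooth_on_frechet_derivative[OF F])
    have sym: "frechet_derivative (dF j) (at (\<phi> p)) (?e i) = frechet_derivative (dF i) (at (\<phi> p)) (?e j)" for i j
      unfolding dF_def by (rule symmetric_second_derivative[OF S(1) smooth_onD[OF F] S(2)])
    \<comment> \<open>The product rule for \<open>Y f\<close>, written as the sum of the components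
      of \<open>Y\<close> times partial derivatives of \<open>f\<close>: a first-order part and a
      Hessian part.\<close>
    have second: "X p (\<lambda>q. Y q f) = (\<Sum>j\<in>UNIV. X p (\<lambda>q. Y q (?\<phi> j)) * dF j (\<phi> p)) +
        (\<Sum>j\<in>UNIV. \<Sum>i\<in>UNIV. Y p (?\<phi> j) * X p (?\<phi> i) * frechet_derivative (dF j) (at (\<phi> p)) (?e i))"
      if X: "vector_field U X" and Y: "vector_field U Y" for X Y
    proof -
      obtain h where h: "X p = chart_vec (V, \<phi>) p h"
        using vector_fieldD[OF X U(2)] tangent_space_chart[OF c] by auto
      have hi: "h $ i = X p (?\<phi> i)" for i using chart_vec_coordinate[OF c] h by simp
      have hs: "h = (\<Sum>j\<in>UNIV. (h $ j) *\<^sub>R ?e j)"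
        using basis_expansion[of h] by (simp add: scalar_mult_eq_scaleR)
      define \<eta> where "\<eta> = (\<lambda>j x. Y (?inv x) (?\<phi> j))"
      have Ysm: "smooth_near p (\<lambda>q. Y q (?\<phi> j))" for j
        by (rule vector_field_smooth_near[OF Y U coord])
      have D\<eta>: "(\<eta> j has_derivative frechet_derivative (\<eta> j) (at (\<phi> p))) (at (\<phi> p))" for j
        unfolding \<eta>_def by (rule smooth_near_has_derivative[OF Ysm c])
      have DdF: "(dF j has_derivative frechet_derivative (dF j) (at (\<phi> p))) (at (\<phi> p))" for j
        by (rule smooth_on_has_derivative[OF dF S(2)])
      have loc: "(\<Sum>j\<in>UNIV. \<eta> j x * dF j x) = Y (?inv x) f" if x: "x \<in> S" for x
      proof -
        obtain q where q: "x = \<phi> q" "q \<in> O'" using x by (auto simp: S_def)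
        then have iq: "?inv x = q" using chart_inverse[OF c(1)] O'(4) by auto
        have "q \<in> U" "q \<in> V" using q(2) O'(3,4) by auto
        then show ?thesis
          using rep[OF Y _ _ smooth_nearI[OF O'(1) q(2) O'(5)]]
          unfolding \<eta>_def dF_def F_def q(1) iq[unfolded q(1)] by simp
      qed
      have "((\<lambda>x. \<Sum>j\<in>UNIV. \<eta> j x * dF j x) has_derivative
        (\<lambda>h. \<Sum>j\<in>UNIV. \<eta> j (\<phi> p) * frechet_derivative (dF j) (at (\<phi> p)) h +
           frechet_derivative (\<eta> j) (at (\<phi> p)) h * dF j (\<phi> p))) (at (\<phi> p))"
        by (intro has_derivative_sum has_derivative_mult D\<eta> DdF)
      then have "((\<lambda>x. Y (?inv x) f) has_derivative
        (\<lambda>h. \<Sum>j\<in>UNIV. \<eta> j (\<phi> p) * frechet_derivative (dF j) (at (\<phi> p)) h +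
           frechet_derivative (\<eta> j) (at (\<phi> p)) h * dF j (\<phi> p))) (at (\<phi> p))"
        by (rule has_derivative_transform_within_open[OF _ S]) (rule loc)
      then have "X p (\<lambda>q. Y q f) = (\<Sum>j\<in>UNIV. \<eta> j (\<phi> p) * frechet_derivative (dF j) (at (\<phi> p)) h +
           frechet_derivative (\<eta> j) (at (\<phi> p)) h * dF j (\<phi> p))"
        unfolding h by (rule chart_vec_eqI[OF vector_field_smooth_near[OF Y U True] c])
      moreover have "frechet_derivative (\<eta> j) (at (\<phi> p)) h = X p (\<lambda>q. Y q (?\<phi> j))" for j
        unfolding h \<eta>_def by (rule chart_vec_apply[OF Ysm, symmetric])
      moreover have "frechet_derivative (dF j) (at (\<phi> p)) h =
          (\<Sum>i\<in>UNIV. X p (?\<phi> i) * frechet_derivative (dF j) (at (\<phi> p)) (?e i))" for j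
        using has_derivative_linear[OF DdF[of j]] hi
        by (subst hs) (simp add: linear_sum linear_cmul)
      moreover have "\<eta> j (\<phi> p) = Y p (?\<phi> j)" for j
        by (simp add: \<eta>_def chart_inverse[OF c])
      ultimately show ?thesis
        by (simp add: sum.distrib sum_distrib_left mult.assoc add.commute)
    qed
    \<comment> \<open>The Hessian part is unchanged when the two fields are exchanged, so it drops
      out of the bracket.\<close>
    have swap: "(\<Sum>j\<in>UNIV. \<Sum>i\<in>UNIV. Y p (?\<phi> j) * X p (?\<phi> i) * frechet_derivative (dF j) (at (\<phi> p)) (?e i)) =
      (\<Sum>j\<in>UNIV. \<Sum>i\<in>UNIV. X p (?\<phi> j) * Y p (?\<phi> i) * frechet_derivative (dF j) (at (\<phi> p)) (?e i))"
      by (subst sum.swap) (simp add: sym mult.commute)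
    have "lie_bracket X Y p f = (\<Sum>j\<in>UNIV. k $ j * dF j (\<phi> p))"
      unfolding lie_bracket_apply[OF True] second[OF X Y] second[OF Y X] swap k_def
      by (simp add: lie_bracket_apply[OF coord] sum_subtractf algebra_simps)
    also have "\<dots> = frechet_derivative F (at (\<phi> p)) (\<Sum>j\<in>UNIV. (k $ j) *\<^sub>R ?e j)"
      using has_derivative_linear[OF smooth_on_has_derivative[OF F S(2)]]
      by (simp add: linear_sum linear_cmul dF_def)
    also have "(\<Sum>j\<in>UNIV. (k $ j) *\<^sub>R ?e j) = k"
      using basis_expansion[of k] by (simp add: scalar_mult_eq_scaleR)
    finally show ?thesis by (simp add: chart_vec_apply[OF True] F_def)
  next
    case False
    then show ?thesis by (simp add: lie_bracket_def chart_vec_def)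
  qed
  then show ?thesis using t by blast
qed

lemma vector_field_lie_bracket:
  assumes "open U" "vector_field U X" "vector_field U Y"
  shows "vector_field U (lie_bracket X Y)"
  unfolding vector_field_def
proof (intro conjI ballI allI impI; (elim conjE)?)
  fix p assume "p \<in> U"
  then show "lie_bracket X Y p \<in> tangent_space p" using lie_bracket_tangent assms by blast
next
  fix V f assume V: "open V" "V \<subseteq> U" and f: "smooth_fun V f"
  have "smooth_fun V (\<lambda>p. X p (\<lambda>q. Y q f) - Y p (\<lambda>q. X q f))"
    using V f by (intro smooth_fun_diff vector_field_smooth[OF assms(2)] vector_field_smooth[OF assms(3)])
  then show "smooth_fun V (\<lambda>p. lie_bracket X Y p f)"
    by (rule smooth_fun_cong[OF V(1)]) (simp add: lie_bracket_apply smooth_nearI[OF V(1) _ f])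
qed

lemma lie_bracket_antisym: "lie_bracket Y X p = - lie_bracket X Y p"
  by (auto simp: lie_bracket_def fun_eq_iff)

lemma lie_bracket_local:
  assumes "open U" "p \<in> U" "vector_field U X" "vector_field U Y"
    and "\<And>q. q \<in> U \<Longrightarrow> X q = X' q" "\<And>q. q \<in> U \<Longrightarrow> Y q = Y' q"
  shows "lie_bracket X Y p = lie_bracket X' Y' p"
proof
  fix f
  have "X p (\<lambda>q. Y q f) = X p (\<lambda>q. Y' q f)" "Y p (\<lambda>q. X q f) = Y p (\<lambda>q. X' q f)"
    by (rule tangent_local[OF vector_fieldD[OF assms(3,2)] assms(1,2)], simp add: assms,
        rule tangent_local[OF vector_fieldD[OF assms(4,2)] assms(1,2)], simp add: assms)
  then show "lie_bracket X Y p f = lie_bracket X' Y' p f"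
    using assms by (simp add: lie_bracket_def)
qed

lemma lie_bracket_add:
  assumes "open U" "p \<in> U" "vector_field U X" "vector_field U Y" "vector_field U Z"
  shows "lie_bracket X (\<lambda>q. Y q + Z q) p = lie_bracket X Y p + lie_bracket X Z p"
proof
  fix f
  show "lie_bracket X (\<lambda>q. Y q + Z q) p f = (lie_bracket X Y p + lie_bracket X Z p) f"
  proof (cases "smooth_near p f")
    case True
    then show ?thesis
      using tangent_add[OF vector_fieldD[OF assms(3,2)] vector_field_smooth_near[OF assms(4,1,2) True]
          vector_field_smooth_near[OF assms(5,1,2) True]]
      by (simp add: lie_bracket_apply)
  qed (simp add: lie_bracket_def)
qed

lemma lie_bracket_scale:
  assumes "open U" "p \<in> U" "vector_field U X" "vector_field U Y" "smooth_near p f"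
  shows "lie_bracket X (\<lambda>q. f q *\<^sub>R Y q) p = f p *\<^sub>R lie_bracket X Y p + X p f *\<^sub>R Y p"
proof
  fix k
  show "lie_bracket X (\<lambda>q. f q *\<^sub>R Y q) p k = (f p *\<^sub>R lie_bracket X Y p + X p f *\<^sub>R Y p) k"
  proof (cases "smooth_near p k")
    case True
    then show ?thesis
      using tangent_mult[OF vector_fieldD[OF assms(3,2)] assms(5) vector_field_smooth_near[OF assms(4,1,2) True]]
      by (simp add: lie_bracket_apply scaleR_fun_def algebra_simps)
  next
    case False
    then show ?thesis
      using tangent_not_smooth[OF vector_fieldD[OF assms(4,2)]] by (simp add: lie_bracket_def scaleR_fun_def)
  qed
qed

text \<open>Applied to a function, the cyclic sum expands into twelve triple derivatives that cancel
  in pairs.\<close>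

lemma lie_bracket_jacobi:
  assumes "open U" "p \<in> U" and X: "vector_field U X" and Y: "vector_field U Y" and Z: "vector_field U Z"
  shows "lie_bracket X (lie_bracket Y Z) p + lie_bracket Y (lie_bracket Z X) p
    + lie_bracket Z (lie_bracket X Y) p = 0"
proof
  fix f
  show "(lie_bracket X (lie_bracket Y Z) p + lie_bracket Y (lie_bracket Z X) p
    + lie_bracket Z (lie_bracket X Y) p) f = 0 f"
  proof (cases "smooth_near p f")
    case True
    then obtain V where V: "open V" "p \<in> V" "smooth_fun V f" by (auto simp: smooth_near_def)
    have second: "X p (\<lambda>q. lie_bracket Y Z q f) = X p (\<lambda>q. Y q (\<lambda>r. Z r f)) - X p (\<lambda>q. Z q (\<lambda>r. Y r f))"
      if X: "vector_field U X" and Y: "vector_field U Y" and Z: "vector_field U Z" for X Y Z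
    proof -
      note sm = vector_field_smooth_near[OF _ assms(1,2)]
      \<comment> \<open>The inner bracket unfolds to a difference only at points near which
        \<open>f\<close> is smooth, hence the passage to the neighbourhood \<open>V\<close>.\<close>
      have "X p (\<lambda>q. lie_bracket Y Z q f) = X p (\<lambda>q. Y q (\<lambda>r. Z r f) - Z q (\<lambda>r. Y r f))"
        by (rule tangent_local[OF vector_fieldD[OF X assms(2)] V(1,2)])
          (simp add: lie_bracket_apply smooth_nearI[OF V(1) _ V(3)])
      also have "\<dots> = X p (\<lambda>q. Y q (\<lambda>r. Z r f)) - X p (\<lambda>q. Z q (\<lambda>r. Y r f))"
        by (rule tangent_diff[OF vector_fieldD[OF X assms(2)] sm[OF Y sm[OF Z True]] sm[OF Z sm[OF Y True]]])
      finally show ?thesis .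
    qed
    show ?thesis
      using X Y Z True
      by (simp add: second lie_bracket_apply vector_field_smooth_near[OF _ assms(1,2)])
  qed (simp add: lie_bracket_def)
qed


section \<open>One-forms and the exterior derivative\<close>

lemma one_form_add: "one_form U \<alpha> \<Longrightarrow> p \<in> U \<Longrightarrow> v \<in> tangent_space p \<Longrightarrow> w \<in> tangent_space p \<Longrightarrow>
    \<alpha> p (v + w) = \<alpha> p v + \<alpha> p w"
  by (simp add: one_form_def linear_on_set_def)

lemma one_form_scale: "one_form U \<alpha> \<Longrightarrow> p \<in> U \<Longrightarrow> v \<in> tangent_space p \<Longrightarrow> \<alpha> p (c *\<^sub>R v) = c * \<alpha> p v"
  by (simp add: one_form_def linear_on_set_def)

lemma one_form_minus: "one_form U \<alpha> \<Longrightarrow> p \<in> U \<Longrightarrow> v \<in> tangent_space p \<Longrightarrow> \<alpha> p (- v) = - \<alpha> p v"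
  using one_form_scale[of U \<alpha> p v "-1"] by simp

lemma one_form_diff: "one_form U \<alpha> \<Longrightarrow> p \<in> U \<Longrightarrow> v \<in> tangent_space p \<Longrightarrow> w \<in> tangent_space p \<Longrightarrow>
    \<alpha> p (v - w) = \<alpha> p v - \<alpha> p w"
  using one_form_add[of U \<alpha> p v "-w"] one_form_minus[of U \<alpha> p w]
  by (simp add: subspace_neg[OF subspace_tangent_space])

lemma one_form_0: "one_form U \<alpha> \<Longrightarrow> p \<in> U \<Longrightarrow> \<alpha> p 0 = 0"
  using one_form_scale[of U \<alpha> p 0 0] by (simp add: tangent_space_0)

lemma one_form_mono: "one_form U \<alpha> \<Longrightarrow> U' \<subseteq> U \<Longrightarrow> one_form U' \<alpha>"
  unfolding one_form_def by (meson subset_eq)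

lemma one_form_smooth: "one_form U \<alpha> \<Longrightarrow> open V \<Longrightarrow> V \<subseteq> U \<Longrightarrow> vector_field V X \<Longrightarrow>
    smooth_fun V (\<lambda>p. \<alpha> p (X p))"
  by (simp add: one_form_def)

lemma one_form_smooth_near:
  assumes "open U" "p \<in> U" "one_form U \<alpha>" "vector_field U X"
  shows "smooth_near p (\<lambda>q. \<alpha> q (X q))"
  by (rule smooth_nearI[OF assms(1,2) one_form_smooth[OF assms(3,1) subset_refl assms(4)]])

lemma one_form_plus: "one_form U \<alpha> \<Longrightarrow> one_form U \<beta> \<Longrightarrow> one_form U (\<alpha> + \<beta>)"
  by (auto simp: one_form_def linear_on_set_def algebra_simps intro!: smooth_fun_add)

lemma one_form_fun_form:
  assumes "smooth_fun U f" "one_form U \<alpha>"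
  shows "one_form U (fun_form f \<alpha>)"
  unfolding one_form_def
proof (intro conjI ballI allI impI; (elim conjE)?)
  fix p assume "p \<in> U"
  then show "linear_on_set (tangent_space p) (fun_form f \<alpha> p)"
    using assms(2) by (simp add: one_form_def linear_on_set_def fun_form_def algebra_simps)
next
  fix V X assume "open V" "V \<subseteq> U" "vector_field V X"
  then show "smooth_fun V (\<lambda>p. fun_form f \<alpha> p (X p))"
    unfolding fun_form_def
    by (intro smooth_fun_mult one_form_smooth[OF assms(2)] smooth_fun_mono[OF assms(1)])
qed

text \<open>The invariant formula for fixed fields. Its tensoriality has to be proved before the
  definite description in \<open>ext_d\<close> can be evaluated.\<close>

definition d_formula :: "'a::smooth_3_manifold form1 \<Rightarrow> ('a \<Rightarrow> 'a tvec) \<Rightarrow> ('a \<Rightarrow> 'a tvec) \<Rightarrow> 'a \<Rightarrow> real" where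
  "d_formula \<alpha> X Y p = X p (\<lambda>q. \<alpha> q (Y q)) - Y p (\<lambda>q. \<alpha> q (X q)) - \<alpha> p (lie_bracket X Y p)"

lemma d_formula_antisym:
  assumes "open U" "p \<in> U" "one_form U \<alpha>" "vector_field U X" "vector_field U Y"
  shows "d_formula \<alpha> Y X p = - d_formula \<alpha> X Y p"
  using one_form_minus[OF assms(3,2) lie_bracket_tangent[OF assms(1,2,4,5)]]
  by (simp add: d_formula_def lie_bracket_antisym[of Y X])

lemma d_formula_local:
  assumes "open U" "p \<in> U" "vector_field U X" "vector_field U Y"
    and "\<And>q. q \<in> U \<Longrightarrow> X q = X' q" "\<And>q. q \<in> U \<Longrightarrow> Y q = Y' q"
  shows "d_formula \<alpha> X Y p = d_formula \<alpha> X' Y' p"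
proof -
  have "X p (\<lambda>q. \<alpha> q (Y q)) = X p (\<lambda>q. \<alpha> q (Y' q))" "Y p (\<lambda>q. \<alpha> q (X q)) = Y p (\<lambda>q. \<alpha> q (X' q))"
    by (rule tangent_local[OF vector_fieldD[OF assms(3,2)] assms(1,2)], simp add: assms,
        rule tangent_local[OF vector_fieldD[OF assms(4,2)] assms(1,2)], simp add: assms)
  then show ?thesis
    using lie_bracket_local[OF assms] assms(2,5,6) by (simp add: d_formula_def)
qed

lemma d_formula_add:
  assumes "open U" "p \<in> U" "one_form U \<alpha>" "vector_field U X" "vector_field U Y" "vector_field U Z"
  shows "d_formula \<alpha> X (\<lambda>q. Y q + Z q) p = d_formula \<alpha> X Y p + d_formula \<alpha> X Z p"
proof -
  have "X p (\<lambda>q. \<alpha> q (Y q + Z q)) = X p (\<lambda>q. \<alpha> q (Y q) + \<alpha> q (Z q))"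
    by (rule tangent_local[OF vector_fieldD[OF assms(4,2)] assms(1,2)])
      (rule one_form_add[OF assms(3) _ vector_fieldD[OF assms(5)] vector_fieldD[OF assms(6)]])
  also have "\<dots> = X p (\<lambda>q. \<alpha> q (Y q)) + X p (\<lambda>q. \<alpha> q (Z q))"
    by (rule tangent_add[OF vector_fieldD[OF assms(4,2)] one_form_smooth_near[OF assms(1-3,5)]
          one_form_smooth_near[OF assms(1-3,6)]])
  finally show ?thesis
    by (simp add: d_formula_def lie_bracket_add[OF assms(1,2,4-6)]
        one_form_add[OF assms(3,2) lie_bracket_tangent[OF assms(1,2,4,5)] lie_bracket_tangent[OF assms(1,2,4,6)]])
qed

text \<open>The product rule and the bracket both contribute
  \<open>X p f * \<alpha> p (Y p)\<close>, with opposite signs, so no derivative of \<open>f\<close>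
  survives. This makes the formula depend on the fields only pointwise.\<close>

lemma d_formula_scale:
  assumes "open U" "p \<in> U" "one_form U \<alpha>" "vector_field U X" "vector_field U Y" "smooth_near p f"
  shows "d_formula \<alpha> X (\<lambda>q. f q *\<^sub>R Y q) p = f p * d_formula \<alpha> X Y p"
proof -
  have "X p (\<lambda>q. \<alpha> q (f q *\<^sub>R Y q)) = X p (\<lambda>q. f q * \<alpha> q (Y q))"
    by (rule tangent_local[OF vector_fieldD[OF assms(4,2)] assms(1,2)])
      (rule one_form_scale[OF assms(3) _ vector_fieldD[OF assms(5)]])
  also have "\<dots> = f p * X p (\<lambda>q. \<alpha> q (Y q)) + X p f * \<alpha> p (Y p)"
    by (rule tangent_mult[OF vector_fieldD[OF assms(4,2)] assms(6) one_form_smooth_near[OF assms(1-3,5)]])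
  finally have "X p (\<lambda>q. \<alpha> q (f q *\<^sub>R Y q)) = f p * X p (\<lambda>q. \<alpha> q (Y q)) + X p f * \<alpha> p (Y p)" .
  moreover have "\<alpha> p (lie_bracket X (\<lambda>q. f q *\<^sub>R Y q) p) = f p * \<alpha> p (lie_bracket X Y p) + X p f * \<alpha> p (Y p)"
    unfolding lie_bracket_scale[OF assms(1,2,4-6)]
    using one_form_add[OF assms(3,2)] one_form_scale[OF assms(3,2)] lie_bracket_tangent[OF assms(1,2,4,5)]
      vector_fieldD[OF assms(5,2)] by (simp add: tangent_space_scale)
  moreover have "(f p *\<^sub>R Y p) (\<lambda>q. \<alpha> q (X q)) = f p * Y p (\<lambda>q. \<alpha> q (X q))"
    by (simp add: scaleR_fun_def)
  ultimately show ?thesis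
    unfolding d_formula_def by (simp add: algebra_simps)
qed

text \<open>Expansion with smooth coefficients in a frame and its dual turns linearity over
  functions into dependence on the values at a point. The instance of interest is the Reeb field
  together with an orthonormal frame of \<open>H\<close>.\<close>

locale local_frame =
  fixes U :: "'a::smooth_3_manifold set"
    and E\<^sub>0 E\<^sub>1 E\<^sub>2 :: "'a \<Rightarrow> 'a tvec" and \<epsilon>\<^sub>0 \<epsilon>\<^sub>1 \<epsilon>\<^sub>2 :: "'a form1"
  assumes open_U: "open U"
    and fields: "vector_field U E\<^sub>0" "vector_field U E\<^sub>1" "vector_field U E\<^sub>2"
    and forms: "one_form U \<epsilon>\<^sub>0" "one_form U \<epsilon>\<^sub>1" "one_form U \<epsilon>\<^sub>2"
    and dual: "\<And>p. p \<in> U \<Longrightarrow> \<epsilon>\<^sub>0 p (E\<^sub>0 p) = 1" "\<And>p. p \<in> U \<Longrightarrow> \<epsilon>\<^sub>0 p (E\<^sub>1 p) = 0" "\<And>p. p \<in> U \<Longrightarrow> \<epsilon>\<^sub>0 p (E\<^sub>2 p) = 0"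
      "\<And>p. p \<in> U \<Longrightarrow> \<epsilon>\<^sub>1 p (E\<^sub>0 p) = 0" "\<And>p. p \<in> U \<Longrightarrow> \<epsilon>\<^sub>1 p (E\<^sub>1 p) = 1" "\<And>p. p \<in> U \<Longrightarrow> \<epsilon>\<^sub>1 p (E\<^sub>2 p) = 0"
      "\<And>p. p \<in> U \<Longrightarrow> \<epsilon>\<^sub>2 p (E\<^sub>0 p) = 0" "\<And>p. p \<in> U \<Longrightarrow> \<epsilon>\<^sub>2 p (E\<^sub>1 p) = 0" "\<And>p. p \<in> U \<Longrightarrow> \<epsilon>\<^sub>2 p (E\<^sub>2 p) = 1"
    and expand: "\<And>p v. p \<in> U \<Longrightarrow> v \<in> tangent_space p \<Longrightarrow>
      v = \<epsilon>\<^sub>0 p v *\<^sub>R E\<^sub>0 p + \<epsilon>\<^sub>1 p v *\<^sub>R E\<^sub>1 p + \<epsilon>\<^sub>2 p v *\<^sub>R E\<^sub>2 p"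
begin

lemma frame_tangent: "p \<in> U \<Longrightarrow> E\<^sub>0 p \<in> tangent_space p" "p \<in> U \<Longrightarrow> E\<^sub>1 p \<in> tangent_space p"
  "p \<in> U \<Longrightarrow> E\<^sub>2 p \<in> tangent_space p"
  using fields vector_fieldD by blast+

lemma linear_expand:
  assumes "p \<in> U" "linear_on_set (tangent_space p) F" "v \<in> tangent_space p"
  shows "F v = \<epsilon>\<^sub>0 p v * F (E\<^sub>0 p) + \<epsilon>\<^sub>1 p v * F (E\<^sub>1 p) + \<epsilon>\<^sub>2 p v * F (E\<^sub>2 p)"
proof -
  have "F v = F (\<epsilon>\<^sub>0 p v *\<^sub>R E\<^sub>0 p + \<epsilon>\<^sub>1 p v *\<^sub>R E\<^sub>1 p + \<epsilon>\<^sub>2 p v *\<^sub>R E\<^sub>2 p)"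
    using expand[OF assms(1,3)] by simp
  also have "\<dots> = \<epsilon>\<^sub>0 p v * F (E\<^sub>0 p) + \<epsilon>\<^sub>1 p v * F (E\<^sub>1 p) + \<epsilon>\<^sub>2 p v * F (E\<^sub>2 p)"
    using assms(2) frame_tangent[OF assms(1)] unfolding linear_on_set_def
    by (simp add: tangent_space_add tangent_space_scale)
  finally show ?thesis .
qed

lemma form_expand:
  assumes "p \<in> U" "one_form V \<alpha>" "p \<in> V" "v \<in> tangent_space p"
  shows "\<alpha> p v = \<epsilon>\<^sub>0 p v * \<alpha> p (E\<^sub>0 p) + \<epsilon>\<^sub>1 p v * \<alpha> p (E\<^sub>1 p) + \<epsilon>\<^sub>2 p v * \<alpha> p (E\<^sub>2 p)"
  using linear_expand[OF assms(1) _ assms(4)] assms(2,3) by (simp add: one_form_def)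

lemma d_formula_expand_right:
  assumes "p \<in> U" "open V" "V \<subseteq> U" "p \<in> V" "one_form V \<alpha>" "vector_field V X" "vector_field V Y"
  shows "d_formula \<alpha> X Y p = \<epsilon>\<^sub>0 p (Y p) * d_formula \<alpha> X E\<^sub>0 p + \<epsilon>\<^sub>1 p (Y p) * d_formula \<alpha> X E\<^sub>1 p
    + \<epsilon>\<^sub>2 p (Y p) * d_formula \<alpha> X E\<^sub>2 p"
proof -
  note f = fields[THEN vector_field_mono[OF _ assms(3)]]
  have sm: "smooth_fun V (\<lambda>q. \<epsilon>\<^sub>0 q (Y q))" "smooth_fun V (\<lambda>q. \<epsilon>\<^sub>1 q (Y q))" "smooth_fun V (\<lambda>q. \<epsilon>\<^sub>2 q (Y q))"
    by (rule one_form_smooth[OF forms(1) assms(2,3,7)] one_form_smooth[OF forms(2) assms(2,3,7)]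
        one_form_smooth[OF forms(3) assms(2,3,7)])+
  note vs = vector_field_scale[OF assms(2) sm(1) f(1)] vector_field_scale[OF assms(2) sm(2) f(2)]
    vector_field_scale[OF assms(2) sm(3) f(3)]
  note sn = sm[THEN smooth_nearI[OF assms(2,4)]]
  have "d_formula \<alpha> X Y p =
      d_formula \<alpha> X (\<lambda>q. \<epsilon>\<^sub>0 q (Y q) *\<^sub>R E\<^sub>0 q + \<epsilon>\<^sub>1 q (Y q) *\<^sub>R E\<^sub>1 q + \<epsilon>\<^sub>2 q (Y q) *\<^sub>R E\<^sub>2 q) p"
    by (rule d_formula_local[OF assms(2,4,6,7)])
      (use expand vector_fieldD[OF assms(7)] assms(3) in auto)
  then show ?thesis
    by (simp add: d_formula_add[OF assms(2,4-6)] vs vector_field_add[OF assms(2)]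
        d_formula_scale[OF assms(2,4-6)] f sn)
qed

text \<open>Expanding both slots and using antisymmetry leaves three basic values, with coefficients
  that involve \<open>X\<close> and \<open>Y\<close> only at \<open>p\<close>. The set
  \<open>V\<close> admits fields that are given only on part of \<open>U\<close>.\<close>

lemma d_formula_expand:
  assumes "p \<in> U" "open V" "V \<subseteq> U" "p \<in> V" "one_form V \<alpha>" "vector_field V X" "vector_field V Y"
  shows "d_formula \<alpha> X Y p =
      (\<epsilon>\<^sub>0 p (X p) * \<epsilon>\<^sub>1 p (Y p) - \<epsilon>\<^sub>0 p (Y p) * \<epsilon>\<^sub>1 p (X p)) * d_formula \<alpha> E\<^sub>0 E\<^sub>1 p
    + (\<epsilon>\<^sub>0 p (X p) * \<epsilon>\<^sub>2 p (Y p) - \<epsilon>\<^sub>0 p (Y p) * \<epsilon>\<^sub>2 p (X p)) * d_formula \<alpha> E\<^sub>0 E\<^sub>2 p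
    + (\<epsilon>\<^sub>1 p (X p) * \<epsilon>\<^sub>2 p (Y p) - \<epsilon>\<^sub>1 p (Y p) * \<epsilon>\<^sub>2 p (X p)) * d_formula \<alpha> E\<^sub>1 E\<^sub>2 p"
proof -
  note f = fields[THEN vector_field_mono[OF _ assms(3)]]
  note ant = d_formula_antisym[OF assms(2,4,5)]
  have "d_formula \<alpha> X Y p = - (\<epsilon>\<^sub>0 p (Y p) * d_formula \<alpha> E\<^sub>0 X p + \<epsilon>\<^sub>1 p (Y p) * d_formula \<alpha> E\<^sub>1 X p
    + \<epsilon>\<^sub>2 p (Y p) * d_formula \<alpha> E\<^sub>2 X p)"
    unfolding d_formula_expand_right[OF assms]
    by (simp add: ant[OF assms(6) f(1)] ant[OF assms(6) f(2)] ant[OF assms(6) f(3)])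
  moreover have "d_formula \<alpha> E\<^sub>0 E\<^sub>0 p = 0" "d_formula \<alpha> E\<^sub>1 E\<^sub>1 p = 0" "d_formula \<alpha> E\<^sub>2 E\<^sub>2 p = 0"
    using ant[OF f(1) f(1)] ant[OF f(2) f(2)] ant[OF f(3) f(3)] by auto
  ultimately show ?thesis
    unfolding d_formula_expand_right[OF assms(1-5) f(1) assms(6)]
      d_formula_expand_right[OF assms(1-5) f(2) assms(6)] d_formula_expand_right[OF assms(1-5) f(3) assms(6)]
      ant[OF f(1) f(2)] ant[OF f(1) f(3)] ant[OF f(2) f(3)]
    by (simp add: algebra_simps)
qed

lemma extension:
  assumes "p \<in> U" "v \<in> tangent_space p"
  obtains X where "vector_field U X" "X p = v"
proof
  show "vector_field U (\<lambda>q. \<epsilon>\<^sub>0 p v *\<^sub>R E\<^sub>0 q + \<epsilon>\<^sub>1 p v *\<^sub>R E\<^sub>1 q + \<epsilon>\<^sub>2 p v *\<^sub>R E\<^sub>2 q)"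
    by (intro vector_field_add vector_field_scale open_U fields smooth_fun_const)
  show "\<epsilon>\<^sub>0 p v *\<^sub>R E\<^sub>0 p + \<epsilon>\<^sub>1 p v *\<^sub>R E\<^sub>1 p + \<epsilon>\<^sub>2 p v *\<^sub>R E\<^sub>2 p = v"
    using expand[OF assms] by simp
qed

text \<open>Discharges the definite description in \<open>ext_d\<close>: two extensions of the same
  pair of vectors, restricted to \<open>U\<close> and expanded in the frame, give the same
  value.\<close>

lemma ext_d_eq:
  assumes "p \<in> U" "one_form U \<alpha>" "open V" "p \<in> V" "vector_field V X" "vector_field V Y"
  shows "ext_d \<alpha> p (X p) (Y p) = d_formula \<alpha> X Y p"
proof -
  have ext: "d_formula \<alpha> X' Y' p = d_formula \<alpha> X Y p"
    if "open V'" "p \<in> V'" "vector_field V' X'" "vector_field V' Y'" "X' p = X p" "Y' p = Y p" for V' X' Y'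
  proof -
    let ?V = "U \<inter> V" and ?V' = "U \<inter> V'"
    have a: "one_form ?V \<alpha>" "one_form ?V' \<alpha>" using assms(2) by (auto intro: one_form_mono)
    have b: "vector_field ?V X" "vector_field ?V Y" "vector_field ?V' X'" "vector_field ?V' Y'"
      using assms that by (auto intro: vector_field_mono)
    show ?thesis
      using d_formula_expand[OF assms(1) _ _ _ a(1) b(1,2)] d_formula_expand[OF assms(1) _ _ _ a(2) b(3,4)]
        that assms open_Int[OF open_U] by simp
  qed
  show ?thesis
    unfolding ext_d_def
  proof (rule the_equality)
    show "\<forall>U' X' Y'. open U' \<and> p \<in> U' \<and> vector_field U' X' \<and> vector_field U' Y' \<and> X' p = X p \<and> Y' p = Y p \<longrightarrow>
      d_formula \<alpha> X Y p = X p (\<lambda>q. \<alpha> q (Y' q)) - Y p (\<lambda>q. \<alpha> q (X' q)) - \<alpha> p (lie_bracket X' Y' p)"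
    proof (intro allI impI, elim conjE)
      fix V' X' Y' assume "open V'" "p \<in> V'" "vector_field V' X'" "vector_field V' Y'"
        and e: "X' p = X p" "Y' p = Y p"
      from ext[OF this] show "d_formula \<alpha> X Y p = X p (\<lambda>q. \<alpha> q (Y' q)) - Y p (\<lambda>q. \<alpha> q (X' q)) - \<alpha> p (lie_bracket X' Y' p)"
        by (simp add: d_formula_def e)
    qed
  next
    fix c assume "\<forall>U' X' Y'. open U' \<and> p \<in> U' \<and> vector_field U' X' \<and> vector_field U' Y' \<and> X' p = X p \<and> Y' p = Y p \<longrightarrow>
      c = X p (\<lambda>q. \<alpha> q (Y' q)) - Y p (\<lambda>q. \<alpha> q (X' q)) - \<alpha> p (lie_bracket X' Y' p)"
    then show "c = d_formula \<alpha> X Y p"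
      using assms(3-6) by (auto simp: d_formula_def)
  qed
qed

lemma ext_d_expand:
  assumes "p \<in> U" "one_form U \<alpha>" "v \<in> tangent_space p" "w \<in> tangent_space p"
  shows "ext_d \<alpha> p v w =
      (\<epsilon>\<^sub>0 p v * \<epsilon>\<^sub>1 p w - \<epsilon>\<^sub>0 p w * \<epsilon>\<^sub>1 p v) * ext_d \<alpha> p (E\<^sub>0 p) (E\<^sub>1 p)
    + (\<epsilon>\<^sub>0 p v * \<epsilon>\<^sub>2 p w - \<epsilon>\<^sub>0 p w * \<epsilon>\<^sub>2 p v) * ext_d \<alpha> p (E\<^sub>0 p) (E\<^sub>2 p)
    + (\<epsilon>\<^sub>1 p v * \<epsilon>\<^sub>2 p w - \<epsilon>\<^sub>1 p w * \<epsilon>\<^sub>2 p v) * ext_d \<alpha> p (E\<^sub>1 p) (E\<^sub>2 p)"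
proof -
  obtain X where X: "vector_field U X" "X p = v" using extension[OF assms(1,3)] .
  obtain Y where Y: "vector_field U Y" "Y p = w" using extension[OF assms(1,4)] .
  note eq = ext_d_eq[OF assms(1,2) open_U assms(1)]
  show ?thesis
    using d_formula_expand[OF assms(1) open_U subset_refl assms(1,2) X(1) Y(1)] eq[OF X(1) Y(1)] X(2) Y(2)
      eq[OF fields(1,2)] eq[OF fields(1,3)] eq[OF fields(2,3)] by simp
qed

lemma ext_d_antisym:
  assumes "p \<in> U" "one_form U \<alpha>" "v \<in> tangent_space p" "w \<in> tangent_space p"
  shows "ext_d \<alpha> p w v = - ext_d \<alpha> p v w"
  unfolding ext_d_expand[OF assms] ext_d_expand[OF assms(1,2,4,3)] by (simp add: algebra_simps)

lemma ext_d_apply: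
  assumes "p \<in> U" "one_form U \<alpha>" "vector_field U X" "vector_field U Y"
  shows "ext_d \<alpha> p (X p) (Y p) = X p (\<lambda>q. \<alpha> q (Y q)) - Y p (\<lambda>q. \<alpha> q (X q)) - \<alpha> p (lie_bracket X Y p)"
  using ext_d_eq[OF assms(1,2) open_U assms(1,3,4)] by (simp add: d_formula_def)

lemma ext_d_smooth:
  assumes "one_form U \<alpha>" "vector_field U X" "vector_field U Y"
  shows "smooth_fun U (\<lambda>p. ext_d \<alpha> p (X p) (Y p))"
proof (rule smooth_fun_cong[OF open_U])
  show "smooth_fun U (\<lambda>p. X p (\<lambda>q. \<alpha> q (Y q)) - Y p (\<lambda>q. \<alpha> q (X q)) - \<alpha> p (lie_bracket X Y p))"
    using assms open_U
    by (intro smooth_fun_diff one_form_smooth[OF assms(1)] vector_field_lie_bracket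
        vector_field_smooth[OF assms(2)] vector_field_smooth[OF assms(3)]) auto
qed (simp add: ext_d_apply assms)

end

section \<open>Adapted frames of a sub-Riemannian contact structure\<close>

locale contact_structure =
  fixes H :: "'a::smooth_3_manifold \<Rightarrow> 'a tvec set"
    and g :: "'a form2" and W :: "'a set" and \<theta> :: "'a form1" and T :: "'a \<Rightarrow> 'a tvec"
  assumes sub_riemannian: "sub_riemannian_contact H g"
    and open_W: "open W"
    and normalised: "normalised_contact_form H g W \<theta>"
    and reeb: "reeb_field W \<theta> T"
begin

lemma H_frame:
  obtains U X Y where "open U" "p \<in> U" "vector_field U X" "vector_field U Y"
    "\<And>q. q \<in> U \<Longrightarrow> X q \<noteq> Y q \<and> independent {X q, Y q} \<and> H q = span {X q, Y q}"
  using sub_riemannian unfolding sub_riemannian_contact_def contact_distribution_def rank2_subbundle_def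
  by metis

lemma H_span:
  obtains X Y where "X \<noteq> Y" "independent {X, Y}" "H p = span {X, Y}"
proof (rule H_frame[of p])
  fix U X Y assume "p \<in> U" and "\<And>q. q \<in> U \<Longrightarrow> X q \<noteq> Y q \<and> independent {X q, Y q} \<and> H q = span {X q, Y q}"
  then show thesis using that[of "X p" "Y p"] by blast
qed

lemma subspace_H: "subspace (H p)"
  by (rule H_span[of p]) simp

lemma H_tangent: "v \<in> H p \<Longrightarrow> v \<in> tangent_space p"
proof (rule H_frame[of p])
  fix U X Y assume v: "v \<in> H p" and U: "p \<in> U" "vector_field U X" "vector_field U Y"
    and s: "\<And>q. q \<in> U \<Longrightarrow> X q \<noteq> Y q \<and> independent {X q, Y q} \<and> H q = span {X q, Y q}"
  have "span {X p, Y p} \<subseteq> tangent_space p"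
    by (rule span_minimal) (use U vector_fieldD subspace_tangent_space in auto)
  then show "v \<in> tangent_space p" using v s[OF U(1)] by auto
qed

lemma one_form_\<theta>: "one_form W \<theta>"
  using normalised by (simp add: normalised_contact_form_def nonvanishing_annihilator_def)

lemma \<theta>_H: "p \<in> W \<Longrightarrow> v \<in> H p \<Longrightarrow> \<theta> p v = 0"
  using normalised by (simp add: normalised_contact_form_def nonvanishing_annihilator_def)

lemma vector_field_T: "vector_field W T" and \<theta>_T: "p \<in> W \<Longrightarrow> \<theta> p (T p) = 1"
  and ext_d_\<theta>_T: "p \<in> W \<Longrightarrow> v \<in> tangent_space p \<Longrightarrow> ext_d \<theta> p (T p) v = 0"
  using reeb by (auto simp: reeb_field_def)

lemma T_tangent: "p \<in> W \<Longrightarrow> T p \<in> tangent_space p"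
  by (rule vector_fieldD[OF vector_field_T])

text \<open>A kernel vector outside \<open>H\<close> would be independent of a basis of
  \<open>H\<close>, and the Reeb field lies outside the kernel; together these would be four
  independent tangent vectors.\<close>

lemma kernel_\<theta>:
  assumes p: "p \<in> W" and v: "v \<in> tangent_space p" "\<theta> p v = 0"
  shows "v \<in> H p"
proof (rule ccontr)
  assume nv: "v \<notin> H p"
  obtain X Y where XY: "X \<noteq> Y" "independent {X, Y}" "H p = span {X, Y}"
    by (rule H_span)
  then have XYH: "X \<in> H p" "Y \<in> H p" by (auto intro: span_base)
  have "subspace {u \<in> tangent_space p. \<theta> p u = 0}"
    using one_form_0[OF one_form_\<theta> p] one_form_add[OF one_form_\<theta> p] one_form_scale[OF one_form_\<theta> p]
    by (auto simp: subspace_def tangent_space_0 tangent_space_add tangent_space_scale)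
  then have "span {v, X, Y} \<subseteq> {u \<in> tangent_space p. \<theta> p u = 0}"
    using v XYH \<theta>_H[OF p] H_tangent by (intro span_minimal) auto
  then have nT: "T p \<notin> span {v, X, Y}" using \<theta>_T[OF p] by auto
  have "independent {v, X, Y}" using XY nv by (simp add: independent_insertI)
  then have "independent {T p, v, X, Y}" using nT by (simp add: independent_insertI)
  moreover have "{T p, v, X, Y} \<subseteq> tangent_space p"
    using v XYH H_tangent T_tangent[OF p] by auto
  moreover have "T p \<notin> {v, X, Y}" "v \<notin> {X, Y}"
    using nT span_base[of _ "{v, X, Y}"] nv XYH by auto
  then have "card {T p, v, X, Y} = 4" using XY(1) by simp
  ultimately show False using independent_tangent_bound by fastforce
qed

lemma H_proj_H:
  assumes "p \<in> W" "v \<in> tangent_space p"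
  shows "H_proj \<theta> T p v \<in> H p"
proof (rule kernel_\<theta>[OF assms(1)])
  show "H_proj \<theta> T p v \<in> tangent_space p"
    using T_tangent[OF assms(1)] assms(2) by (simp add: H_proj_def tangent_space_diff tangent_space_scale)
  show "\<theta> p (H_proj \<theta> T p v) = 0"
    unfolding H_proj_def
    using one_form_diff[OF one_form_\<theta> assms(1,2) tangent_space_scale[OF T_tangent[OF assms(1)]]]
      one_form_scale[OF one_form_\<theta> assms(1) T_tangent[OF assms(1)]] \<theta>_T[OF assms(1)] by simp
qed

lemma H_proj_id: "p \<in> W \<Longrightarrow> v \<in> H p \<Longrightarrow> H_proj \<theta> T p v = v"
  by (simp add: H_proj_def \<theta>_H)

lemma g_bilinear: "bilinear_section H H UNIV g" and g_sym: "v \<in> H p \<Longrightarrow> w \<in> H p \<Longrightarrow> g p v w = g p w v"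
  and g_pos: "v \<in> H p \<Longrightarrow> v \<noteq> 0 \<Longrightarrow> g p v v > 0"
  using sub_riemannian by (auto simp: sub_riemannian_contact_def)

lemma g_scale: "v \<in> H p \<Longrightarrow> w \<in> H p \<Longrightarrow> g p (c *\<^sub>R v) w = c * g p v w"
  and g_add_right: "u \<in> H p \<Longrightarrow> v \<in> H p \<Longrightarrow> w \<in> H p \<Longrightarrow> g p w (u + v) = g p w u + g p w v"
  and g_scale_right: "v \<in> H p \<Longrightarrow> w \<in> H p \<Longrightarrow> g p w (c *\<^sub>R v) = c * g p w v"
  using g_bilinear by (auto simp: bilinear_section_def linear_on_set_def)

lemma g_diff_right: "u \<in> H p \<Longrightarrow> v \<in> H p \<Longrightarrow> w \<in> H p \<Longrightarrow> g p w (u - v) = g p w u - g p w v"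
  using g_add_right[of u p "- v" w] g_scale_right[of v p w "-1"] by (simp add: subspace_neg[OF subspace_H])

lemma g_0_right: "w \<in> H p \<Longrightarrow> g p w 0 = 0"
  using g_scale_right[of 0 p w 0] by (simp add: subspace_0[OF subspace_H])

lemma g_smooth:
  assumes "open V" "vector_field V X" "vector_field V Y" "\<And>p. p \<in> V \<Longrightarrow> X p \<in> H p" "\<And>p. p \<in> V \<Longrightarrow> Y p \<in> H p"
  shows "smooth_fun V (\<lambda>p. g p (X p) (Y p))"
  using g_bilinear assms by (simp add: bilinear_section_def)

section \<open>Orthonormal frames of \<open>H\<close> and their dual coframes\<close>

definition orthonormal :: "'a set \<Rightarrow> ('a \<Rightarrow> 'a tvec) \<Rightarrow> ('a \<Rightarrow> 'a tvec) \<Rightarrow> bool" where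
  "orthonormal U X\<^sub>1 X\<^sub>2 \<longleftrightarrow> open U \<and> U \<subseteq> W \<and> vector_field U X\<^sub>1 \<and> vector_field U X\<^sub>2 \<and>
     (\<forall>p\<in>U. X\<^sub>1 p \<in> H p \<and> X\<^sub>2 p \<in> H p \<and> g p (X\<^sub>1 p) (X\<^sub>1 p) = 1 \<and> g p (X\<^sub>2 p) (X\<^sub>2 p) = 1 \<and> g p (X\<^sub>1 p) (X\<^sub>2 p) = 0)"

lemma normalise_field:
  assumes "open U" "vector_field U X" "\<And>p. p \<in> U \<Longrightarrow> X p \<in> H p" "\<And>p. p \<in> U \<Longrightarrow> X p \<noteq> 0"
    and X'_def: "X' = (\<lambda>p. (g p (X p) (X p) powr (-1/2)) *\<^sub>R X p)"
  shows "vector_field U X'" "p \<in> U \<Longrightarrow> X' p \<in> H p" "p \<in> U \<Longrightarrow> g p (X' p) (X' p) = 1"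
proof -
  have pos: "g p (X p) (X p) > 0" if "p \<in> U" for p using g_pos assms(3,4) that by blast
  show "vector_field U X'"
    unfolding X'_def
    by (intro vector_field_scale smooth_fun_powr g_smooth assms(1-3) pos)
  show H': "X' p \<in> H p" if "p \<in> U" for p
    unfolding X'_def using assms(3)[OF that] by (rule subspace_scale[OF subspace_H])
  assume p: "p \<in> U"
  have "g p (X' p) (X' p) = g p (X p) (X p) powr (-1/2) * (g p (X p) (X p) powr (-1/2) * g p (X p) (X p))"
    unfolding X'_def using assms(3)[OF p] by (simp add: g_scale g_scale_right subspace_scale[OF subspace_H])
  also have "\<dots> = g p (X p) (X p) powr (-1/2 + -1/2) * g p (X p) (X p)"
    by (simp only: powr_add mult.assoc)
  also have "\<dots> = 1" using pos[OF p] by (simp add: powr_minus)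
  finally show "g p (X' p) (X' p) = 1" .
qed

text \<open>Gram-Schmidt with smooth coefficients, starting from a local frame given by the rank two
  condition. Independence of that frame keeps both fields nonzero before they are
  normalised.\<close>

lemma orthonormal_exists:
  assumes "p \<in> W" "open V" "p \<in> V"
  obtains U X\<^sub>1 X\<^sub>2 where "orthonormal U X\<^sub>1 X\<^sub>2" "p \<in> U" "U \<subseteq> V"
proof (rule H_frame[of p])
  fix U\<^sub>0 X Y assume U0: "open U\<^sub>0" "p \<in> U\<^sub>0" and XY: "vector_field U\<^sub>0 X" "vector_field U\<^sub>0 Y"
    and fr: "\<And>q. q \<in> U\<^sub>0 \<Longrightarrow> X q \<noteq> Y q \<and> independent {X q, Y q} \<and> H q = span {X q, Y q}"
  define U where "U = U\<^sub>0 \<inter> V \<inter> W"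
  have U: "open U" "p \<in> U" "U \<subseteq> V" "U \<subseteq> W" "U \<subseteq> U\<^sub>0"
    using U0 assms open_W by (auto simp: U_def)
  have X: "vector_field U X" and Y: "vector_field U Y" using XY vector_field_mono U(5) by blast+
  have XH: "X q \<in> H q" and YH: "Y q \<in> H q" and X0: "X q \<noteq> 0" and YX: "Y q \<notin> span {X q}" if "q \<in> U" for q
  proof -
    have q: "X q \<noteq> Y q" "independent {Y q, X q}" "H q = span {X q, Y q}"
      using fr[of q] that U(5) by (auto simp: insert_commute)
    then show "X q \<in> H q" "Y q \<in> H q" by (auto intro: span_base)
    show "X q \<noteq> 0" "Y q \<notin> span {X q}"
      using q(1,2) by (auto simp: independent_insert dest: dependent_zero)
  qed
  define X\<^sub>1 where "X\<^sub>1 = (\<lambda>p. (g p (X p) (X p) powr (-1/2)) *\<^sub>R X p)"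
  have X1: "vector_field U X\<^sub>1" "\<And>q. q \<in> U \<Longrightarrow> X\<^sub>1 q \<in> H q" "\<And>q. q \<in> U \<Longrightarrow> g q (X\<^sub>1 q) (X\<^sub>1 q) = 1"
    using normalise_field[OF U(1) X _ _ X\<^sub>1_def] XH X0 by blast+
  define Z where "Z = (\<lambda>q. Y q + (- g q (X\<^sub>1 q) (Y q)) *\<^sub>R X\<^sub>1 q)"
  have Z: "vector_field U Z"
    unfolding Z_def
    by (intro vector_field_add vector_field_scale smooth_fun_minus g_smooth U(1) X1(1) Y X1(2) YH)
  have ZH: "Z q \<in> H q" if "q \<in> U" for q
    unfolding Z_def using YH[OF that] X1(2)[OF that]
    by (intro subspace_add[OF subspace_H] subspace_scale[OF subspace_H])
  have Z0: "Z q \<noteq> 0" if "q \<in> U" for q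
  proof
    assume "Z q = 0"
    then have "Y q = g q (X\<^sub>1 q) (Y q) *\<^sub>R X\<^sub>1 q"
      unfolding Z_def by (metis add_eq_0_iff2 scaleR_minus_left minus_minus add.inverse_unique)
    also have "\<dots> \<in> span {X q}" unfolding X\<^sub>1_def by (intro span_scale span_base) simp
    finally show False using YX[OF that] by simp
  qed
  define X\<^sub>2 where "X\<^sub>2 = (\<lambda>p. (g p (Z p) (Z p) powr (-1/2)) *\<^sub>R Z p)"
  have X2: "vector_field U X\<^sub>2" "\<And>q. q \<in> U \<Longrightarrow> X\<^sub>2 q \<in> H q" "\<And>q. q \<in> U \<Longrightarrow> g q (X\<^sub>2 q) (X\<^sub>2 q) = 1"
    using normalise_field[OF U(1) Z _ _ X\<^sub>2_def] ZH Z0 by blast+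
  have orth: "g q (X\<^sub>1 q) (X\<^sub>2 q) = 0" if q: "q \<in> U" for q
  proof -
    have "g q (X\<^sub>1 q) (Z q) = 0"
      unfolding Z_def using X1(2,3)[OF q] YH[OF q]
      by (simp add: g_add_right g_scale_right subspace_scale[OF subspace_H] del: scaleR_minus_left)
    then show ?thesis
      unfolding X\<^sub>2_def using X1(2)[OF q] ZH[OF q] by (simp add: g_scale_right)
  qed
  have "orthonormal U X\<^sub>1 X\<^sub>2"
    unfolding orthonormal_def using U X1 X2 orth by blast
  then show ?thesis using that U by blast
qed

text \<open>The metric dual of \<open>X\<close>, extended by zero along the Reeb field to a form on
  the whole tangent space.\<close>

definition coframe :: "('a \<Rightarrow> 'a tvec) \<Rightarrow> 'a form1" where
  "coframe X = (\<lambda>p v. g p (X p) (H_proj \<theta> T p v))"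

lemma H_proj_linear:
  assumes "p \<in> W" "v \<in> tangent_space p"
  shows "w \<in> tangent_space p \<Longrightarrow> H_proj \<theta> T p (v + w) = H_proj \<theta> T p v + H_proj \<theta> T p w"
    and "H_proj \<theta> T p (c *\<^sub>R v) = c *\<^sub>R H_proj \<theta> T p v"
  using one_form_add[OF one_form_\<theta> assms(1,2)] one_form_scale[OF one_form_\<theta> assms]
  by (auto simp: H_proj_def scaleR_left_distrib scaleR_right_diff_distrib)

lemma one_form_coframe:
  assumes U: "open U" "U \<subseteq> W" and X: "vector_field U X" "\<And>p. p \<in> U \<Longrightarrow> X p \<in> H p"
  shows "one_form U (coframe X)"
  unfolding one_form_def
proof (intro conjI ballI allI impI; (elim conjE)?)
  fix p assume p: "p \<in> U"
  then have pW: "p \<in> W" using U by auto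
  show "linear_on_set (tangent_space p) (coframe X p)"
    unfolding linear_on_set_def coframe_def
    using X(2)[OF p] H_proj_H[OF pW]
    by (auto simp: H_proj_linear[OF pW] g_add_right g_scale_right)
next
  fix V Y assume V: "open V" "V \<subseteq> U" and Y: "vector_field V Y"
  have VW: "V \<subseteq> W" using V U by auto
  have T: "vector_field V T" by (rule vector_field_mono[OF vector_field_T VW])
  have "vector_field V (\<lambda>p. Y p + (- \<theta> p (Y p)) *\<^sub>R T p)"
    by (intro vector_field_add vector_field_scale V Y T smooth_fun_minus one_form_smooth[OF one_form_\<theta> V(1) VW])
  then have "vector_field V (\<lambda>p. H_proj \<theta> T p (Y p))" by (simp add: H_proj_def)
  then show "smooth_fun V (\<lambda>p. coframe X p (Y p))"
    unfolding coframe_def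
    by (rule g_smooth[OF V(1) vector_field_mono[OF X(1) V(2)]])
      (use X(2) V(2) VW H_proj_H vector_fieldD[OF Y] in auto)
qed

lemma coframe_H: "p \<in> W \<Longrightarrow> v \<in> H p \<Longrightarrow> coframe X p v = g p (X p) v"
  by (simp add: coframe_def H_proj_id)

text \<open>The difference between \<open>h\<close> and its projection is orthogonal to both frame
  vectors; were it nonzero, the rank two space \<open>H p\<close> would contain three independent
  vectors.\<close>

lemma orthonormal_expand:
  assumes on: "orthonormal U X\<^sub>1 X\<^sub>2" and p: "p \<in> U" and h: "h \<in> H p"
  shows "h = g p (X\<^sub>1 p) h *\<^sub>R X\<^sub>1 p + g p (X\<^sub>2 p) h *\<^sub>R X\<^sub>2 p"
proof -
  have X: "X\<^sub>1 p \<in> H p" "X\<^sub>2 p \<in> H p" and gX: "g p (X\<^sub>1 p) (X\<^sub>1 p) = 1" "g p (X\<^sub>2 p) (X\<^sub>2 p) = 1"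
    "g p (X\<^sub>1 p) (X\<^sub>2 p) = 0" "g p (X\<^sub>2 p) (X\<^sub>1 p) = 0"
    using on p g_sym[of "X\<^sub>2 p" p "X\<^sub>1 p"] by (auto simp: orthonormal_def)
  define c where "c = g p (X\<^sub>1 p) h *\<^sub>R X\<^sub>1 p + g p (X\<^sub>2 p) h *\<^sub>R X\<^sub>2 p"
  define d where "d = h - c"
  have cH: "c \<in> H p"
    unfolding c_def using X by (intro subspace_add[OF subspace_H] subspace_scale[OF subspace_H])
  then have dH: "d \<in> H p" unfolding d_def using h by (intro subspace_diff[OF subspace_H])
  have "g p (X\<^sub>1 p) c = g p (X\<^sub>1 p) h" "g p (X\<^sub>2 p) c = g p (X\<^sub>2 p) h"
    unfolding c_def using X gX by (simp_all add: g_add_right g_scale_right subspace_scale[OF subspace_H])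
  then have orth: "g p d (X\<^sub>1 p) = 0" "g p d (X\<^sub>2 p) = 0"
    using g_diff_right[OF h cH] X g_sym[OF dH] unfolding d_def by simp_all
  \<comment> \<open>For use with \<open>span_minimal\<close>: orthogonality to generators passes to
    their span, and a nonzero vector is not orthogonal to itself.\<close>
  have perp: "subspace {u \<in> H p. g p w u = 0}" if "w \<in> H p" for w
    using that g_0_right[OF that] g_add_right[OF _ _ that] g_scale_right[OF _ that]
    by (auto simp: subspace_def subspace_0[OF subspace_H] subspace_add[OF subspace_H] subspace_scale[OF subspace_H])
  have "d = 0"
  proof (rule ccontr)
    assume d0: "d \<noteq> 0"
    have nd: "d \<notin> span {X\<^sub>1 p, X\<^sub>2 p}"
    proof
      assume "d \<in> span {X\<^sub>1 p, X\<^sub>2 p}"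
      moreover have "span {X\<^sub>1 p, X\<^sub>2 p} \<subseteq> {u \<in> H p. g p d u = 0}"
        using X orth by (intro span_minimal perp dH) auto
      ultimately show False using g_pos[OF dH d0] by auto
    qed
    have n1: "X\<^sub>1 p \<notin> span {X\<^sub>2 p}"
    proof
      assume "X\<^sub>1 p \<in> span {X\<^sub>2 p}"
      moreover have "span {X\<^sub>2 p} \<subseteq> {u \<in> H p. g p (X\<^sub>1 p) u = 0}"
        using X gX by (intro span_minimal perp) auto
      ultimately show False using gX by auto
    qed
    have "X\<^sub>2 p \<noteq> 0" using gX(2) g_0_right[OF X(2)] by auto
    then have "independent {d, X\<^sub>1 p, X\<^sub>2 p}"
      using nd n1 by (intro independent_insertI independent_empty) auto
    moreover obtain A B where AB: "H p = span {A, B}" by (rule H_span)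
    moreover have "{d, X\<^sub>1 p, X\<^sub>2 p} \<subseteq> H p" using dH X by auto
    ultimately have "card {d, X\<^sub>1 p, X\<^sub>2 p} \<le> card {A, B}"
      using independent_span_bound[of "{A, B}" "{d, X\<^sub>1 p, X\<^sub>2 p}"] by auto
    moreover have "d \<notin> {X\<^sub>1 p, X\<^sub>2 p}" "X\<^sub>1 p \<noteq> X\<^sub>2 p"
      using nd n1 span_base[of d "{X\<^sub>1 p, X\<^sub>2 p}"] span_base[of "X\<^sub>1 p" "{X\<^sub>2 p}"] by auto
    then have "card {d, X\<^sub>1 p, X\<^sub>2 p} = 3" by simp
    moreover have "card {A, B} \<le> 2" by (simp add: card_insert_if)
    ultimately show False by simp
  qed
  then show ?thesis by (simp add: d_def c_def)
qed

text \<open>Subtracting the Reeb component of a tangent vector leaves a vector of \<open>H\<close>,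
  to which \<open>orthonormal_expand\<close> applies.\<close>

lemma orthonormal_local_frame:
  assumes on: "orthonormal U X\<^sub>1 X\<^sub>2"
  shows "local_frame U T X\<^sub>1 X\<^sub>2 \<theta> (coframe X\<^sub>1) (coframe X\<^sub>2)"
proof -
  have U: "open U" "U \<subseteq> W" and X: "vector_field U X\<^sub>1" "vector_field U X\<^sub>2"
    "\<And>p. p \<in> U \<Longrightarrow> X\<^sub>1 p \<in> H p" "\<And>p. p \<in> U \<Longrightarrow> X\<^sub>2 p \<in> H p"
    using on by (auto simp: orthonormal_def)
  have gX: "g p (X\<^sub>1 p) (X\<^sub>1 p) = 1" "g p (X\<^sub>2 p) (X\<^sub>2 p) = 1"
    "g p (X\<^sub>1 p) (X\<^sub>2 p) = 0" "g p (X\<^sub>2 p) (X\<^sub>1 p) = 0" if "p \<in> U" for p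
    using on that g_sym[of "X\<^sub>2 p" p "X\<^sub>1 p"] by (auto simp: orthonormal_def)
  have T0: "coframe X p (T p) = 0" if "p \<in> W" "X p \<in> H p" for X p
    using that by (simp add: coframe_def H_proj_def \<theta>_T g_0_right)
  show ?thesis
  proof
    fix p assume p: "p \<in> U"
    then have pW: "p \<in> W" using U by auto
    show "v = \<theta> p v *\<^sub>R T p + coframe X\<^sub>1 p v *\<^sub>R X\<^sub>1 p + coframe X\<^sub>2 p v *\<^sub>R X\<^sub>2 p"
      if v: "v \<in> tangent_space p" for v
      using orthonormal_expand[OF on p H_proj_H[OF pW v]]
      by (simp add: coframe_def) (simp add: H_proj_def algebra_simps)
    show "\<theta> p (T p) = 1" "\<theta> p (X\<^sub>1 p) = 0" "\<theta> p (X\<^sub>2 p) = 0"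
      "coframe X\<^sub>1 p (T p) = 0" "coframe X\<^sub>1 p (X\<^sub>1 p) = 1" "coframe X\<^sub>1 p (X\<^sub>2 p) = 0"
      "coframe X\<^sub>2 p (T p) = 0" "coframe X\<^sub>2 p (X\<^sub>1 p) = 0" "coframe X\<^sub>2 p (X\<^sub>2 p) = 1"
      using X(3,4)[OF p] gX[OF p] by (simp_all add: \<theta>_T[OF pW] \<theta>_H[OF pW] T0[OF pW] coframe_H[OF pW])
  qed (rule U X vector_field_mono[OF vector_field_T U(2)] one_form_mono[OF one_form_\<theta> U(2)]
      one_form_coframe[OF U X(1,3)] one_form_coframe[OF U X(2,4)] | assumption)+
qed

end

text \<open>The sign condition orients the pair. Since contraction with the Reeb field annihilates
  d\<theta>, it yields d\<theta> = \<open>e\<^sub>1\<close> \<and> \<open>e\<^sub>2\<close> on all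
  tangent vectors.\<close>

locale adapted_frame = contact_structure +
  fixes U :: "'a set" and X\<^sub>1 X\<^sub>2 :: "'a \<Rightarrow> 'a tvec"
  assumes orthonormal: "orthonormal U X\<^sub>1 X\<^sub>2"
    and oriented: "\<And>p. p \<in> U \<Longrightarrow> ext_d \<theta> p (X\<^sub>1 p) (X\<^sub>2 p) = 1"

text \<open>By normalisation the value \<open>s\<close> of d\<theta> on an orthonormal pair squares
  to 1. Multiplying the second vector by \<open>s\<close> itself turns this value into
  \<open>s * s\<close>, and keeps the pair smooth and orthonormal without a case distinction on the
  sign.\<close>

lemma (in contact_structure) adapted_frame_exists:
  assumes "p \<in> W" "open V" "p \<in> V"
  obtains U X\<^sub>1 X\<^sub>2 where "adapted_frame H g W \<theta> T U X\<^sub>1 X\<^sub>2" "p \<in> U" "U \<subseteq> V"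
proof (rule orthonormal_exists[OF assms])
  fix U X\<^sub>1 X\<^sub>2 assume on: "orthonormal U X\<^sub>1 X\<^sub>2" and U: "p \<in> U" "U \<subseteq> V"
  interpret local_frame U T X\<^sub>1 X\<^sub>2 \<theta> "coframe X\<^sub>1" "coframe X\<^sub>2"
    by (rule orthonormal_local_frame[OF on])
  have UW: "U \<subseteq> W" using on by (simp add: orthonormal_def)
  have gX: "X\<^sub>1 q \<in> H q" "X\<^sub>2 q \<in> H q" "g q (X\<^sub>1 q) (X\<^sub>1 q) = 1" "g q (X\<^sub>2 q) (X\<^sub>2 q) = 1"
    "g q (X\<^sub>1 q) (X\<^sub>2 q) = 0" "g q (X\<^sub>2 q) (X\<^sub>1 q) = 0" if "q \<in> U" for q
    using on that g_sym[of "X\<^sub>2 q" q "X\<^sub>1 q"] by (auto simp: orthonormal_def)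
  define s where "s = (\<lambda>q. ext_d \<theta> q (X\<^sub>1 q) (X\<^sub>2 q))"
  have s: "smooth_fun U s" unfolding s_def by (rule ext_d_smooth[OF forms(1) fields(2,3)])
  have s2: "s q * s q = 1" if q: "q \<in> U" for q
  proof -
    \<comment> \<open>The norm in \<open>normalised_contact_form\<close> runs over vectors indexed
      by 0 and 1. Its two off-diagonal terms are equal, so the total 2 means that each square is
      1.\<close>
    define X where "X = (\<lambda>i::nat. if i = 0 then X\<^sub>1 q else X\<^sub>2 q)"
    have XH: "X i \<in> H q" for i using gX[OF q] by (simp add: X_def)
    have Xg: "i < 2 \<Longrightarrow> j < 2 \<Longrightarrow> g q (X i) (X j) = (if i = j then 1 else 0)" for i j
      using gX[OF q] by (auto simp: X_def)
    have qW: "q \<in> W" using q UW by auto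
    have "(\<Sum>i<2. \<Sum>j<2. (ext_d \<theta> q (X i) (X j))\<^sup>2) = 2"
      using normalised qW XH Xg unfolding normalised_contact_form_def by blast
    moreover have "ext_d \<theta> q (X i) (X i) = 0" for i
      using ext_d_antisym[OF q forms(1) H_tangent[OF XH[of i]] H_tangent[OF XH[of i]]] by simp
    moreover have "ext_d \<theta> q (X 1) (X 0) = - ext_d \<theta> q (X 0) (X 1)"
      by (rule ext_d_antisym[OF q forms(1) H_tangent[OF XH] H_tangent[OF XH]])
    ultimately have "(ext_d \<theta> q (X 0) (X 1))\<^sup>2 = 1" by (simp add: numeral_2_eq_2)
    then show ?thesis by (simp add: s_def X_def power2_eq_square)
  qed
  define Y where "Y = (\<lambda>q. s q *\<^sub>R X\<^sub>2 q)"
  have Y: "vector_field U Y" unfolding Y_def by (rule vector_field_scale[OF open_U s fields(3)])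
  have "orthonormal U X\<^sub>1 Y"
    unfolding orthonormal_def using open_U UW fields(2) Y gX s2
    by (auto simp: Y_def g_scale g_scale_right subspace_scale[OF subspace_H] mult.assoc[symmetric])
  moreover have "ext_d \<theta> q (X\<^sub>1 q) (Y q) = 1" if q: "q \<in> U" for q
    using ext_d_expand[OF q forms(1) vector_fieldD[OF fields(2) q] vector_fieldD[OF Y q]] dual[OF q] s2[OF q]
    by (simp add: Y_def one_form_scale[OF forms(1) q frame_tangent(3)[OF q]]
        one_form_scale[OF forms(3) q frame_tangent(3)[OF q]] s_def)
  ultimately have "adapted_frame H g W \<theta> T U X\<^sub>1 Y"
    by unfold_locales
  then show ?thesis using that U by blast
qed

section \<open>Partial connections\<close>

lemma partial_connection_section:
  assumes "partial_connection E W D" "open V" "V \<subseteq> W" "one_form V \<alpha>"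
  shows "bilinear_section E tangent_space V (D \<alpha>)"
  by (rule assms(1)[unfolded partial_connection_def, THEN conjunct1, rule_format]) (use assms in simp)

lemma partial_connection_cong:
  assumes "partial_connection E W D" "open V" "V \<subseteq> W" "one_form V \<alpha>" "one_form V \<beta>"
    "\<And>q u. q \<in> V \<Longrightarrow> u \<in> tangent_space q \<Longrightarrow> \<alpha> q u = \<beta> q u"
    "p \<in> V" "v \<in> E p" "w \<in> tangent_space p"
  shows "D \<alpha> p v w = D \<beta> p v w"
  by (rule assms(1)[unfolded partial_connection_def, THEN conjunct2, THEN conjunct1, rule_format, OF _ assms(7-9)])
    (use assms(2-6) in simp)

lemma partial_connection_add:
  assumes "partial_connection E W D" "open V" "V \<subseteq> W" "one_form V \<alpha>" "one_form V \<beta>"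
    "p \<in> V" "v \<in> E p" "w \<in> tangent_space p"
  shows "D (\<alpha> + \<beta>) p v w = D \<alpha> p v w + D \<beta> p v w"
  by (rule assms(1)[unfolded partial_connection_def, THEN conjunct2, THEN conjunct2, THEN conjunct1, rule_format, OF _ assms(6-8)])
    (use assms(2-5) in simp)

lemma partial_connection_mult:
  assumes "partial_connection E W D" "open V" "V \<subseteq> W" "smooth_fun V f" "one_form V \<alpha>"
    "p \<in> V" "v \<in> E p" "w \<in> tangent_space p"
  shows "D (fun_form f \<alpha>) p v w = f p * D \<alpha> p v w + v f * \<alpha> p w"
  by (rule assms(1)[unfolded partial_connection_def, THEN conjunct2, THEN conjunct2, THEN conjunct2, rule_format, OF _ assms(6-8)])
    (use assms(2-5) in simp)


section \<open>The structure equations\<close>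

context adapted_frame
begin

abbreviation "e\<^sub>1 \<equiv> coframe X\<^sub>1"
abbreviation "e\<^sub>2 \<equiv> coframe X\<^sub>2"

sublocale local_frame U T X\<^sub>1 X\<^sub>2 \<theta> e\<^sub>1 e\<^sub>2
  by (rule orthonormal_local_frame[OF orthonormal])

lemma U_subset_W: "U \<subseteq> W" and in_W: "p \<in> U \<Longrightarrow> p \<in> W"
  using orthonormal by (auto simp: orthonormal_def)

lemma X_H: "p \<in> U \<Longrightarrow> X\<^sub>1 p \<in> H p" "p \<in> U \<Longrightarrow> X\<^sub>2 p \<in> H p"
  using orthonormal by (auto simp: orthonormal_def)

lemma ext_d_\<theta>:
  assumes "p \<in> U" "v \<in> tangent_space p" "w \<in> tangent_space p"
  shows "ext_d \<theta> p v w = e\<^sub>1 p v * e\<^sub>2 p w - e\<^sub>1 p w * e\<^sub>2 p v"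
  using ext_d_expand[OF assms(1) forms(1) assms(2,3)] ext_d_\<theta>_T[OF in_W[OF assms(1)]]
    frame_tangent[OF assms(1)] oriented[OF assms(1)] by simp

text \<open>The structure equations evaluated on the frame are six linear equations for five
  unknowns. The pair \<open>X\<^sub>1\<close>, \<open>X\<^sub>2\<close> gives the components
  \<open>c\<^sub>1\<close>, \<open>c\<^sub>2\<close> of \<omega> along \<open>H\<close>; the pairs
  with \<open>T\<close> give \<open>A\<close> and, by half-difference and half-sum, the component
  \<open>c\<^sub>0\<close> of \<omega> along \<open>T\<close> and the function \<open>B\<close>. The
  sixth equation is the compatibility condition \<open>ext_d_coframe_trace\<close>.\<close>

definition c\<^sub>1 :: "'a \<Rightarrow> real" where "c\<^sub>1 p = ext_d e\<^sub>1 p (X\<^sub>1 p) (X\<^sub>2 p)"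
definition c\<^sub>2 :: "'a \<Rightarrow> real" where "c\<^sub>2 p = ext_d e\<^sub>2 p (X\<^sub>1 p) (X\<^sub>2 p)"
definition c\<^sub>0 :: "'a \<Rightarrow> real" where
  "c\<^sub>0 p = 1/2 * (ext_d e\<^sub>1 p (T p) (X\<^sub>2 p) - ext_d e\<^sub>2 p (T p) (X\<^sub>1 p))"
definition A :: "'a \<Rightarrow> real" where "A p = ext_d e\<^sub>1 p (T p) (X\<^sub>1 p)"
definition B :: "'a \<Rightarrow> real" where
  "B p = 1/2 * (ext_d e\<^sub>1 p (T p) (X\<^sub>2 p) + ext_d e\<^sub>2 p (T p) (X\<^sub>1 p))"
definition \<omega> :: "'a form1" where
  "\<omega> = fun_form c\<^sub>1 e\<^sub>1 + fun_form c\<^sub>2 e\<^sub>2 + fun_form c\<^sub>0 \<theta>"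

lemma smooth_coefficients: "smooth_fun U c\<^sub>1" "smooth_fun U c\<^sub>2" "smooth_fun U c\<^sub>0" "smooth_fun U A" "smooth_fun U B"
  unfolding c\<^sub>1_def c\<^sub>2_def c\<^sub>0_def A_def B_def
  by (intro ext_d_smooth forms fields smooth_fun_mult smooth_fun_add smooth_fun_diff smooth_fun_const open_U)+

lemma one_form_\<omega>: "one_form U \<omega>"
  unfolding \<omega>_def by (intro one_form_plus one_form_fun_form smooth_coefficients forms)

lemma \<omega>_apply: "\<omega> p v = c\<^sub>1 p * e\<^sub>1 p v + c\<^sub>2 p * e\<^sub>2 p v + c\<^sub>0 p * \<theta> p v"
  by (simp add: \<omega>_def fun_form_def)

text \<open>Constant pairings have zero derivative. Frame fields and dual forms pair to constants,
  so the exterior derivatives of these forms encode the brackets of the frame.\<close>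

lemma ext_d_constant:
  assumes "p \<in> U" "one_form U \<alpha>" "vector_field U X" "vector_field U Y"
    "\<And>q. q \<in> U \<Longrightarrow> \<alpha> q (X q) = a" "\<And>q. q \<in> U \<Longrightarrow> \<alpha> q (Y q) = b"
  shows "ext_d \<alpha> p (X p) (Y p) = - \<alpha> p (lie_bracket X Y p)"
  unfolding ext_d_apply[OF assms(1-4)]
  by (simp add: tangent_constant_near[OF vector_fieldD[OF assms(3,1)] open_U assms(1) assms(6)]
      tangent_constant_near[OF vector_fieldD[OF assms(4,1)] open_U assms(1) assms(5)])

text \<open>This is \<open>d(d\<theta>) = 0\<close>, in the form of the Jacobi identity for \<open>T\<close>, \<open>X\<^sub>1\<close>, \<open>X\<^sub>2\<close>.\<close>

lemma ext_d_coframe_trace: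
  assumes p: "p \<in> U"
  shows "ext_d e\<^sub>1 p (T p) (X\<^sub>1 p) + ext_d e\<^sub>2 p (T p) (X\<^sub>2 p) = 0"
proof -
  note vl = vector_field_lie_bracket[OF open_U]
  note tl = lie_bracket_tangent[OF open_U p]
  \<comment> \<open>These brackets have constant \<theta> component, so
    \<open>ext_d_constant\<close> applies a second time, with a bracket as one of the two
    fields.\<close>
  have br: "\<theta> q (lie_bracket T X\<^sub>1 q) = 0" "\<theta> q (lie_bracket X\<^sub>2 T q) = 0" "\<theta> q (lie_bracket X\<^sub>1 X\<^sub>2 q) = - 1"
    if q: "q \<in> U" for q
    using ext_d_constant[OF q forms(1) fields(1,2)] ext_d_constant[OF q forms(1) fields(3,1)]
      ext_d_constant[OF q forms(1) fields(2,3)] dual ext_d_\<theta>[OF q] frame_tangent[OF q] q by simp_all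
  have t1: "\<theta> p (lie_bracket T (lie_bracket X\<^sub>1 X\<^sub>2) p) = 0"
    using ext_d_constant[OF p forms(1) fields(1) vl[OF fields(2,3)]] br dual(1)
      ext_d_\<theta>[OF p frame_tangent(1)[OF p] tl[OF fields(2,3)]] dual[OF p] by simp
  have t2: "\<theta> p (lie_bracket X\<^sub>1 (lie_bracket X\<^sub>2 T) p) = - e\<^sub>2 p (lie_bracket X\<^sub>2 T p)"
    using ext_d_constant[OF p forms(1) fields(2) vl[OF fields(3,1)]] br dual(2)
      ext_d_\<theta>[OF p frame_tangent(2)[OF p] tl[OF fields(3,1)]] dual[OF p] by simp
  have t3: "\<theta> p (lie_bracket X\<^sub>2 (lie_bracket T X\<^sub>1) p) = e\<^sub>1 p (lie_bracket T X\<^sub>1 p)"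
    using ext_d_constant[OF p forms(1) fields(3) vl[OF fields(1,2)]] br dual(3)
      ext_d_\<theta>[OF p frame_tangent(3)[OF p] tl[OF fields(1,2)]] dual[OF p] by simp
  have "\<theta> p (lie_bracket T (lie_bracket X\<^sub>1 X\<^sub>2) p + lie_bracket X\<^sub>1 (lie_bracket X\<^sub>2 T) p
      + lie_bracket X\<^sub>2 (lie_bracket T X\<^sub>1) p) = 0"
    unfolding lie_bracket_jacobi[OF open_U p fields] by (rule one_form_0[OF forms(1) p])
  \<comment> \<open>The double bracket with outer field \<open>T\<close> contributes nothing, since
    d\<theta> vanishes when one argument is \<open>T\<close>.\<close>
  then have "- e\<^sub>2 p (lie_bracket X\<^sub>2 T p) + e\<^sub>1 p (lie_bracket T X\<^sub>1 p) = 0"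
    using tl[OF fields(1) vl[OF fields(2,3)]] tl[OF fields(2) vl[OF fields(3,1)]] tl[OF fields(3) vl[OF fields(1,2)]]
    by (simp add: one_form_add[OF forms(1) p] tangent_space_add t1 t2 t3)
  moreover have "e\<^sub>2 p (lie_bracket X\<^sub>2 T p) = ext_d e\<^sub>2 p (T p) (X\<^sub>2 p)"
    using ext_d_constant[OF p forms(3) fields(3,1)] dual(7,9)
      ext_d_antisym[OF p forms(3) frame_tangent(1)[OF p] frame_tangent(3)[OF p]] by simp
  moreover have "e\<^sub>1 p (lie_bracket T X\<^sub>1 p) = - ext_d e\<^sub>1 p (T p) (X\<^sub>1 p)"
    using ext_d_constant[OF p forms(2) fields(1,2)] dual(4,5) by simp
  ultimately show ?thesis by simp
qed

lemma structure_equations: "structure_equations \<theta> U e\<^sub>1 e\<^sub>2 \<omega> A B"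
  unfolding structure_equations_def
proof (intro conjI one_form_\<omega> smooth_coefficients ballI)
  fix p v w assume p: "p \<in> U" and v: "v \<in> tangent_space p" and w: "w \<in> tangent_space p"
  have E: "ext_d e\<^sub>1 p (T p) (X\<^sub>1 p) = A p" "ext_d e\<^sub>1 p (T p) (X\<^sub>2 p) = B p + c\<^sub>0 p"
    "ext_d e\<^sub>2 p (T p) (X\<^sub>1 p) = B p - c\<^sub>0 p" "ext_d e\<^sub>2 p (T p) (X\<^sub>2 p) = - A p"
    using ext_d_coframe_trace[OF p] by (simp_all add: A_def B_def c\<^sub>0_def algebra_simps)
  show "ext_d e\<^sub>1 p v w = wedge \<omega> e\<^sub>2 p v w + A p * wedge \<theta> e\<^sub>1 p v w + B p * wedge \<theta> e\<^sub>2 p v w"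
    unfolding ext_d_expand[OF p forms(2) v w] E c\<^sub>1_def[symmetric] wedge_def \<omega>_apply
    by (simp add: algebra_simps)
  show "ext_d e\<^sub>2 p v w = - wedge \<omega> e\<^sub>1 p v w + B p * wedge \<theta> e\<^sub>1 p v w - A p * wedge \<theta> e\<^sub>2 p v w"
    unfolding ext_d_expand[OF p forms(3) v w] E c\<^sub>2_def[symmetric] wedge_def \<omega>_apply
    by (simp add: algebra_simps)
qed

text \<open>As [\<open>X\<^sub>1\<close>, \<open>X\<^sub>2\<close>] is
  \<open>- T - c\<^sub>1 X\<^sub>1 - c\<^sub>2 X\<^sub>2\<close>, the value of d\<eta> on
  \<open>H\<close> contains \<open>\<eta> p (T p)\<close>. A form known only on \<open>H\<close>
  gets its component along \<open>T\<close> from a prescribed value of its derivative.\<close>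

lemma ext_d_X:
  assumes p: "p \<in> U" and \<eta>: "one_form U \<eta>"
  shows "ext_d \<eta> p (X\<^sub>1 p) (X\<^sub>2 p) = X\<^sub>1 p (\<lambda>q. \<eta> q (X\<^sub>2 q)) - X\<^sub>2 p (\<lambda>q. \<eta> q (X\<^sub>1 q))
    + \<eta> p (T p) + c\<^sub>1 p * \<eta> p (X\<^sub>1 p) + c\<^sub>2 p * \<eta> p (X\<^sub>2 p)"
proof -
  have "\<theta> p (lie_bracket X\<^sub>1 X\<^sub>2 p) = - 1" "e\<^sub>1 p (lie_bracket X\<^sub>1 X\<^sub>2 p) = - c\<^sub>1 p"
    "e\<^sub>2 p (lie_bracket X\<^sub>1 X\<^sub>2 p) = - c\<^sub>2 p"
    unfolding c\<^sub>1_def c\<^sub>2_def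
    using ext_d_constant[OF p forms(1) fields(2,3)] ext_d_constant[OF p forms(2) fields(2,3)]
      ext_d_constant[OF p forms(3) fields(2,3)] dual oriented[OF p] by simp_all
  then show ?thesis
    using form_expand[OF p \<eta> p lie_bracket_tangent[OF open_U p fields(2,3)]]
    by (simp add: ext_d_apply[OF p \<eta> fields(2,3)])
qed

text \<open>The witness is the rotation taking \<open>X\<^sub>1\<close> to \<open>X\<^sub>2\<close>
  and \<open>X\<^sub>2\<close> to \<open>- X\<^sub>1\<close>, which matches d\<theta> =
  \<open>e\<^sub>1\<close> \<and> \<open>e\<^sub>2\<close>. Uniqueness comes from positivity of
  \<open>g\<close> on the difference of two solutions.\<close>

lemma J_map_eq:
  assumes p: "p \<in> U" and v: "v \<in> H p"
  shows "J_map H g \<theta> p v = e\<^sub>1 p v *\<^sub>R X\<^sub>2 p - e\<^sub>2 p v *\<^sub>R X\<^sub>1 p" (is "_ = ?u")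
  unfolding J_map_def
proof (rule the_equality)
  have uH: "?u \<in> H p"
    using X_H[OF p] by (intro subspace_diff[OF subspace_H] subspace_scale[OF subspace_H])
  moreover have u: "g p ?u w = ext_d \<theta> p v w" if w: "w \<in> H p" for w
  proof -
    have "g p ?u w = e\<^sub>1 p v * g p w (X\<^sub>2 p) - e\<^sub>2 p v * g p w (X\<^sub>1 p)"
      using X_H[OF p] w uH g_sym[OF uH w]
      by (simp add: g_diff_right g_scale_right subspace_scale[OF subspace_H])
    then show ?thesis
      using X_H[OF p] w v in_W[OF p]
      by (simp add: ext_d_\<theta>[OF p H_tangent H_tangent] coframe_H[of p w] g_sym[of w])
  qed
  ultimately show "?u \<in> H p \<and> (\<forall>w\<in>H p. g p ?u w = ext_d \<theta> p v w)" by blast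
  fix u' assume u': "u' \<in> H p \<and> (\<forall>w\<in>H p. g p u' w = ext_d \<theta> p v w)"
  then have dH: "u' - ?u \<in> H p" using uH subspace_diff[OF subspace_H] by blast
  have "g p (u' - ?u) (u' - ?u) = g p (u' - ?u) u' - g p (u' - ?u) ?u"
    by (rule g_diff_right[OF _ uH dH]) (use u' in simp)
  also have "\<dots> = g p u' (u' - ?u) - g p ?u (u' - ?u)"
    using g_sym[OF dH uH] g_sym[OF dH, of u'] u' by simp
  finally have "g p (u' - ?u) (u' - ?u) = 0" using u' u dH by simp
  then show "u' = ?u" using g_pos[OF dH] by fastforce
qed

lemma adapted_coframe: "adapted_coframe H g \<theta> U e\<^sub>1 e\<^sub>2"
  unfolding adapted_coframe_def
proof (intro conjI forms ballI)
  fix p v w assume p: "p \<in> U" and v: "v \<in> tangent_space p" and w: "w \<in> tangent_space p"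
  show "ext_d \<theta> p v w = wedge e\<^sub>1 e\<^sub>2 p v w"
    by (simp add: ext_d_\<theta>[OF p v w] wedge_def)
next
  fix p v assume p: "p \<in> U" and v: "v \<in> H p"
  have "e\<^sub>2 p (e\<^sub>1 p v *\<^sub>R X\<^sub>2 p - e\<^sub>2 p v *\<^sub>R X\<^sub>1 p) = e\<^sub>1 p v"
    using frame_tangent[OF p] dual[OF p]
    by (simp add: one_form_diff[OF forms(3) p] one_form_scale[OF forms(3) p] tangent_space_scale)
  then show "J_form H g \<theta> e\<^sub>2 p v = e\<^sub>1 p v"
    by (simp add: J_form_def J_map_eq[OF p v])
next
  fix p assume p: "p \<in> U"
  show "\<forall>a b c. (\<forall>v\<in>tangent_space p. a * \<theta> p v + b * e\<^sub>1 p v + c * e\<^sub>2 p v = 0) \<longrightarrow> a = 0 \<and> b = 0 \<and> c = 0"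
  proof (intro allI impI)
    fix a b c assume "\<forall>v\<in>tangent_space p. a * \<theta> p v + b * e\<^sub>1 p v + c * e\<^sub>2 p v = 0"
    from bspec[OF this frame_tangent(1)[OF p]] bspec[OF this frame_tangent(2)[OF p]]
      bspec[OF this frame_tangent(3)[OF p]]
    show "a = 0 \<and> b = 0 \<and> c = 0" using dual[OF p] by simp
  qed
qed

text \<open>On the triple \<open>T\<close>, \<open>X\<^sub>1\<close>, \<open>X\<^sub>2\<close> each
  cyclic sum reduces to a single term by duality of frame and coframe.\<close>

lemma curvature_eq:
  assumes "tanaka_webster_curvature H g W \<theta> R" "p \<in> U"
  shows "R p = ext_d \<omega> p (X\<^sub>1 p) (X\<^sub>2 p)"
proof -
  have "wedge21 (ext_d \<omega>) \<theta> p (T p) (X\<^sub>1 p) (X\<^sub>2 p) = R p * wedge21 (wedge \<theta> e\<^sub>1) e\<^sub>2 p (T p) (X\<^sub>1 p) (X\<^sub>2 p)"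
    by (rule assms(1)[unfolded tanaka_webster_curvature_def, rule_format, OF _ assms(2) frame_tangent[OF assms(2)]])
      (use open_U U_subset_W adapted_coframe structure_equations in blast)
  then show ?thesis using dual[OF assms(2)] by (simp add: wedge21_def wedge_def)
qed


section \<open>The canonical partial connection in an adapted frame\<close>

text \<open>The coframe expansion of \<alpha> combined with the Leibniz rule. The terms that
  differentiate coefficients are the same for every connection. \<open>E\<close> is left free so
  that the partial connection and both full connections are covered.\<close>

lemma connection_expand:
  assumes D: "partial_connection E W D" and V: "open V" "V \<subseteq> U" "p \<in> V" and \<alpha>: "one_form V \<alpha>"
    and v: "v \<in> E p" and w: "w \<in> tangent_space p"
  shows "D \<alpha> p v w =
      (\<alpha> p (T p) * D \<theta> p v w + v (\<lambda>q. \<alpha> q (T q)) * \<theta> p w)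
    + (\<alpha> p (X\<^sub>1 p) * D e\<^sub>1 p v w + v (\<lambda>q. \<alpha> q (X\<^sub>1 q)) * e\<^sub>1 p w)
    + (\<alpha> p (X\<^sub>2 p) * D e\<^sub>2 p v w + v (\<lambda>q. \<alpha> q (X\<^sub>2 q)) * e\<^sub>2 p w)"
proof -
  have VW: "V \<subseteq> W" using V U_subset_W by auto
  note add = partial_connection_add[OF D V(1) VW _ _ V(3) v w] and mult = partial_connection_mult[OF D V(1) VW _ _ V(3) v w]
  note f = fields[THEN vector_field_mono[OF _ V(2)]] and e = forms[THEN one_form_mono[OF _ V(2)]]
  note s = one_form_smooth[OF \<alpha> V(1) subset_refl]
  note fe = one_form_fun_form[OF s[OF f(1)] e(1)] one_form_fun_form[OF s[OF f(2)] e(2)]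
    one_form_fun_form[OF s[OF f(3)] e(3)]
  have "D \<alpha> p v w = D (fun_form (\<lambda>q. \<alpha> q (T q)) \<theta> + fun_form (\<lambda>q. \<alpha> q (X\<^sub>1 q)) e\<^sub>1
      + fun_form (\<lambda>q. \<alpha> q (X\<^sub>2 q)) e\<^sub>2) p v w"
  proof (rule partial_connection_cong[OF D V(1) VW \<alpha> one_form_plus[OF one_form_plus[OF fe(1,2)] fe(3)] _ V(3) v w])
    fix q u assume q: "q \<in> V" and u: "u \<in> tangent_space q"
    have "q \<in> U" using q V by auto
    from form_expand[OF this \<alpha> q u]
    show "\<alpha> q u = (fun_form (\<lambda>q. \<alpha> q (T q)) \<theta> + fun_form (\<lambda>q. \<alpha> q (X\<^sub>1 q)) e\<^sub>1
      + fun_form (\<lambda>q. \<alpha> q (X\<^sub>2 q)) e\<^sub>2) q u"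
      by (simp add: fun_form_def mult.commute)
  qed
  then show ?thesis
    by (simp add: add one_form_plus fe mult s f e)
qed

text \<open>Discharges the definite description in \<open>dual_deriv\<close>. Pairing with the
  coframe leaves one candidate; it pairs correctly with every 1-form because both sides obey the
  same Leibniz rule.\<close>

lemma dual_deriv_apply:
  assumes D: "partial_connection H W D" and p: "p \<in> U" and v: "v \<in> H p" and Y: "vector_field U Y"
  shows "dual_deriv W D Y p v \<in> tangent_space p"
    and "open V \<Longrightarrow> p \<in> V \<Longrightarrow> V \<subseteq> W \<Longrightarrow> one_form V \<alpha> \<Longrightarrow>
      \<alpha> p (dual_deriv W D Y p v) = v (\<lambda>q. \<alpha> q (Y q)) - D \<alpha> p v (Y p)"
proof -
  let ?P = "\<lambda>u. u \<in> tangent_space p \<and> (\<forall>V \<alpha>. open V \<and> p \<in> V \<and> V \<subseteq> W \<and> one_form V \<alpha> \<longrightarrow>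
        \<alpha> p u = v (\<lambda>q. \<alpha> q (Y q)) - D \<alpha> p v (Y p))"
  have vt: "v \<in> tangent_space p" by (rule H_tangent[OF v])
  have Yt: "Y p \<in> tangent_space p" by (rule vector_fieldD[OF Y p])
  define k where "k = (\<lambda>\<epsilon>. v (\<lambda>q. \<epsilon> q (Y q)) - D \<epsilon> p v (Y p))"
  define u where "u = k \<theta> *\<^sub>R T p + k e\<^sub>1 *\<^sub>R X\<^sub>1 p + k e\<^sub>2 *\<^sub>R X\<^sub>2 p"
  have ut: "u \<in> tangent_space p"
    unfolding u_def by (intro tangent_space_add tangent_space_scale frame_tangent p)
  have "\<alpha> p u = v (\<lambda>q. \<alpha> q (Y q)) - D \<alpha> p v (Y p)"
    if V: "open V" "p \<in> V" "V \<subseteq> W" and \<alpha>: "one_form V \<alpha>" for V \<alpha>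
  proof -
    let ?V = "V \<inter> U"
    have V': "open ?V" "?V \<subseteq> U" "p \<in> ?V" using V p open_U by auto
    have \<alpha>': "one_form ?V \<alpha>" using \<alpha> by (rule one_form_mono) simp
    note f = fields[THEN vector_field_mono[OF _ V'(2)]] and e = forms[THEN one_form_mono[OF _ V'(2)]]
      and Y' = vector_field_mono[OF Y V'(2)]
    note sm = one_form_smooth_near[OF V'(1,3)]
    note s = sm[OF \<alpha>' f(1)] sm[OF \<alpha>' f(2)] sm[OF \<alpha>' f(3)] sm[OF e(1) Y'] sm[OF e(2) Y'] sm[OF e(3) Y']
    have "v (\<lambda>q. \<alpha> q (Y q)) = v (\<lambda>q. \<alpha> q (T q) * \<theta> q (Y q) + \<alpha> q (X\<^sub>1 q) * e\<^sub>1 q (Y q) + \<alpha> q (X\<^sub>2 q) * e\<^sub>2 q (Y q))"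
      by (rule tangent_local[OF vt V'(1,3)])
        (use form_expand[OF _ \<alpha>' _ vector_fieldD[OF Y]] in \<open>auto simp: mult.commute\<close>)
    also have "\<dots> = (\<alpha> p (T p) * v (\<lambda>q. \<theta> q (Y q)) + v (\<lambda>q. \<alpha> q (T q)) * \<theta> p (Y p))
      + (\<alpha> p (X\<^sub>1 p) * v (\<lambda>q. e\<^sub>1 q (Y q)) + v (\<lambda>q. \<alpha> q (X\<^sub>1 q)) * e\<^sub>1 p (Y p))
      + (\<alpha> p (X\<^sub>2 p) * v (\<lambda>q. e\<^sub>2 q (Y q)) + v (\<lambda>q. \<alpha> q (X\<^sub>2 q)) * e\<^sub>2 p (Y p))"
      using s by (simp add: tangent_add[OF vt] tangent_mult[OF vt] smooth_near_add smooth_near_mult)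
    finally have "v (\<lambda>q. \<alpha> q (Y q)) - D \<alpha> p v (Y p) = \<alpha> p (T p) * k \<theta> + \<alpha> p (X\<^sub>1 p) * k e\<^sub>1 + \<alpha> p (X\<^sub>2 p) * k e\<^sub>2"
      unfolding k_def connection_expand[OF D V' \<alpha>' v Yt] by (simp add: algebra_simps)
    also have "\<dots> = \<alpha> p u"
      unfolding u_def using frame_tangent[OF p]
      by (simp add: one_form_add[OF \<alpha> V(2)] one_form_scale[OF \<alpha> V(2)] tangent_space_add tangent_space_scale)
    finally show ?thesis by simp
  qed
  then have Pu: "?P u" by (intro conjI allI impI ut) blast
  have uniq: "u' = u" if u': "?P u'" for u'
  proof -
    have eq: "\<epsilon> p u' = \<epsilon> p u" if \<epsilon>: "one_form U \<epsilon>" for \<epsilon>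
      using conjunct2[OF u', rule_format, of U \<epsilon>] conjunct2[OF Pu, rule_format, of U \<epsilon>] \<epsilon> open_U p U_subset_W
      by simp
    show ?thesis
      using expand[OF p conjunct1[OF u']] expand[OF p ut] by (simp add: eq[OF forms(1)] eq[OF forms(2)] eq[OF forms(3)])
  qed
  have "?P (THE u. ?P u)" by (rule theI[of ?P, OF Pu uniq])
  then have P: "?P (dual_deriv W D Y p v)" unfolding dual_deriv_def .
  show "dual_deriv W D Y p v \<in> tangent_space p" using conjunct1[OF P] .
  show "open V \<Longrightarrow> p \<in> V \<Longrightarrow> V \<subseteq> W \<Longrightarrow> one_form V \<alpha> \<Longrightarrow>
      \<alpha> p (dual_deriv W D Y p v) = v (\<lambda>q. \<alpha> q (Y q)) - D \<alpha> p v (Y p)" using conjunct2[OF P] by simp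
qed

text \<open>Parallelism of the metric makes the matrix of \<open>D\<close> on
  \<open>e\<^sub>1\<close>, \<open>e\<^sub>2\<close> skew along each vector of \<open>H\<close>,
  leaving one number for each of the two directions. The torsion equations of
  \<open>e\<^sub>1\<close> and \<open>e\<^sub>2\<close> on the pair \<open>X\<^sub>1\<close>,
  \<open>X\<^sub>2\<close> give these two numbers. The factor 1/2 comes from
  \<open>form2_tensor\<close>.\<close>

lemma canonical_values:
  assumes D: "canonical_partial_connection H g W \<theta> T D" and p: "p \<in> U"
  shows "v \<in> H p \<Longrightarrow> w \<in> tangent_space p \<Longrightarrow> D \<theta> p v w = 1/2 * ext_d \<theta> p v w"
    and "v \<in> H p \<Longrightarrow> one_form U \<alpha> \<Longrightarrow> D \<alpha> p v (T p) = v (\<lambda>q. \<alpha> q (T q))"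
    and "v \<in> H p \<Longrightarrow> D e\<^sub>1 p v (X\<^sub>1 p) = 0" and "v \<in> H p \<Longrightarrow> D e\<^sub>2 p v (X\<^sub>2 p) = 0"
    and "D e\<^sub>1 p (X\<^sub>1 p) (X\<^sub>2 p) = c\<^sub>1 p" and "D e\<^sub>1 p (X\<^sub>2 p) (X\<^sub>2 p) = c\<^sub>2 p"
    and "D e\<^sub>2 p (X\<^sub>1 p) (X\<^sub>1 p) = - c\<^sub>1 p" and "D e\<^sub>2 p (X\<^sub>2 p) (X\<^sub>1 p) = - c\<^sub>2 p"
proof -
  have pc: "partial_connection H W D" and tf: "torsion_free_partial H W D"
    and par: "parallel2 H W D (extend2 \<theta> T g)"
    using D by (auto simp: canonical_partial_connection_def)
  note pW = in_W[OF p]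
  show "D \<theta> p v w = 1/2 * ext_d \<theta> p v w" if "v \<in> H p" "w \<in> tangent_space p" for v w
    using D that pW by (auto simp: canonical_partial_connection_def form2_tensor_def scaleR_fun_def)
  \<comment> \<open>This is the vanishing derivative of the Reeb field, read through
    duality.\<close>
  show "D \<alpha> p v (T p) = v (\<lambda>q. \<alpha> q (T q))" if v: "v \<in> H p" and \<alpha>: "one_form U \<alpha>"
  proof -
    have "dual_deriv W D T p v = 0" using D v pW by (auto simp: canonical_partial_connection_def)
    then show ?thesis
      using dual_deriv_apply(2)[OF pc p v fields(1) open_U p U_subset_W \<alpha>] one_form_0[OF \<alpha> p] by simp
  qed
  \<comment> \<open>When \<open>g\<close> is constant on the two fields, the Leibniz rule for the
    metric has no derivative term. \<open>coframe\<close> turns the two remaining inner products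
    into pairings, which duality converts into values of \<open>D\<close>.\<close>
  have skew: "D (coframe Z) p v (Y p) + D (coframe Y) p v (Z p) = 0"
    if v: "v \<in> H p" and YZ: "vector_field U Y" "vector_field U Z" "\<And>q. q \<in> U \<Longrightarrow> Y q \<in> H q" "\<And>q. q \<in> U \<Longrightarrow> Z q \<in> H q"
      and c: "\<And>q. q \<in> U \<Longrightarrow> g q (Y q) (Z q) = a" for v Y Z a
  proof -
    note vt = H_tangent[OF v]
    have G: "extend2 \<theta> T g q u (Z q) = coframe Z q u" "extend2 \<theta> T g q (Z q) u = coframe Z q u"
      if "q \<in> U" "Z q \<in> H q" "u \<in> tangent_space q" for q u Z
      using that in_W[OF that(1)] H_proj_H[OF in_W[OF that(1)] that(3)]
      by (auto simp: extend2_def coframe_def H_proj_id g_sym)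
    have "v (\<lambda>q. extend2 \<theta> T g q (Y q) (Z q)) = 0"
      by (rule tangent_constant_near[OF vt open_U p, of _ a])
        (use YZ c in \<open>simp add: extend2_def H_proj_id in_W\<close>)
    moreover have "v (\<lambda>q. extend2 \<theta> T g q (Y q) (Z q)) - extend2 \<theta> T g p (dual_deriv W D Y p v) (Z p)
        - extend2 \<theta> T g p (Y p) (dual_deriv W D Z p v) = 0"
      by (rule par[unfolded parallel2_def, rule_format, OF _ p v]) (use YZ open_U U_subset_W in simp)
    ultimately have "coframe Z p (dual_deriv W D Y p v) + coframe Y p (dual_deriv W D Z p v) = 0"
      using G[of p Z, OF p YZ(4)[OF p] dual_deriv_apply(1)[OF pc p v YZ(1)]]
        G[of p Y, OF p YZ(3)[OF p] dual_deriv_apply(1)[OF pc p v YZ(2)]] by simp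
    moreover have of: "one_form U (coframe Y)" "one_form U (coframe Z)"
      using YZ by (auto intro: one_form_coframe[OF open_U U_subset_W])
    moreover have "v (\<lambda>q. coframe Z q (Y q)) = 0" "v (\<lambda>q. coframe Y q (Z q)) = 0"
      using YZ c by (auto intro!: tangent_constant_near[OF vt open_U p, of _ a] simp: coframe_H in_W g_sym)
    ultimately show ?thesis
      using dual_deriv_apply(2)[OF pc p v YZ(1) open_U p U_subset_W of(2)]
        dual_deriv_apply(2)[OF pc p v YZ(2) open_U p U_subset_W of(1)] by simp
  qed
  have on: "g q (X\<^sub>1 q) (X\<^sub>1 q) = 1" "g q (X\<^sub>2 q) (X\<^sub>2 q) = 1" "g q (X\<^sub>1 q) (X\<^sub>2 q) = 0" if "q \<in> U" for q
    using orthonormal that by (auto simp: orthonormal_def)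
  have 11: "D e\<^sub>1 p v (X\<^sub>1 p) = 0" if v: "v \<in> H p" for v
    using skew[OF v fields(2,2) X_H(1) X_H(1) on(1)] by simp
  have 22: "D e\<^sub>2 p v (X\<^sub>2 p) = 0" if v: "v \<in> H p" for v
    using skew[OF v fields(3,3) X_H(2) X_H(2) on(2)] by simp
  show "v \<in> H p \<Longrightarrow> D e\<^sub>1 p v (X\<^sub>1 p) = 0" "v \<in> H p \<Longrightarrow> D e\<^sub>2 p v (X\<^sub>2 p) = 0"
    by (rule 11, assumption, rule 22)
  have 12: "D e\<^sub>2 p v (X\<^sub>1 p) + D e\<^sub>1 p v (X\<^sub>2 p) = 0" if v: "v \<in> H p" for v
    using skew[OF v fields(2,3) X_H(1) X_H(2) on(3)] by simp
  \<comment> \<open>In each of the two torsion equations, skewness removes one of the two terms that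
    contain \<open>D\<close>.\<close>
  have tor: "ext_d \<alpha> p (X\<^sub>1 p) (X\<^sub>2 p) - (D \<alpha> p (X\<^sub>1 p) (X\<^sub>2 p) - D \<alpha> p (X\<^sub>2 p) (X\<^sub>1 p)) = 0" if "one_form U \<alpha>" for \<alpha>
    by (rule tf[unfolded torsion_free_partial_def, rule_format, OF _ p X_H[OF p]]) (use that open_U U_subset_W in simp)
  show t1: "D e\<^sub>1 p (X\<^sub>1 p) (X\<^sub>2 p) = c\<^sub>1 p"
    using tor[OF forms(2)] 11[OF X_H(2)[OF p]] by (simp add: c\<^sub>1_def)
  show t2: "D e\<^sub>2 p (X\<^sub>2 p) (X\<^sub>1 p) = - c\<^sub>2 p"
    using tor[OF forms(3)] 22[OF X_H(1)[OF p]] by (simp add: c\<^sub>2_def)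
  show "D e\<^sub>2 p (X\<^sub>1 p) (X\<^sub>1 p) = - c\<^sub>1 p" using 12[OF X_H(1)[OF p]] t1 by simp
  show "D e\<^sub>1 p (X\<^sub>2 p) (X\<^sub>2 p) = c\<^sub>2 p" using 12[OF X_H(2)[OF p]] t2 by simp
qed

end

section \<open>The promoted connection in an adapted frame\<close>

lemma bilinear_section_tensor:
  assumes "one_form U \<alpha>" "one_form U \<beta>"
  shows "bilinear_section tangent_space tangent_space U (tensor \<alpha> \<beta>)"
  unfolding bilinear_section_def
proof (intro conjI ballI allI impI; (elim conjE)?)
  fix p v assume "p \<in> U"
  then show "linear_on_set (tangent_space p) (\<lambda>u. tensor \<alpha> \<beta> p u v)" "linear_on_set (tangent_space p) (tensor \<alpha> \<beta> p v)"
    using assms by (auto simp: linear_on_set_def tensor_def one_form_add one_form_scale algebra_simps)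
next
  fix V X Y assume "open V" "V \<subseteq> U" "vector_field V X" "vector_field V Y"
  then show "smooth_fun V (\<lambda>p. tensor \<alpha> \<beta> p (X p) (Y p))"
    unfolding tensor_def by (intro smooth_fun_mult one_form_smooth[OF assms(1)] one_form_smooth[OF assms(2)])
qed

lemma bilinear_section_add:
  assumes "bilinear_section tangent_space tangent_space U \<Phi>" "bilinear_section tangent_space tangent_space U \<Psi>"
  shows "bilinear_section tangent_space tangent_space U (\<Phi> + \<Psi>)"
  using assms unfolding bilinear_section_def linear_on_set_def
  by (auto simp: algebra_simps intro!: smooth_fun_add)

text \<open>Supplies the coefficient 1-forms of a tensor expanded in its second factor.\<close>

lemma bilinear_section_contract:
  assumes "bilinear_section tangent_space tangent_space U \<Phi>" "vector_field U Y"
  shows "one_form U (\<lambda>p v. \<Phi> p v (Y p))"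
  unfolding one_form_def
proof (intro conjI ballI allI impI; (elim conjE)?)
  fix p assume "p \<in> U"
  then show "linear_on_set (tangent_space p) (\<lambda>v. \<Phi> p v (Y p))"
    using assms(1) vector_fieldD[OF assms(2)] by (simp add: bilinear_section_def)
next
  fix V X assume V: "open V" "V \<subseteq> U" "vector_field V X"
  then show "smooth_fun V (\<lambda>p. \<Phi> p (X p) (Y p))"
    using assms(1) vector_field_mono[OF assms(2) V(2)] vector_fieldD unfolding bilinear_section_def by blast
qed

lemma promotion_cong:
  assumes "promotion_operator H W D P" "open V" "V \<subseteq> W"
    "bilinear_section tangent_space tangent_space V \<Phi>" "bilinear_section tangent_space tangent_space V \<Psi>"
    "\<And>p v w. p \<in> V \<Longrightarrow> v \<in> tangent_space p \<Longrightarrow> w \<in> tangent_space p \<Longrightarrow> \<Phi> p v w = \<Psi> p v w"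
    "p \<in> V" "u \<in> H p" "v \<in> H p" "w \<in> tangent_space p"
  shows "P \<Phi> p u v w = P \<Psi> p u v w"
  by (rule assms(1)[unfolded promotion_operator_def, THEN conjunct1, rule_format, OF _ assms(7-10)])
    (use assms(2-6) in simp)

lemma promotion_add:
  assumes "promotion_operator H W D P" "open V" "V \<subseteq> W"
    "bilinear_section tangent_space tangent_space V \<Phi>" "bilinear_section tangent_space tangent_space V \<Psi>"
    "p \<in> V" "u \<in> H p" "v \<in> H p" "w \<in> tangent_space p"
  shows "P (\<Phi> + \<Psi>) p u v w = P \<Phi> p u v w + P \<Psi> p u v w"
  by (rule assms(1)[unfolded promotion_operator_def, THEN conjunct2, THEN conjunct1, rule_format, OF _ assms(6-9)])
    (use assms(2-5) in simp)

lemma promotion_tensor: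
  assumes "promotion_operator H W D P" "open V" "V \<subseteq> W" "one_form V \<alpha>" "one_form V \<sigma>"
    "p \<in> V" "u \<in> H p" "v \<in> H p" "w \<in> tangent_space p"
  shows "P (tensor \<alpha> \<sigma>) p u v w = ext_d \<alpha> p u v * \<sigma> p w - (\<alpha> p u * D \<sigma> p v w - \<alpha> p v * D \<sigma> p u w)"
  by (rule assms(1)[unfolded promotion_operator_def, THEN conjunct2, THEN conjunct2, rule_format, OF _ assms(6-9)])
    (use assms(2-5) in simp)

context adapted_frame
begin

text \<open>A promotion operator is accessible only through decomposable tensors and sums, so
  \<open>N \<sigma>\<close> is written as a sum of three terms
  \<open>tensor (\<eta> Y) \<epsilon>\<close>, with \<open>Y\<close> a frame field and \<epsilon>
  its dual form. Each bracketed group is the image of one of them on \<open>X\<^sub>1\<close>,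
  \<open>X\<^sub>2\<close>.\<close>

lemma promotion_equation:
  assumes N: "promoted_connection H W D N" and \<sigma>: "one_form U \<sigma>" and p: "p \<in> U" and w: "w \<in> tangent_space p"
    and \<eta>_def: "\<eta> = (\<lambda>X p v. N \<sigma> p v (X p))"
  shows "(ext_d (\<eta> T) p (X\<^sub>1 p) (X\<^sub>2 p) * \<theta> p w
        - (\<eta> T p (X\<^sub>1 p) * D \<theta> p (X\<^sub>2 p) w - \<eta> T p (X\<^sub>2 p) * D \<theta> p (X\<^sub>1 p) w))
    + (ext_d (\<eta> X\<^sub>1) p (X\<^sub>1 p) (X\<^sub>2 p) * e\<^sub>1 p w
        - (\<eta> X\<^sub>1 p (X\<^sub>1 p) * D e\<^sub>1 p (X\<^sub>2 p) w - \<eta> X\<^sub>1 p (X\<^sub>2 p) * D e\<^sub>1 p (X\<^sub>1 p) w))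
    + (ext_d (\<eta> X\<^sub>2) p (X\<^sub>1 p) (X\<^sub>2 p) * e\<^sub>2 p w
        - (\<eta> X\<^sub>2 p (X\<^sub>1 p) * D e\<^sub>2 p (X\<^sub>2 p) w - \<eta> X\<^sub>2 p (X\<^sub>2 p) * D e\<^sub>2 p (X\<^sub>1 p) w)) = 0"
proof -
  have conn: "connection W N" using N by (simp add: promoted_connection_def)
  obtain P where P: "promotion_operator H W D P"
    and P0: "\<forall>U \<alpha>. open U \<and> U \<subseteq> W \<and> one_form U \<alpha> \<longrightarrow>
           (\<forall>p\<in>U. \<forall>u\<in>H p. \<forall>v\<in>H p. \<forall>w\<in>tangent_space p. P (N \<alpha>) p u v w = 0)"
    using N[unfolded promoted_connection_def, THEN conjunct2, THEN conjunct2] by (elim exE conjE)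
  have N\<sigma>: "bilinear_section tangent_space tangent_space U (N \<sigma>)"
    by (rule partial_connection_section[OF conn open_U U_subset_W \<sigma>])
  have \<eta>: "one_form U (\<eta> T)" "one_form U (\<eta> X\<^sub>1)" "one_form U (\<eta> X\<^sub>2)"
    unfolding \<eta>_def by (intro bilinear_section_contract[OF N\<sigma>] fields)+
  note t = bilinear_section_tensor[OF \<eta>(1) forms(1)] bilinear_section_tensor[OF \<eta>(2) forms(2)]
    bilinear_section_tensor[OF \<eta>(3) forms(3)]
  have "P (N \<sigma>) p (X\<^sub>1 p) (X\<^sub>2 p) w =
      P (tensor (\<eta> T) \<theta> + tensor (\<eta> X\<^sub>1) e\<^sub>1 + tensor (\<eta> X\<^sub>2) e\<^sub>2) p (X\<^sub>1 p) (X\<^sub>2 p) w"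
  proof (rule promotion_cong[OF P open_U U_subset_W N\<sigma> _ _ p X_H[OF p] w])
    show "bilinear_section tangent_space tangent_space U (tensor (\<eta> T) \<theta> + tensor (\<eta> X\<^sub>1) e\<^sub>1 + tensor (\<eta> X\<^sub>2) e\<^sub>2)"
      by (intro bilinear_section_add t)
    fix q u v assume q: "q \<in> U" and u: "u \<in> tangent_space q" and v: "v \<in> tangent_space q"
    have lin: "linear_on_set (tangent_space q) (N \<sigma> q u)"
      using N\<sigma> q u by (simp add: bilinear_section_def)
    show "N \<sigma> q u v = (tensor (\<eta> T) \<theta> + tensor (\<eta> X\<^sub>1) e\<^sub>1 + tensor (\<eta> X\<^sub>2) e\<^sub>2) q u v"
      using linear_expand[OF q lin v] by (simp add: tensor_def \<eta>_def mult.commute)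
  qed
  moreover have "P (N \<sigma>) p (X\<^sub>1 p) (X\<^sub>2 p) w = 0"
    by (rule P0[rule_format, OF _ p X_H[OF p] w]) (use open_U U_subset_W \<sigma> in simp)
  ultimately show ?thesis
    by (simp add: promotion_add[OF P open_U U_subset_W _ _ p X_H[OF p] w] t bilinear_section_add
        promotion_tensor[OF P open_U U_subset_W _ _ p X_H[OF p] w] \<eta> forms)
qed

lemma frame_derivative_const: "p \<in> U \<Longrightarrow> (\<And>q. q \<in> U \<Longrightarrow> f q = c) \<Longrightarrow> X\<^sub>1 p f = 0"
  "p \<in> U \<Longrightarrow> (\<And>q. q \<in> U \<Longrightarrow> f q = c) \<Longrightarrow> X\<^sub>2 p f = 0"
  using tangent_constant_near[OF _ open_U] frame_tangent by blast+

text \<open>The components of the promotion equation are solved for the derivative in the direction of \<open>T\<close>.\<close>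

lemma promoted_values:
  assumes D: "canonical_partial_connection H g W \<theta> T D" and N: "promoted_connection H W D N"
    and p: "p \<in> U" and v: "v \<in> tangent_space p" and w: "w \<in> tangent_space p"
  defines "R \<equiv> ext_d \<omega> p (X\<^sub>1 p) (X\<^sub>2 p)"
  shows "N \<theta> p v w = 1/2 * (e\<^sub>1 p v * e\<^sub>2 p w - e\<^sub>1 p w * e\<^sub>2 p v)"
    and "N e\<^sub>1 p v w = \<omega> p v * e\<^sub>2 p w - R * \<theta> p v * e\<^sub>2 p w"
    and "N e\<^sub>2 p v w = - \<omega> p v * e\<^sub>1 p w + R * \<theta> p v * e\<^sub>1 p w"
proof -
  have conn: "connection W N" using N by (simp add: promoted_connection_def)
  have ND: "N \<sigma> q u u' = D \<sigma> q u u'" if "one_form U \<sigma>" "q \<in> U" "u \<in> H q" "u' \<in> tangent_space q" for \<sigma> q u u'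
    by (rule N[unfolded promoted_connection_def, THEN conjunct2, THEN conjunct1, rule_format, OF _ that(2-4)])
      (use that open_U U_subset_W in simp)
  note cv = canonical_values[OF D]
  have D\<theta>: "D \<theta> q (X\<^sub>1 q) (X\<^sub>1 q) = 0" "D \<theta> q (X\<^sub>1 q) (X\<^sub>2 q) = 1/2"
    "D \<theta> q (X\<^sub>2 q) (X\<^sub>1 q) = - 1/2" "D \<theta> q (X\<^sub>2 q) (X\<^sub>2 q) = 0" if q: "q \<in> U" for q
    using cv(1)[OF q X_H(1)[OF q] frame_tangent(2)[OF q]] cv(1)[OF q X_H(1)[OF q] frame_tangent(3)[OF q]]
      cv(1)[OF q X_H(2)[OF q] frame_tangent(2)[OF q]] cv(1)[OF q X_H(2)[OF q] frame_tangent(3)[OF q]]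
      frame_tangent[OF q] dual[OF q]
    by (simp_all add: ext_d_\<theta>[OF q])
  have DT: "D \<epsilon> q (X\<^sub>1 q) (T q) = 0" "D \<epsilon> q (X\<^sub>2 q) (T q) = 0"
    if q: "q \<in> U" and \<epsilon>: "\<epsilon> = \<theta> \<or> \<epsilon> = e\<^sub>1 \<or> \<epsilon> = e\<^sub>2" for q \<epsilon>
    using \<epsilon> cv(2)[OF q X_H(1)[OF q]] cv(2)[OF q X_H(2)[OF q]] forms
      frame_derivative_const[OF q, of _ 1] frame_derivative_const[OF q, of _ 0] dual by auto
  \<comment> \<open>\<open>\<eta> \<sigma> Y\<close> is the coefficient of \<open>N \<sigma>\<close>
    along the form dual to \<open>Y\<close>. On \<open>H\<close> it is a value of \<open>D\<close>;
    on \<open>T\<close> it is the unknown to be found.\<close>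
  define \<eta> where "\<eta> = (\<lambda>\<sigma> X p v. N \<sigma> p v (X p))"
  have \<eta>1: "one_form U (\<eta> \<sigma> Y)" if "one_form U \<sigma>" "vector_field U Y" for \<sigma> Y
    unfolding \<eta>_def
    by (rule bilinear_section_contract[OF partial_connection_section[OF conn open_U U_subset_W that(1)] that(2)])
  have \<eta>H: "\<eta> \<sigma> Y q u = D \<sigma> q u (Y q)" if "one_form U \<sigma>" "q \<in> U" "u \<in> H q" "vector_field U Y" for \<sigma> Y q u
    unfolding \<eta>_def by (rule ND[OF that(1-3) vector_fieldD[OF that(4,2)]])
  have \<eta>_eq: "\<eta> \<sigma> = (\<lambda>X p v. N \<sigma> p v (X p))" for \<sigma> by (simp add: \<eta>_def)
  note eq\<theta> = promotion_equation[OF N forms(1) p, OF _ \<eta>_eq[of \<theta>]]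
    and eq1 = promotion_equation[OF N forms(2) p, OF _ \<eta>_eq[of e\<^sub>1]]
    and eq2 = promotion_equation[OF N forms(3) p, OF _ \<eta>_eq[of e\<^sub>2]]
  note val = D\<theta> DT cv(3-8) X_H dual \<eta>H forms fields
  \<comment> \<open>The coefficient forms are known on \<open>H\<close>, so their value on
    \<open>T\<close> is the one unknown in this derivative.\<close>
  have ext: "ext_d (\<eta> \<sigma> Y) p (X\<^sub>1 p) (X\<^sub>2 p) = X\<^sub>1 p (\<lambda>q. D \<sigma> q (X\<^sub>2 q) (Y q)) - X\<^sub>2 p (\<lambda>q. D \<sigma> q (X\<^sub>1 q) (Y q))
    + \<eta> \<sigma> Y p (T p) + c\<^sub>1 p * D \<sigma> p (X\<^sub>1 p) (Y p) + c\<^sub>2 p * D \<sigma> p (X\<^sub>2 p) (Y p)"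
    if \<sigma>: "one_form U \<sigma>" and Y: "vector_field U Y" for \<sigma> Y
  proof -
    have "X\<^sub>1 p (\<lambda>q. \<eta> \<sigma> Y q (X\<^sub>2 q)) = X\<^sub>1 p (\<lambda>q. D \<sigma> q (X\<^sub>2 q) (Y q))"
      "X\<^sub>2 p (\<lambda>q. \<eta> \<sigma> Y q (X\<^sub>1 q)) = X\<^sub>2 p (\<lambda>q. D \<sigma> q (X\<^sub>1 q) (Y q))"
      using tangent_local[OF frame_tangent(2)[OF p] open_U p, of "\<lambda>q. \<eta> \<sigma> Y q (X\<^sub>2 q)" "\<lambda>q. D \<sigma> q (X\<^sub>2 q) (Y q)"]
        tangent_local[OF frame_tangent(3)[OF p] open_U p, of "\<lambda>q. \<eta> \<sigma> Y q (X\<^sub>1 q)" "\<lambda>q. D \<sigma> q (X\<^sub>1 q) (Y q)"]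
        \<eta>H[OF \<sigma> _ _ Y] X_H by simp_all
    then show ?thesis
      using ext_d_X[OF p \<eta>1[OF \<sigma> Y]] \<eta>H[OF \<sigma> p _ Y] X_H[OF p] by simp
  qed
  have dconst: "X\<^sub>1 p (\<lambda>q. D \<sigma> q (X\<^sub>2 q) (Y q)) = 0" "X\<^sub>2 p (\<lambda>q. D \<sigma> q (X\<^sub>1 q) (Y q)) = 0"
    if "\<And>q. q \<in> U \<Longrightarrow> D \<sigma> q (X\<^sub>2 q) (Y q) = a" "\<And>q. q \<in> U \<Longrightarrow> D \<sigma> q (X\<^sub>1 q) (Y q) = b" for \<sigma> Y a b
    using frame_derivative_const(1)[OF p that(1)] frame_derivative_const(2)[OF p that(2)] by simp_all
  \<comment> \<open>The same formula for \<omega>, whose values on \<open>X\<^sub>1\<close>,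
    \<open>X\<^sub>2\<close> are \<open>c\<^sub>1\<close>, \<open>c\<^sub>2\<close>; comparison with
    \<open>ext\<close> isolates \<open>R\<close>.\<close>
  have R: "R = X\<^sub>1 p c\<^sub>2 - X\<^sub>2 p c\<^sub>1 + \<omega> p (T p) + c\<^sub>1 p * c\<^sub>1 p + c\<^sub>2 p * c\<^sub>2 p"
  proof -
    have w: "\<omega> q (X\<^sub>1 q) = c\<^sub>1 q" "\<omega> q (X\<^sub>2 q) = c\<^sub>2 q" if "q \<in> U" for q
      using dual[OF that] by (simp_all add: \<omega>_apply)
    show ?thesis
      unfolding R_def ext_d_X[OF p one_form_\<omega>]
      using tangent_local[OF frame_tangent(2)[OF p] open_U p, of "\<lambda>q. \<omega> q (X\<^sub>2 q)" c\<^sub>2]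
        tangent_local[OF frame_tangent(3)[OF p] open_U p, of "\<lambda>q. \<omega> q (X\<^sub>1 q)" c\<^sub>1] w p by simp
  qed
  have dcc: "X\<^sub>1 p (\<lambda>q. D e\<^sub>1 q (X\<^sub>2 q) (X\<^sub>2 q)) = X\<^sub>1 p c\<^sub>2" "X\<^sub>2 p (\<lambda>q. D e\<^sub>1 q (X\<^sub>1 q) (X\<^sub>2 q)) = X\<^sub>2 p c\<^sub>1"
    "X\<^sub>1 p (\<lambda>q. D e\<^sub>2 q (X\<^sub>2 q) (X\<^sub>1 q)) = - X\<^sub>1 p c\<^sub>2" "X\<^sub>2 p (\<lambda>q. D e\<^sub>2 q (X\<^sub>1 q) (X\<^sub>1 q)) = - X\<^sub>2 p c\<^sub>1"
    using tangent_local[OF frame_tangent(2)[OF p] open_U p, of "\<lambda>q. D e\<^sub>1 q (X\<^sub>2 q) (X\<^sub>2 q)" c\<^sub>2]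
      tangent_local[OF frame_tangent(3)[OF p] open_U p, of "\<lambda>q. D e\<^sub>1 q (X\<^sub>1 q) (X\<^sub>2 q)" c\<^sub>1]
      tangent_local[OF frame_tangent(2)[OF p] open_U p, of "\<lambda>q. D e\<^sub>2 q (X\<^sub>2 q) (X\<^sub>1 q)" "\<lambda>q. - c\<^sub>2 q"]
      tangent_local[OF frame_tangent(3)[OF p] open_U p, of "\<lambda>q. D e\<^sub>2 q (X\<^sub>1 q) (X\<^sub>1 q)" "\<lambda>q. - c\<^sub>1 q"]
      tangent_minus[OF frame_tangent(2)[OF p] smooth_nearI[OF open_U p smooth_coefficients(2)]]
      tangent_minus[OF frame_tangent(3)[OF p] smooth_nearI[OF open_U p smooth_coefficients(1)]]
      cv(5-8) by simp_all
  \<comment> \<open>The parameters are constant values of \<open>D\<close> on frame vectors; those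
    of \<theta> are 0, 1/2 and -1/2 because \<open>D \<theta>\<close> is half of d\<theta>.\<close>
  note dc = dconst[of \<theta> T 0 0] dconst[of \<theta> X\<^sub>1 "- 1/2" 0] dconst[of \<theta> X\<^sub>2 0 "1/2"]
    dconst[of e\<^sub>1 T 0 0] dconst[of e\<^sub>1 X\<^sub>1 0 0] dconst[of e\<^sub>2 T 0 0] dconst[of e\<^sub>2 X\<^sub>2 0 0]
  \<comment> \<open>Nine unknowns from three forms tested on three frame vectors. For \<theta> the
    terms in \<open>c\<^sub>1\<close>, \<open>c\<^sub>2\<close> cancel. For \<open>e\<^sub>1\<close>
    and \<open>e\<^sub>2\<close> the nontrivial equation says that a form equal on \<open>H\<close>
    to \<omega> or its negative has zero derivative on \<open>X\<^sub>1\<close>,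
    \<open>X\<^sub>2\<close>, while d\<omega> has the value \<open>R\<close> there.\<close>
  have \<eta>T: "\<eta> \<theta> T p (T p) = 0" "\<eta> \<theta> X\<^sub>1 p (T p) = 0" "\<eta> \<theta> X\<^sub>2 p (T p) = 0"
    "\<eta> e\<^sub>1 T p (T p) = 0" "\<eta> e\<^sub>1 X\<^sub>1 p (T p) = 0" "\<eta> e\<^sub>1 X\<^sub>2 p (T p) = \<omega> p (T p) - R"
    "\<eta> e\<^sub>2 T p (T p) = 0" "\<eta> e\<^sub>2 X\<^sub>1 p (T p) = - \<omega> p (T p) + R" "\<eta> e\<^sub>2 X\<^sub>2 p (T p) = 0"
    using eq\<theta>[OF frame_tangent(1)[OF p]] eq\<theta>[OF frame_tangent(2)[OF p]] eq\<theta>[OF frame_tangent(3)[OF p]]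
      eq1[OF frame_tangent(1)[OF p]] eq1[OF frame_tangent(2)[OF p]] eq1[OF frame_tangent(3)[OF p]]
      eq2[OF frame_tangent(1)[OF p]] eq2[OF frame_tangent(2)[OF p]] eq2[OF frame_tangent(3)[OF p]]
    by (simp_all add: val p ext dc dcc R algebra_simps)
  have comp: "N \<sigma> p v w =
      (\<theta> p v * \<eta> \<sigma> T p (T p) + e\<^sub>1 p v * D \<sigma> p (X\<^sub>1 p) (T p) + e\<^sub>2 p v * D \<sigma> p (X\<^sub>2 p) (T p)) * \<theta> p w
    + (\<theta> p v * \<eta> \<sigma> X\<^sub>1 p (T p) + e\<^sub>1 p v * D \<sigma> p (X\<^sub>1 p) (X\<^sub>1 p) + e\<^sub>2 p v * D \<sigma> p (X\<^sub>2 p) (X\<^sub>1 p)) * e\<^sub>1 p w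
    + (\<theta> p v * \<eta> \<sigma> X\<^sub>2 p (T p) + e\<^sub>1 p v * D \<sigma> p (X\<^sub>1 p) (X\<^sub>2 p) + e\<^sub>2 p v * D \<sigma> p (X\<^sub>2 p) (X\<^sub>2 p)) * e\<^sub>2 p w"
    if \<sigma>: "one_form U \<sigma>" for \<sigma>
  proof -
    have lin: "linear_on_set (tangent_space p) (N \<sigma> p v)"
      using partial_connection_section[OF conn open_U U_subset_W \<sigma>] p v by (simp add: bilinear_section_def)
    have "N \<sigma> p v w = \<theta> p w * \<eta> \<sigma> T p v + e\<^sub>1 p w * \<eta> \<sigma> X\<^sub>1 p v + e\<^sub>2 p w * \<eta> \<sigma> X\<^sub>2 p v"
      unfolding \<eta>_def using linear_expand[OF p lin w] by simp
    then show ?thesis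
      using form_expand[OF p \<eta>1[OF \<sigma> fields(1)] p v] form_expand[OF p \<eta>1[OF \<sigma> fields(2)] p v]
        form_expand[OF p \<eta>1[OF \<sigma> fields(3)] p v] \<eta>H[OF \<sigma> p] X_H[OF p] fields by (simp add: mult.commute)
  qed
  show "N \<theta> p v w = 1/2 * (e\<^sub>1 p v * e\<^sub>2 p w - e\<^sub>1 p w * e\<^sub>2 p v)"
    unfolding comp[OF forms(1)] \<eta>T by (simp add: val p algebra_simps)
  show "N e\<^sub>1 p v w = \<omega> p v * e\<^sub>2 p w - R * \<theta> p v * e\<^sub>2 p w"
    unfolding comp[OF forms(2)] \<eta>T \<omega>_apply using dual[OF p] by (simp add: val p algebra_simps)
  show "N e\<^sub>2 p v w = - \<omega> p v * e\<^sub>1 p w + R * \<theta> p v * e\<^sub>1 p w"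
    unfolding comp[OF forms(3)] \<eta>T \<omega>_apply using dual[OF p] by (simp add: val p algebra_simps)
qed

lemma tanaka_webster_values:
  assumes N: "tanaka_webster_connection H g W \<theta> N"
    and p: "p \<in> U" and v: "v \<in> tangent_space p" and w: "w \<in> tangent_space p"
  shows "N \<theta> p v w = 0" "N e\<^sub>1 p v w = \<omega> p v * e\<^sub>2 p w" "N e\<^sub>2 p v w = - \<omega> p v * e\<^sub>1 p w"
proof -
  show "N \<theta> p v w = 0"
    by (rule N[unfolded tanaka_webster_connection_def, THEN conjunct2, THEN conjunct1, rule_format, OF in_W[OF p] v w])
  have "N e\<^sub>1 p v w = tensor \<omega> e\<^sub>2 p v w \<and> N e\<^sub>2 p v w = - tensor \<omega> e\<^sub>1 p v w"
    by (rule N[unfolded tanaka_webster_connection_def, THEN conjunct2, THEN conjunct2, rule_format, OF _ p v w])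
      (use open_U U_subset_W adapted_coframe structure_equations in blast)
  then show "N e\<^sub>1 p v w = \<omega> p v * e\<^sub>2 p w" "N e\<^sub>2 p v w = - \<omega> p v * e\<^sub>1 p w" by (simp_all add: tensor_def)
qed

end

section \<open>The difference of the promoted and the Tanaka-Webster connection\<close>

theorem mainTheorem2:
  fixes H :: "'a::smooth_3_manifold \<Rightarrow> 'a tvec set"
    and g :: "'a form2" and W :: "'a set" and \<theta> :: "'a form1" and T :: "'a \<Rightarrow> 'a tvec"
    and nabla_H nabla nabla_TW :: "'a form1 \<Rightarrow> 'a form2"
    and R :: "'a \<Rightarrow> real"
  assumes "sub_riemannian_contact H g"
    and "open W"
    and "normalised_contact_form H g W \<theta>"
    and "reeb_field W \<theta> T"
    and "canonical_partial_connection H g W \<theta> T nabla_H"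
    and "promoted_connection H W nabla_H nabla"
    and "tanaka_webster_connection H g W \<theta> nabla_TW"
    and "tanaka_webster_curvature H g W \<theta> R"
  shows "\<forall>U \<sigma> \<rho>. open U \<and> U \<subseteq> W \<and> horizontal_form U T \<sigma> \<and> smooth_fun U \<rho> \<longrightarrow>
    (\<forall>p\<in>U. \<forall>v\<in>tangent_space p. \<forall>w\<in>tangent_space p.
       (nabla (\<sigma> + fun_form \<rho> \<theta>) - nabla_TW (\<sigma> + fun_form \<rho> \<theta>)) p v w =
         R p * tensor \<theta> (extend1 \<theta> T (J_form H g \<theta> \<sigma>)) p v w
         + \<rho> p * form2_tensor (extend2 \<theta> T (ext_d \<theta>)) p v w)"
proof (intro allI impI ballI, elim conjE)
  fix V \<sigma> \<rho> p v w
  assume V: "open V" "V \<subseteq> W" "p \<in> V" and \<sigma>: "horizontal_form V T \<sigma>" and \<rho>: "smooth_fun V \<rho>"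
    and v: "v \<in> tangent_space p" and w: "w \<in> tangent_space p"
  interpret contact_structure H g W \<theta> T
    using assms by unfold_locales
  have pW: "p \<in> W" using V by auto
  \<comment> \<open>The claim is pointwise and mentions no frame, so any adapted frame around
    \<open>p\<close> will do; it is taken inside \<open>V\<close>, where \<sigma> and \<rho> are
    defined.\<close>
  obtain U X\<^sub>1 X\<^sub>2 where fr: "adapted_frame H g W \<theta> T U X\<^sub>1 X\<^sub>2" and p: "p \<in> U" and UV: "U \<subseteq> V"
    using adapted_frame_exists[OF pW V(1,3)] .
  interpret adapted_frame H g W \<theta> T U X\<^sub>1 X\<^sub>2 by (rule fr)
  define \<tau> where "\<tau> = \<sigma> + fun_form \<rho> \<theta>"
  have \<sigma>1: "one_form U \<sigma>" and \<sigma>T: "\<sigma> p (T p) = 0"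
    using \<sigma> V(3) one_form_mono[OF _ UV] by (auto simp: horizontal_form_def)
  have \<tau>1: "one_form U \<tau>"
    unfolding \<tau>_def by (intro one_form_plus one_form_fun_form \<sigma>1 forms smooth_fun_mono[OF \<rho> UV])
  have \<tau>: "\<tau> p (T p) = \<rho> p" "\<tau> p (X\<^sub>1 p) = \<sigma> p (X\<^sub>1 p)" "\<tau> p (X\<^sub>2 p) = \<sigma> p (X\<^sub>2 p)"
    using dual[OF p] \<sigma>T by (simp_all add: \<tau>_def fun_form_def)
  have N: "connection W nabla" and N': "connection W nabla_TW"
    using assms(6,7) by (auto simp: promoted_connection_def tanaka_webster_connection_def)
  \<comment> \<open>The derivative terms of the two expansions coincide and cancel, leaving the
    differences on the coframe weighted by \<rho> and the components of \<sigma>.\<close>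
  note expand_N = connection_expand[OF N open_U subset_refl p \<tau>1 v w]
    and expand_N' = connection_expand[OF N' open_U subset_refl p \<tau>1 v w]
  have R: "ext_d \<omega> p (X\<^sub>1 p) (X\<^sub>2 p) = R p" using curvature_eq[OF assms(8) p] by simp
  let ?w = "H_proj \<theta> T p w" and ?v = "H_proj \<theta> T p v"
  have proj: "?w \<in> H p" "?v \<in> H p" using H_proj_H[OF pW] v w by auto
  have eproj: "coframe X p (H_proj \<theta> T p u) = coframe X p u" if "u \<in> tangent_space p" for X u
    using H_proj_H[OF pW that] by (simp add: coframe_def H_proj_id[OF pW])
  \<comment> \<open>The \<open>R\<close> terms of \<open>promoted_values\<close>, weighted by the
    components of \<sigma>, add up to exactly this combination.\<close>
  have J: "J_form H g \<theta> \<sigma> p ?w = e\<^sub>1 p w * \<sigma> p (X\<^sub>2 p) - e\<^sub>2 p w * \<sigma> p (X\<^sub>1 p)"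
    using frame_tangent[OF p]
    by (simp add: J_form_def J_map_eq[OF p proj(1)] eproj[OF w] one_form_diff[OF \<sigma>1 p] one_form_scale[OF \<sigma>1 p]
        tangent_space_scale)
  have d\<theta>: "ext_d \<theta> p ?v ?w = e\<^sub>1 p v * e\<^sub>2 p w - e\<^sub>1 p w * e\<^sub>2 p v"
    using ext_d_\<theta>[OF p H_tangent[OF proj(2)] H_tangent[OF proj(1)]] by (simp add: eproj v w)
  show "(nabla (\<sigma> + fun_form \<rho> \<theta>) - nabla_TW (\<sigma> + fun_form \<rho> \<theta>)) p v w =
         R p * tensor \<theta> (extend1 \<theta> T (J_form H g \<theta> \<sigma>)) p v w
         + \<rho> p * form2_tensor (extend2 \<theta> T (ext_d \<theta>)) p v w"
    unfolding \<tau>_def[symmetric]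
    by (simp add: expand_N expand_N' \<tau> promoted_values[OF assms(5,6) p v w] tanaka_webster_values[OF assms(7) p v w]
        R J d\<theta> tensor_def extend1_def extend2_def form2_tensor_def scaleR_fun_def)
      (simp add: field_simps)
qed

end
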